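(* Unless $\mathsf{P}=\#\mathsf{P}$ (i.e. unless every $\#\mathsf{P}$ function is computable in polynomial time), there is no polynomial-time algorithm that, given an ERGM, computes its partition function exactly.
   Context: An exponential random graph model (ERGM) on the vertex set $V=\{1,\dots,n\}$ is given by a finite list of features $f$, each a function from the set of all simple graphs on $V$ to the nonnegative integers (e.g. $0$-$1$ indicators that a specified pair of vertices is an edge, or the count of triangles), together with an integer weight $w_f$ for each feature, given in binary as part of the input. The density of a graph $H$ on $V$ is $d(H)=\prod_f 2^{f(H)w_f}$, the partition function is $Z=\sum_H d(H)$ (sum over all simple graphs on $V$), and the probability of $H$ is $d(H)/Z$. *)

theory Defs
  imports Complex_Main "HOL-Computational_Algebra.Polynomial"
begin

section \<open>Deterministic multi-tape Turing machines\<close>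

text \<open>
  States and tape symbols are initial segments of the naturals; state 0 is initial, state 1 is
  halting, symbol 0 is blank, symbols 1 and 2 are the input bits. Tapes are infinite in both
  directions. Tape 0 holds the input at the start and the output (and nothing else) at the end.
\<close>

record tm =
  ntapes :: nat
  nstates :: nat
  nsymbols :: nat
  delta :: "nat \<Rightarrow> nat list \<Rightarrow> nat \<times> (nat \<times> int) list"

definition turing_machine :: "tm \<Rightarrow> bool" where
  "turing_machine M \<longleftrightarrow>
     1 \<le> ntapes M \<and> 2 \<le> nstates M \<and> 3 \<le> nsymbols M \<and>
     (\<forall>q < nstates M. \<forall>ss. length ss = ntapes M \<and> (\<forall>s \<in> set ss. s < nsymbols M) \<longrightarrow>
        (let (q', as) = delta M q ss in
           q' < nstates M \<and> length as = ntapes M \<and>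
           (\<forall>(s, d) \<in> set as. s < nsymbols M \<and> d \<in> {-1, 0, 1})))"

type_synonym tape = "(int \<Rightarrow> nat) \<times> int"
type_synonym config = "nat \<times> tape list"

definition tape_of :: "bool list \<Rightarrow> int \<Rightarrow> nat" where
  "tape_of xs i =
     (if 0 \<le> i \<and> i < int (length xs) then (if xs ! nat i then 2 else 1) else 0)"

definition initial_config :: "tm \<Rightarrow> bool list \<Rightarrow> config" where
  "initial_config M xs = (0, (tape_of xs, 0) # replicate (ntapes M - 1) (\<lambda>_. 0, 0))"

definition step :: "tm \<Rightarrow> config \<Rightarrow> config" where
  "step M = (\<lambda>(q, ts).
     if q = 1 then (q, ts)
     else let (q', as) = delta M q (map (\<lambda>(c, h). c h) ts)
          in (q', map2 (\<lambda>(c, h) (s, d). (c(h := s), h + d)) ts as))"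

definition computes_within :: "tm \<Rightarrow> bool list \<Rightarrow> bool list \<Rightarrow> nat \<Rightarrow> bool" where
  "computes_within M xs ys t \<longleftrightarrow>
     (let (q, ts) = (step M ^^ t) (initial_config M xs) in q = 1 \<and> fst (ts ! 0) = tape_of ys)"


section \<open>Polynomial time and \<open>#P\<close>\<close>

text \<open>
  An algorithm for a problem with instance set \<open>A\<close>, where the instance \<open>a\<close> is presented as the
  string \<open>inp a\<close> and has to be answered by the string \<open>out a\<close>.
\<close>

definition polytime_algorithm :: "'a set \<Rightarrow> ('a \<Rightarrow> bool list) \<Rightarrow> ('a \<Rightarrow> bool list) \<Rightarrow> bool" where
  "polytime_algorithm A inp out \<longleftrightarrow>
     (\<exists>M (p :: nat poly). turing_machine M \<and>
        (\<forall>a \<in> A. computes_within M (inp a) (out a) (poly p (length (inp a)))))"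

text \<open>
  The same with time polynomial in the joint length of input and output, the appropriate notion
  when outputs may be exponentially long in the input.
\<close>

definition output_polytime_algorithm ::
    "'a set \<Rightarrow> ('a \<Rightarrow> bool list) \<Rightarrow> ('a \<Rightarrow> bool list) \<Rightarrow> bool" where
  "output_polytime_algorithm A inp out \<longleftrightarrow>
     (\<exists>M (p :: nat poly). turing_machine M \<and>
        (\<forall>a \<in> A. computes_within M (inp a) (out a) (poly p (length (inp a) + length (out a)))))"

definition polytime_computable :: "(bool list \<Rightarrow> bool list) \<Rightarrow> bool" where
  "polytime_computable f \<longleftrightarrow> polytime_algorithm UNIV (\<lambda>x. x) f"

text \<open>Binary notation, least significant bit first, without superfluous zeros.\<close>

fun nat_bits :: "nat \<Rightarrow> bool list" where
  "nat_bits n = (if n = 0 then [] else odd n # nat_bits (n div 2))"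

declare nat_bits.simps [simp del]

text \<open>Prefix-free coding of strings, so that codes may be concatenated.\<close>

definition delimit :: "bool list \<Rightarrow> bool list" where
  "delimit xs = concat (map (\<lambda>b. [True, b]) xs) @ [False]"

text \<open>\<open>#P\<close>: the functions counting the accepted certificates of a polynomial-time verifier.\<close>

definition sharpP :: "(bool list \<Rightarrow> nat) set" where
  "sharpP = {f. \<exists>V (p :: nat poly). polytime_computable V \<and>
     (\<forall>x. f x = card {y. length y = poly p (length x) \<and> V (delimit x @ y) = [True]})}"

definition P_eq_sharpP :: bool where
  "P_eq_sharpP \<longleftrightarrow> (\<forall>f \<in> sharpP. polytime_computable (\<lambda>x. nat_bits (f x)))"


section \<open>Exponential random graph models\<close>

text \<open>A simple graph on \<open>{1..n}\<close> is identified with its set of edges.\<close>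

type_synonym graph = "nat set set"

definition simple_graphs :: "nat \<Rightarrow> graph set" where
  "simple_graphs n = Pow {e. e \<subseteq> {1..n} \<and> card e = 2}"

definition triangle_count :: "graph \<Rightarrow> nat" where
  "triangle_count H = card {T. card T = 3 \<and> (\<forall>e. e \<subseteq> T \<and> card e = 2 \<longrightarrow> e \<in> H)}"

text \<open>
  To be part of an input, a feature needs a name. Edge indicators and the triangle count have fixed
  names; \<open>Other s\<close> names a further feature by a string \<open>s\<close>, whose meaning on graphs with vertex set
  \<open>{1..n}\<close> is given by a parameter \<open>ext s n\<close>. As \<open>ext\<close> is arbitrary, any functions from graphs to
  naturals may occur as features, under any naming scheme (formulas, circuits, programs, ...).
\<close>

datatype feature = Edge nat nat | Triangles | Other "bool list"

type_synonym feature_meaning = "bool list \<Rightarrow> nat \<Rightarrow> graph \<Rightarrow> nat"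

fun feature_value :: "feature_meaning \<Rightarrow> nat \<Rightarrow> feature \<Rightarrow> graph \<Rightarrow> nat" where
  "feature_value ext n (Edge u v) H = (if {u, v} \<in> H then 1 else 0)"
| "feature_value ext n Triangles H = triangle_count H"
| "feature_value ext n (Other s) H = ext s n H"

record ergm =
  num_vertices :: nat
  weighted_features :: "(feature \<times> int) list"

fun valid_feature :: "nat \<Rightarrow> feature \<Rightarrow> bool" where
  "valid_feature n (Edge u v) \<longleftrightarrow> u \<in> {1..n} \<and> v \<in> {1..n} \<and> u \<noteq> v"
| "valid_feature n Triangles \<longleftrightarrow> True"
| "valid_feature n (Other s) \<longleftrightarrow> True"

definition ergms :: "ergm set" where
  "ergms = {E. \<forall>(f, w) \<in> set (weighted_features E). valid_feature (num_vertices E) f}"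

text \<open>Weights may be negative, so densities and the partition function are rational.\<close>

definition density :: "feature_meaning \<Rightarrow> ergm \<Rightarrow> graph \<Rightarrow> rat" where
  "density ext E H =
     (\<Prod>(f, w) \<leftarrow> weighted_features E.
        2 powi (int (feature_value ext (num_vertices E) f H) * w))"

definition partition_function :: "feature_meaning \<Rightarrow> ergm \<Rightarrow> rat" where
  "partition_function ext E = (\<Sum>H \<in> simple_graphs (num_vertices E). density ext E H)"


section \<open>Input and output encodings\<close>

definition encode_nat :: "nat \<Rightarrow> bool list" where
  "encode_nat n = delimit (nat_bits n)"

definition encode_int :: "int \<Rightarrow> bool list" where
  "encode_int k = (k < 0) # encode_nat (nat \<bar>k\<bar>)"

fun encode_feature :: "feature \<Rightarrow> bool list" where
  "encode_feature (Edge u v) = [False, False] @ encode_nat u @ encode_nat v"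
| "encode_feature Triangles = [False, True]"
| "encode_feature (Other s) = [True] @ delimit s"

text \<open>
  The number of vertices is written in unary: the size of an instance includes the size of its
  vertex set. Weights are written in binary.
\<close>

definition encode_ergm :: "ergm \<Rightarrow> bool list" where
  "encode_ergm E =
     replicate (num_vertices E) True @ [False] @
     concat (map (\<lambda>(f, w). [True] @ encode_feature f @ encode_int w) (weighted_features E)) @
     [False]"

text \<open>A rational is written as a fraction in lowest terms, in binary.\<close>

definition encode_rat :: "rat \<Rightarrow> bool list" where
  "encode_rat r = (let (a, b) = quotient_of r in encode_int a @ encode_int b)"

end

theory Submission
  imports Defs "HOL-Computational_Algebra.Primes"
begin

text \<open>
  A \<open>#P\<close> function counts the strings \<open>y\<close> accepted by a polynomial-time machine on \<open>(x, y)\<close>. The space-time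
  diagrams of accepting runs are the tilings of a rectangle with pairwise constraints between
  neighbouring tiles, hence correspond to the independent sets of maximal size in a graph \<open>G\<close>
  with one vertex for each admissible pair of a cell and a tile.

  In the model, large weights force the edges among the vertices of \<open>G\<close> to be exactly those
  of \<open>G\<close>; a vertex \<open>v\<close> counts as chosen if the edge \<open>{1, v}\<close> is present, and a negative weight on
  triangles suppresses choices that are not independent. Weight \<open>A\<close> per chosen vertex then makes the
  number of independent sets of size \<open>k\<close> a digit in base \<open>2 ^ A\<close> of the partition function. A marker
  vertex 2, adjacent to all others and of weight \<open>A * (m + 1)\<close>, contributes the leading bit, so the
  count for the maximal size \<open>m\<close> occupies the next \<open>A\<close> bits, whatever power of two is factored out.
\<close>

section \<open>A structured language for multi-tape machines\<close>

text \<open>Two obstacles shape the argument. Machines are concrete, so polynomial running time of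
  the reduction has to be shown by producing a machine; hence a small language compiled to machines,
  stack programs in it, and a class \<open>PF\<close> closed under composition and bounded
  recursion, in which the reduction can simply be written down. The hypothetical algorithm runs
  once, as a simulated subroutine, while \<open>x\<close> is kept for the decoding. Secondly, the
  answer might be long: all large weights are assembled from copies of features of weight 1 or -1,
  so every size is polynomial even in unary, the answer has polynomial length, and algorithms with
  time measured in input and output together are refuted as well. The count is preserved exactly
  because runs are deterministic: the certificate in the first row fixes the tiling. A tile repeats
  the state and all scanned symbols because the heads of different tapes sit in different columns,
  while constraints may relate only neighbours. Base \<open>2 ^ A\<close> with \<open>A\<close>
  above the number \<open>n\<close> of vertices keeps the at most \<open>2 ^ n\<close> smaller
  independent sets below the digit of interest.\<close>

type_synonym tapes = "nat \<Rightarrow> tape"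

definition reads :: "tapes \<Rightarrow> nat \<Rightarrow> nat" where
  "reads \<sigma> i = fst (\<sigma> i) (snd (\<sigma> i))"

definition upd_tape :: "nat \<times> int \<Rightarrow> tape \<Rightarrow> tape" where
  "upd_tape = (\<lambda>(s, d) (c, h). (c(h := s), h + d))"

datatype com =
    Skip
  | Act "(nat \<Rightarrow> nat) \<Rightarrow> nat \<Rightarrow> nat \<times> int"
  | Seq com com
  | Cond "(nat \<Rightarrow> nat) \<Rightarrow> bool" com com
  | While "(nat \<Rightarrow> nat) \<Rightarrow> bool" com

text \<open>Testing a guard and unwrapping a finished first component each cost one step that writes
  the scanned symbols back; the extra units in all later time bounds come from here.\<close>

fun cact :: "com \<Rightarrow> (nat \<Rightarrow> nat) \<Rightarrow> com \<times> (nat \<Rightarrow> nat \<times> int)" where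
  "cact Skip r = (Skip, \<lambda>i. (r i, 0))"
| "cact (Act f) r = (Skip, f r)"
| "cact (Seq c d) r =
     (if c = Skip then (d, \<lambda>i. (r i, 0)) else (Seq (fst (cact c r)) d, snd (cact c r)))"
| "cact (Cond b c d) r = (if b r then c else d, \<lambda>i. (r i, 0))"
| "cact (While b c) r = (if b r then Seq c (While b c) else Skip, \<lambda>i. (r i, 0))"

definition cstep :: "com \<times> tapes \<Rightarrow> com \<times> tapes" where
  "cstep = (\<lambda>(c, \<sigma>). (fst (cact c (reads \<sigma>)), \<lambda>i. upd_tape (snd (cact c (reads \<sigma>)) i) (\<sigma> i)))"

text \<open>\<open>Skip\<close> is a fixed point of \<open>cstep\<close>, so \<open>t\<close> acts
  as an upper bound on the running time, like the time in \<open>computes_within\<close>.\<close>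

definition runs :: "com \<Rightarrow> tapes \<Rightarrow> nat \<Rightarrow> tapes \<Rightarrow> bool" where
  "runs c \<sigma> t \<sigma>' \<longleftrightarrow> (cstep ^^ t) (c, \<sigma>) = (Skip, \<sigma>')"

lemma upd_tape_reads [simp]: "upd_tape (reads \<sigma> i, 0) (\<sigma> i) = \<sigma> i"
  by (cases "\<sigma> i") (simp add: upd_tape_def reads_def)

lemma cstep_simps [simp]:
  "cstep (Skip, \<sigma>) = (Skip, \<sigma>)"
  "cstep (Act f, \<sigma>) = (Skip, \<lambda>i. upd_tape (f (reads \<sigma>) i) (\<sigma> i))"
  "cstep (Seq Skip d, \<sigma>) = (d, \<sigma>)"
  "c \<noteq> Skip \<Longrightarrow> cstep (Seq c d, \<sigma>) = (Seq (fst (cstep (c, \<sigma>))) d, snd (cstep (c, \<sigma>)))"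
  "cstep (Cond b c d, \<sigma>) = (if b (reads \<sigma>) then c else d, \<sigma>)"
  "cstep (While b c, \<sigma>) = (if b (reads \<sigma>) then Seq c (While b c) else Skip, \<sigma>)"
  by (auto simp: cstep_def)

lemma funpow_cstep_Skip [simp]: "(cstep ^^ t) (Skip, \<sigma>) = (Skip, \<sigma>)"
  by (induction t) auto

lemma runs_mono: "runs c \<sigma> t \<sigma>' \<Longrightarrow> t \<le> t' \<Longrightarrow> runs c \<sigma> t' \<sigma>'"
  by (auto simp: runs_def le_iff_add funpow_add add.commute[of t])

lemma runs_Suc: "runs c \<sigma> (Suc t) \<sigma>' \<longleftrightarrow> runs (fst (cstep (c, \<sigma>))) (snd (cstep (c, \<sigma>))) t \<sigma>'"
  unfolding runs_def funpow_Suc_right by simp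

lemma runs_Skip [simp]: "runs Skip \<sigma> t \<sigma>' \<longleftrightarrow> \<sigma>' = \<sigma>"
  by (auto simp: runs_def)

lemma runs_Seq:
  assumes "runs c \<sigma> t \<sigma>'" "runs d \<sigma>' t' \<sigma>''"
  shows "runs (Seq c d) \<sigma> (Suc (t + t')) \<sigma>''"
  using assms(1)
proof (induction t arbitrary: c \<sigma>)
  case 0
  then show ?case using assms(2) by (simp add: runs_Suc) (simp add: runs_def)
next
  case (Suc t)
  show ?case
  proof (cases "c = Skip")
    case True
    then have "runs (Seq c d) \<sigma> (Suc t') \<sigma>''" using Suc.prems assms(2) by (simp add: runs_Suc)
    then show ?thesis by (rule runs_mono) simp
  next
    case False
    have "runs (Seq (fst (cstep (c, \<sigma>))) d) (snd (cstep (c, \<sigma>))) (Suc (t + t')) \<sigma>''"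
      using Suc.prems by (intro Suc.IH) (simp add: runs_Suc)
    then show ?thesis using False by (simp add: runs_Suc[of "Seq c d"])
  qed
qed

text \<open>The analogue of the partial derivatives of a regular expression: a finite set containing
  every program that execution can reach. A loop re-enters itself only as \<open>While b c\<close>,
  which keeps the set finite.\<close>

primrec resid :: "com \<Rightarrow> com set" where
  "resid Skip = {Skip}"
| "resid (Act f) = {Act f, Skip}"
| "resid (Seq c d) = (\<lambda>c'. Seq c' d) ` resid c \<union> resid d"
| "resid (Cond b c d) = insert (Cond b c d) (resid c \<union> resid d)"
| "resid (While b c) = {While b c, Skip} \<union> (\<lambda>c'. Seq c' (While b c)) ` resid c"

lemma resid_self: "c \<in> resid c"
  by (induction c) auto

lemma resid_Skip: "Skip \<in> resid c"
  by (induction c) auto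

lemma finite_resid: "finite (resid c)"
  by (induction c) auto

lemma resid_closed: "c' \<in> resid c \<Longrightarrow> fst (cact c' r) \<in> resid c"
proof (induction c arbitrary: c')
  case (Seq c1 c2)
  then show ?case using resid_self[of c2] by auto
next
  case (Cond b c1 c2)
  then show ?case using resid_self[of c1] resid_self[of c2] by (auto split: if_splits)
next
  case (While b c)
  then show ?case using resid_self[of c] by (auto split: if_splits)
qed auto

text \<open>From tape \<open>K\<close> on an action must do nothing, so that a program over
  infinitely many tapes is realised by a machine with \<open>K\<close> tapes.\<close>

definition act_ok :: "nat \<Rightarrow> nat \<Rightarrow> (nat \<Rightarrow> nat) \<Rightarrow> (nat \<Rightarrow> nat \<times> int) \<Rightarrow> bool" where
  "act_ok K S r a \<longleftrightarrow>
     (\<forall>i. fst (a i) < S \<and> snd (a i) \<in> {-1, 0, 1}) \<and> (\<forall>i\<ge>K. a i = (r i, 0))"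

definition act_wf :: "nat \<Rightarrow> nat \<Rightarrow> ((nat \<Rightarrow> nat) \<Rightarrow> nat \<Rightarrow> nat \<times> int) \<Rightarrow> bool" where
  "act_wf K S f \<longleftrightarrow> (\<forall>r. (\<forall>i. r i < S) \<longrightarrow> act_ok K S r (f r))"

primrec wf_com :: "nat \<Rightarrow> nat \<Rightarrow> com \<Rightarrow> bool" where
  "wf_com K S Skip \<longleftrightarrow> True"
| "wf_com K S (Act f) \<longleftrightarrow> act_wf K S f"
| "wf_com K S (Seq c d) \<longleftrightarrow> wf_com K S c \<and> wf_com K S d"
| "wf_com K S (Cond b c d) \<longleftrightarrow> wf_com K S c \<and> wf_com K S d"
| "wf_com K S (While b c) \<longleftrightarrow> wf_com K S c"

lemma wf_com_mono: "wf_com K S c \<Longrightarrow> K \<le> K' \<Longrightarrow> wf_com K' S c"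
  by (induction c) (auto simp: act_wf_def act_ok_def)

lemma wf_com_resid: "wf_com K S c \<Longrightarrow> c' \<in> resid c \<Longrightarrow> wf_com K S c'"
proof -
  have "wf_com K S c \<Longrightarrow> \<forall>c'\<in>resid c. wf_com K S c'"
    by (induction c; (unfold resid.simps ball_Un ball_simps ball_empty wf_com.simps image_iff)?)
      (use wf_com.simps in blast)+
  then show "wf_com K S c \<Longrightarrow> c' \<in> resid c \<Longrightarrow> wf_com K S c'" by blast
qed

lemma act_ok_cact:
  "wf_com K S c \<Longrightarrow> (\<And>i. r i < S) \<Longrightarrow> act_ok K S r (snd (cact c r))"
proof (induction c)
  case (Act f)
  then show ?case by (simp add: act_wf_def)
qed (simp_all add: act_ok_def)

text \<open>The machine model fixes 0 as initial and 1 as halting state. These become the program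
  itself and \<open>Skip\<close>, which therefore have to differ.\<close>

lemma state_numbering:
  assumes "finite R" "a \<in> R" "b \<in> R" "a \<noteq> b"
  obtains e :: "'a \<Rightarrow> nat" where "inj_on e R" "e a = 0" "e b = 1" "\<And>x. x \<in> R \<Longrightarrow> e x < card R"
proof -
  have fin: "finite (R - {a, b})" using assms by auto
  obtain g where g: "bij_betw g (R - {a, b}) {0..<card (R - {a, b})}"
    using ex_bij_betw_finite_nat[OF fin] by blast
  have c: "card R = card (R - {a, b}) + 2"
  proof -
    have "card {a, b} \<le> card R" using assms by (intro card_mono) auto
    then show ?thesis using assms by (subst card_Diff_subset) auto
  qed
  define e where "e x = (if x = a then 0 else if x = b then 1 else g x + 2)" for x
  have gi: "x = y" if "g x = g y" "x \<in> R" "y \<in> R" "x \<notin> {a, b}" "y \<notin> {a, b}" for x y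
    using that inj_onD[OF bij_betw_imp_inj_on[OF g], of x y] by blast
  have "inj_on e R"
    by (rule inj_onI) (auto simp: e_def split: if_splits intro: gi)
  moreover have "e x < card R" if "x \<in> R" for x
    using that c bij_betw_apply[OF g, of x] by (auto simp: e_def)
  ultimately show ?thesis using assms by (intro that[of e]) (auto simp: e_def)
qed

definition start_tapes :: "bool list \<Rightarrow> tapes" where
  "start_tapes xs i = (if i = 0 then tape_of xs else (\<lambda>_. 0), 0)"

text \<open>The control states of the machine are the residual programs.\<close>

theorem com_machine:
  assumes wf: "wf_com K S c" and nt: "c \<noteq> Skip" and K: "1 \<le> K" and S: "3 \<le> S"
  shows "\<exists>M. turing_machine M \<and>
    (\<forall>xs ys t \<sigma>'. runs c (start_tapes xs) t \<sigma>' \<and> fst (\<sigma>' 0) = tape_of ys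
       \<longrightarrow> computes_within M xs ys t)"
proof -
  obtain e :: "com \<Rightarrow> nat" where e: "inj_on e (resid c)" "e c = 0" "e Skip = 1"
    "\<And>d. d \<in> resid c \<Longrightarrow> e d < card (resid c)"
    using state_numbering[OF finite_resid resid_self resid_Skip nt] by metis
  define dec where "dec q = (if \<exists>d\<in>resid c. e d = q then inv_into (resid c) e q else Skip)" for q
  have dec: "dec (e d) = d" if "d \<in> resid c" for d
    using that e(1) by (auto simp: dec_def)
  have dec_in: "dec q \<in> resid c" for q
    by (auto simp: dec_def resid_Skip inv_into_into)
  \<comment> \<open>Tapes from \<open>K\<close> on stay blank, as recorded in \<open>inv\<close>
    below, so filling in 0 reconstructs the full reading.\<close>
  define rd where "rd ss i = (if i < K then ss ! i else 0)" for ss :: "nat list" and i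
  define M where "M = \<lparr>ntapes = K, nstates = card (resid c), nsymbols = S,
    delta = (\<lambda>q ss. (e (fst (cact (dec q) (rd ss))), map (snd (cact (dec q) (rd ss))) [0..<K]))\<rparr>"
  have card2: "2 \<le> card (resid c)"
    using e(4)[OF resid_Skip] e(3) by simp
  have tm: "turing_machine M"
  proof -
    have "act_ok K S (rd ss) (snd (cact (dec q) (rd ss)))"
      if "length ss = K" "\<forall>s\<in>set ss. s < S" for q ss
      using that S by (intro act_ok_cact wf_com_resid[OF wf dec_in]) (auto simp: rd_def)
    then show ?thesis
      using K S card2 e(4)[OF resid_closed[OF dec_in]]
      by (fastforce simp: turing_machine_def M_def act_ok_def split_beta)
  qed
  define abs where "abs d \<sigma> = (e d, map \<sigma> [0..<K])" for d and \<sigma> :: tapes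
  define inv where "inv d \<sigma> \<longleftrightarrow> d \<in> resid c \<and> (\<forall>i\<ge>K. \<sigma> i = (\<lambda>_. 0, 0)) \<and> (\<forall>i j. fst (\<sigma> i) j < S)"
    for d and \<sigma> :: tapes
  have sim: "step M (abs d \<sigma>) = abs (fst (cstep (d, \<sigma>))) (snd (cstep (d, \<sigma>))) \<and>
      inv (fst (cstep (d, \<sigma>))) (snd (cstep (d, \<sigma>)))" if "inv d \<sigma>" for d \<sigma>
  proof -
    have d: "d \<in> resid c" and bl: "\<And>i. i \<ge> K \<Longrightarrow> \<sigma> i = (\<lambda>_. 0, 0)" and sy: "\<And>i j. fst (\<sigma> i) j < S"
      using that by (auto simp: inv_def)
    have rd: "rd (map (\<lambda>(c, h). c h) (map \<sigma> [0..<K])) = reads \<sigma>"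
      using bl by (auto simp: rd_def reads_def fun_eq_iff split_beta)
    have ok: "act_ok K S (reads \<sigma>) (snd (cact d (reads \<sigma>)))"
      by (rule act_ok_cact[OF wf_com_resid[OF wf d]]) (simp add: reads_def sy)
    have "inv (fst (cstep (d, \<sigma>))) (snd (cstep (d, \<sigma>)))"
      using ok sy resid_closed[OF d] bl
      by (auto simp: inv_def cstep_def act_ok_def upd_tape_def split_beta reads_def fun_eq_iff)
    moreover have "step M (abs d \<sigma>) = abs (fst (cstep (d, \<sigma>))) (snd (cstep (d, \<sigma>)))"
    proof (cases "d = Skip")
      case True
      then show ?thesis by (simp add: step_def abs_def e(3))
    next
      case False
      then have "e d \<noteq> 1" using e(1,3) d resid_Skip[of c] by (metis inj_onD)
      then show ?thesis
        by (auto simp: step_def abs_def M_def rd[simplified] dec[OF d] cstep_def upd_tape_def split_beta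
            intro!: nth_equalityI)
    qed
    ultimately show ?thesis by blast
  qed
  have iter: "(step M ^^ t) (abs d \<sigma>) = abs (fst ((cstep ^^ t) (d, \<sigma>))) (snd ((cstep ^^ t) (d, \<sigma>)))
      \<and> inv (fst ((cstep ^^ t) (d, \<sigma>))) (snd ((cstep ^^ t) (d, \<sigma>)))" if "inv d \<sigma>" for t d \<sigma>
    using that by (induction t) (auto dest: sim)
  have init: "initial_config M xs = abs c (start_tapes xs)" for xs
    using K by (auto simp: initial_config_def abs_def M_def e(2) start_tapes_def nth_Cons'
        intro!: nth_equalityI)
  have inv0: "inv c (start_tapes xs)" for xs
    using K S by (auto simp: inv_def resid_self start_tapes_def tape_of_def)
  have "computes_within M xs ys t" if "runs c (start_tapes xs) t \<sigma>'" "fst (\<sigma>' 0) = tape_of ys"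
    for xs ys t \<sigma>'
    using iter[OF inv0, of t xs] that K
    by (simp add: computes_within_def init runs_def abs_def e(3) nth_append)
  then show ?thesis using tm by blast
qed

section \<open>Stack programs\<close>

text \<open>The number of tapes is chosen once, but the alphabet may be any of size at least 3: such
  a program can be placed beside a simulated machine that needs more symbols.\<close>

definition okc :: "com \<Rightarrow> bool" where
  "okc c \<longleftrightarrow> (\<exists>K. \<forall>S\<ge>3. wf_com K S c)"

lemma okc_Skip: "okc Skip"
  by (simp add: okc_def)

lemma okc_Seq: "okc c \<Longrightarrow> okc d \<Longrightarrow> okc (Seq c d)"
  unfolding okc_def wf_com.simps by (metis wf_com_mono max.cobounded1 max.cobounded2)

lemma okc_Cond: "okc c \<Longrightarrow> okc d \<Longrightarrow> okc (Cond b c d)"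
  unfolding okc_def wf_com.simps by (metis wf_com_mono max.cobounded1 max.cobounded2)

lemma okc_While: "okc c \<Longrightarrow> okc (While b c)"
  unfolding okc_def wf_com.simps .

definition act1 :: "nat \<Rightarrow> (nat \<Rightarrow> nat \<times> int) \<Rightarrow> com" where
  "act1 i g = Act (\<lambda>r j. if j = i then g (r j) else (r j, 0))"

lemma okc_act1:
  assumes "\<And>x. (fst (g x) = x \<or> fst (g x) \<le> 2) \<and> snd (g x) \<in> {-1, 0, 1}"
  shows "okc (act1 i g)"
  unfolding okc_def act1_def
proof (intro exI[of _ "Suc i"] allI impI)
  fix S :: nat assume "3 \<le> S"
  then have "fst (g x) < S" if "x < S" for x
    using assms[of x] that by (elim conjE disjE) simp_all
  then show "wf_com (Suc i) S (Act (\<lambda>r j. if j = i then g (r j) else (r j, 0)))"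
    using assms by (simp add: act_wf_def act_ok_def)
qed

text \<open>A register is a stack whose top is under the head and which extends to the right;
  in particular, an input tape is a register.\<close>

definition stk :: "tape \<Rightarrow> bool list \<Rightarrow> bool" where
  "stk T xs \<longleftrightarrow> (\<forall>d. fst T (snd T + d) = tape_of xs d)"

text \<open>The tapes below \<open>m\<close> are described exactly, the others only as stacks.\<close>

definition rep :: "nat \<Rightarrow> tapes \<Rightarrow> tapes \<Rightarrow> (nat \<Rightarrow> bool list) \<Rightarrow> bool" where
  "rep m \<sigma> u s \<longleftrightarrow> (\<forall>i<m. \<sigma> i = u i) \<and> (\<forall>i. stk (\<sigma> (m + i)) (s i))"

text \<open>Every tape state matching \<open>u\<close> and \<open>s\<close> is allowed at the start,
  so the absolute head position of a register never has to be tracked.\<close>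

definition exec ::
    "nat \<Rightarrow> com \<Rightarrow> tapes \<Rightarrow> (nat \<Rightarrow> bool list) \<Rightarrow> nat \<Rightarrow> tapes \<Rightarrow> (nat \<Rightarrow> bool list) \<Rightarrow> bool" where
  "exec m c u s t u' s' \<longleftrightarrow> (\<forall>\<sigma>. rep m \<sigma> u s \<longrightarrow> (\<exists>\<sigma>'. runs c \<sigma> t \<sigma>' \<and> rep m \<sigma>' u' s'))"

definition bitsym :: "bool \<Rightarrow> nat" where
  "bitsym b = (if b then 2 else 1)"

lemma bitsym_le: "bitsym b \<le> 2" and bitsym_pos [simp]: "0 < bitsym b"
  and bitsym_eq_2 [simp]: "bitsym b = 2 \<longleftrightarrow> b"
  by (auto simp: bitsym_def)

lemma tape_of_Nil [simp]: "tape_of [] = (\<lambda>_. 0)"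
  by (auto simp: tape_of_def)

lemma tape_of_Cons: "tape_of (b # xs) d = (if d = 0 then bitsym b else tape_of xs (d - 1))"
proof (cases "d > 0")
  case True
  then have "nat d = Suc (nat (d - 1))" by simp
  then show ?thesis using True by (auto simp: tape_of_def bitsym_def)
qed (auto simp: tape_of_def bitsym_def)

lemma tape_of_neg: "d < 0 \<Longrightarrow> tape_of xs d = 0"
  by (simp add: tape_of_def)

lemma tape_of_0: "tape_of xs 0 = (case xs of [] \<Rightarrow> 0 | b # _ \<Rightarrow> bitsym b)"
  by (cases xs) (auto simp: tape_of_Cons)

lemma exec_Skip: "exec m Skip u s t u s"
  by (simp add: exec_def)

lemma exec_Seq:
  "exec m c u s t u' s' \<Longrightarrow> exec m d u' s' t' u'' s'' \<Longrightarrow> exec m (Seq c d) u s (Suc (t + t')) u'' s''"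
  unfolding exec_def by (meson runs_Seq)

lemma exec_mono: "exec m c u s t u' s' \<Longrightarrow> t \<le> t' \<Longrightarrow> exec m c u s t' u' s'"
  unfolding exec_def by (meson runs_mono)

lemma exec_Cond_True:
  "(\<And>\<sigma>. rep m \<sigma> u s \<Longrightarrow> b (reads \<sigma>)) \<Longrightarrow> exec m c u s t u' s' \<Longrightarrow>
   exec m (Cond b c d) u s (Suc t) u' s'"
  by (auto simp: exec_def runs_Suc)

lemma exec_Cond_False:
  "(\<And>\<sigma>. rep m \<sigma> u s \<Longrightarrow> \<not> b (reads \<sigma>)) \<Longrightarrow> exec m d u s t u' s' \<Longrightarrow>
   exec m (Cond b c d) u s (Suc t) u' s'"
  by (auto simp: exec_def runs_Suc)

text \<open>The states of the loop are given in advance as families indexed by the round. A round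
  costs the test, the body and one step to leave the \<open>Seq\<close>; the last test gives the
  final 1.\<close>

lemma exec_While:
  assumes "\<And>k \<sigma>. k < n \<Longrightarrow> rep m \<sigma> (u k) (s k) \<Longrightarrow> b (reads \<sigma>)"
    and "\<And>\<sigma>. rep m \<sigma> (u n) (s n) \<Longrightarrow> \<not> b (reads \<sigma>)"
    and "\<And>k. k < n \<Longrightarrow> exec m c (u k) (s k) t (u (Suc k)) (s (Suc k))"
  shows "exec m (While b c) (u 0) (s 0) (n * (t + 2) + 1) (u n) (s n)"
  using assms
proof (induction n arbitrary: u s)
  case 0
  then show ?case by (auto simp: exec_def runs_Suc)
next
  case (Suc n)
  have rest: "exec m (While b c) (u (Suc 0)) (s (Suc 0)) (n * (t + 2) + 1) (u (Suc n)) (s (Suc n))"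
    using Suc.IH[of "\<lambda>k. u (Suc k)" "\<lambda>k. s (Suc k)"] Suc.prems by blast
  have "exec m (Seq c (While b c)) (u 0) (s 0) (Suc (t + (n * (t + 2) + 1))) (u (Suc n)) (s (Suc n))"
    using Suc.prems(3)[of 0] by (intro exec_Seq[OF _ rest]) simp
  then show ?case
    using Suc.prems(1)[of 0] by (auto simp: exec_def runs_Suc[of "While b c"] algebra_simps)
qed

lemma rep_reads_reg: "rep m \<sigma> u s \<Longrightarrow> reads \<sigma> (m + i) = tape_of (s i) 0"
  unfolding rep_def stk_def reads_def by (metis add.right_neutral)

lemma rep_reads_low: "rep m \<sigma> u s \<Longrightarrow> i < m \<Longrightarrow> reads \<sigma> i = reads u i"
  by (simp add: rep_def reads_def)

lemma runs_Act: "runs (Act f) \<sigma> 1 (\<lambda>i. upd_tape (f (reads \<sigma>) i) (\<sigma> i))"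
  by (simp add: runs_def)

lemma runs_act1: "runs (act1 i g) \<sigma> 1 (\<sigma>(i := upd_tape (g (reads \<sigma> i)) (\<sigma> i)))"
proof -
  have "(\<lambda>j. upd_tape (if j = i then g (reads \<sigma> j) else (reads \<sigma> j, 0)) (\<sigma> j)) =
    \<sigma>(i := upd_tape (g (reads \<sigma> i)) (\<sigma> i))" by auto
  then show ?thesis using runs_Act[of "\<lambda>r j. if j = i then g (r j) else (r j, 0)" \<sigma>]
    by (simp add: act1_def)
qed

lemma exec_act1_low:
  "i < m \<Longrightarrow> exec m (act1 i g) u s 1 (u(i := upd_tape (g (reads u i)) (u i))) s"
  unfolding exec_def
proof (intro allI impI)
  fix \<sigma> assume a: "i < m" "rep m \<sigma> u s"
  show "\<exists>\<sigma>'. runs (act1 i g) \<sigma> 1 \<sigma>' \<and> rep m \<sigma>' (u(i := upd_tape (g (reads u i)) (u i))) s"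
    by (rule exI, rule conjI, rule runs_act1) (use a in \<open>auto simp: rep_def reads_def\<close>)
qed

lemma exec_act1_reg:
  assumes "\<And>T. stk T (s i) \<Longrightarrow> stk (upd_tape (g (fst T (snd T))) T) ys"
  shows "exec m (act1 (m + i) g) u s 1 u (s(i := ys))"
  unfolding exec_def
proof (intro allI impI)
  fix \<sigma> assume a: "rep m \<sigma> u s"
  show "\<exists>\<sigma>'. runs (act1 (m + i) g) \<sigma> 1 \<sigma>' \<and> rep m \<sigma>' u (s(i := ys))"
    by (rule exI, rule conjI, rule runs_act1) (use a in \<open>auto simp: rep_def reads_def assms\<close>)
qed

text \<open>The popped symbol has to be erased: \<open>stk\<close> also demands blanks to the left
  of the head, where \<open>tape_of\<close> has negative arguments.\<close>

definition pop :: "nat \<Rightarrow> nat \<Rightarrow> com" where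
  "pop m i = act1 (m + i) (\<lambda>_. (0, 1))"

definition push :: "nat \<Rightarrow> nat \<Rightarrow> bool \<Rightarrow> com" where
  "push m i b = Seq (act1 (m + i) (\<lambda>x. (x, -1))) (act1 (m + i) (\<lambda>_. (bitsym b, 0)))"

lemma exec_pop: "exec m (pop m i) u s 1 u (s(i := tl (s i)))"
  unfolding pop_def
proof (rule exec_act1_reg)
  fix T assume T: "stk T (s i)"
  obtain c h where ch: "T = (c, h)" by force
  have "c (h + d) = tape_of (s i) d" for d using T by (simp add: stk_def ch)
  then have c: "c x = tape_of (s i) (x - h)" for x by (metis add_diff_cancel_left' diff_add_cancel add.commute)
  show "stk (upd_tape (0, 1) T) (tl (s i))"
    by (cases "s i") (auto simp: stk_def upd_tape_def ch c tape_of_Cons tape_of_neg)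
qed

lemma exec_push: "exec m (push m i b) u s 3 u (s(i := b # s i))"
proof -
  have "exec m (push m i b) u s t u s'" if "t = 3" "s' = s(i := b # s i)" for t s'
    unfolding exec_def
  proof (intro allI impI)
    fix \<sigma> assume rep: "rep m \<sigma> u s"
    obtain c h where ch: "\<sigma> (m + i) = (c, h)" by force
    have "c (h + d) = tape_of (s i) d" for d using rep ch unfolding rep_def stk_def
      by (metis fst_conv snd_conv)
    then have c: "c x = tape_of (s i) (x - h)" for x
      by (metis add_diff_cancel_left' diff_add_cancel add.commute)
    define \<sigma>' where "\<sigma>' = \<sigma>(m + i := (c(h - 1 := bitsym b), h - 1))"
    have "runs (push m i b) \<sigma> (Suc (1 + 1)) \<sigma>'"
      unfolding push_def
      by (rule runs_Seq[OF runs_act1], rule back_subst[of "runs _ _ _", OF runs_act1])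
        (auto simp: \<sigma>'_def ch upd_tape_def reads_def)
    moreover have "stk (c(h - 1 := bitsym b), h - 1) (b # s i)"
      by (auto simp: stk_def c tape_of_Cons)
    then have "rep m \<sigma>' u s'"
      using rep that by (auto simp: rep_def \<sigma>'_def)
    ultimately show "\<exists>\<sigma>'. runs (push m i b) \<sigma> t \<sigma>' \<and> rep m \<sigma>' u s'"
      using that by (auto simp: numeral_3_eq_3)
  qed
  then show ?thesis by blast
qed

lemma okc_pop: "okc (pop m i)"
  unfolding pop_def by (rule okc_act1) auto

lemma okc_push: "okc (push m i b)"
  unfolding push_def by (intro okc_Seq okc_act1) (auto simp: bitsym_le)

lemma exec_Cond_empty:
  assumes "s i = [] \<Longrightarrow> exec m c u s t u' s'" "s i \<noteq> [] \<Longrightarrow> exec m d u s t u' s'"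
  shows "exec m (Cond (\<lambda>r. r (m + i) = 0) c d) u s (Suc t) u' s'"
proof (cases "s i = []")
  case True
  then show ?thesis using assms by (intro exec_Cond_True) (auto simp: rep_reads_reg)
next
  case False
  then show ?thesis using assms
    by (intro exec_Cond_False) (auto simp: rep_reads_reg tape_of_0 split: list.splits)
qed

lemma exec_Cond_top:
  assumes "s i = b # xs" "exec m (if b then c else d) u s t u' s'"
  shows "exec m (Cond (\<lambda>r. r (m + i) = 2) c d) u s (Suc t) u' s'"
proof (cases b)
  case True
  then show ?thesis using assms by (intro exec_Cond_True) (auto simp: rep_reads_reg tape_of_0)
next
  case False
  then show ?thesis using assms by (intro exec_Cond_False) (auto simp: rep_reads_reg tape_of_0)
qed

text \<open>Register \<open>i\<close> plays the loop counter: that it becomes empty exactly at round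
  \<open>n\<close> decides every test of the guard.\<close>

lemma exec_drain:
  assumes "\<And>k. k \<le> n \<Longrightarrow> (s k i = [] \<longleftrightarrow> k = n)"
    and "\<And>k. k < n \<Longrightarrow> exec m c (u k) (s k) t (u (Suc k)) (s (Suc k))"
    and "t' = n * (t + 2) + 1"
  shows "exec m (While (\<lambda>r. r (m + i) \<noteq> 0) c) (u 0) (s 0) t' (u n) (s n)"
  unfolding assms(3)
proof (rule exec_While)
  fix k \<sigma> assume "k < n" "rep m \<sigma> (u k) (s k)"
  then show "reads \<sigma> (m + i) \<noteq> 0"
    using assms(1)[of k] by (auto simp: rep_reads_reg tape_of_0 split: list.splits)
next
  fix \<sigma> assume "rep m \<sigma> (u n) (s n)"
  then show "\<not> reads \<sigma> (m + i) \<noteq> 0" using assms(1)[of n] by (simp add: rep_reads_reg)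
qed (rule assms(2))

definition clear :: "nat \<Rightarrow> nat \<Rightarrow> com" where
  "clear m i = While (\<lambda>r. r (m + i) \<noteq> 0) (pop m i)"

lemma exec_clear: "exec m (clear m i) u s (3 * length (s i) + 1) u (s(i := []))"
proof -
  have "exec m (clear m i) u (s(i := drop 0 (s i))) (3 * length (s i) + 1) u
    (s(i := drop (length (s i)) (s i)))"
    unfolding clear_def
  proof (rule exec_drain[where u = "\<lambda>_. u" and n = "length (s i)" and t = 1])
    fix k show "exec m (pop m i) u (s(i := drop k (s i))) 1 u (s(i := drop (Suc k) (s i)))"
      using exec_pop[of m i u "s(i := drop k (s i))"] by (simp add: drop_Suc tl_drop)
  qed auto
  then show ?thesis by simp
qed

text \<open>Popping and pushing reverses a word, so copying a register takes two passes: one to a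
  scratch register, and one back that also writes the copy.\<close>

definition pour2 :: "nat \<Rightarrow> nat \<Rightarrow> nat \<Rightarrow> nat \<Rightarrow> com" where
  "pour2 m i j k = While (\<lambda>r. r (m + i) \<noteq> 0)
     (Seq (Cond (\<lambda>r. r (m + i) = 2) (Seq (push m j True) (push m k True))
                                    (Seq (push m j False) (push m k False))) (pop m i))"

definition pour :: "nat \<Rightarrow> nat \<Rightarrow> nat \<Rightarrow> com" where
  "pour m i j = While (\<lambda>r. r (m + i) \<noteq> 0)
     (Seq (Cond (\<lambda>r. r (m + i) = 2) (push m j True) (push m j False)) (pop m i))"

lemma exec_pour:
  assumes "i \<noteq> j"
  shows "exec m (pour m i j) u s (8 * length (s i) + 1) u (s(i := [], j := rev (s i) @ s j))"
proof -
  define st where "st k = s(i := drop k (s i), j := rev (take k (s i)) @ s j)" for k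
  have "exec m (pour m i j) u (st 0) (8 * length (s i) + 1) u (st (length (s i)))"
    unfolding pour_def
  proof (rule exec_drain[where u = "\<lambda>_. u" and n = "length (s i)" and t = 6])
    fix k assume k: "k < length (s i)"
    let ?b = "s i ! k"
    have top: "st k i = ?b # drop (Suc k) (s i)" using k assms by (simp add: st_def Cons_nth_drop_Suc)
    have 1: "exec m (Cond (\<lambda>r. r (m + i) = 2) (push m j True) (push m j False)) u (st k) (Suc 3) u
      ((st k)(j := ?b # st k j))"
      using exec_push[of m j ?b u "st k"] by (intro exec_Cond_top[where s = "st k" and i = i, OF top]) (cases ?b, auto)
    have "tl (((st k)(j := ?b # st k j)) i) = drop (Suc k) (s i)"
      using assms top by simp
    then have "((st k)(j := ?b # st k j))(i := tl (((st k)(j := ?b # st k j)) i)) = st (Suc k)"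
      using assms k by (auto simp: st_def take_Suc_conv_app_nth)
    then show "exec m (Seq (Cond (\<lambda>r. r (m + i) = 2) (push m j True) (push m j False)) (pop m i))
       u (st k) 6 u (st (Suc k))"
      using exec_Seq[OF 1 exec_pop, of i] by (simp add: eval_nat_numeral)
  qed (use assms in \<open>auto simp: st_def\<close>)
  then show ?thesis using assms by (simp add: st_def)
qed

lemma exec_pour2:
  assumes "i \<noteq> j" "i \<noteq> k" "j \<noteq> k"
  shows "exec m (pour2 m i j k) u s (12 * length (s i) + 1) u
    (s(i := [], j := rev (s i) @ s j, k := rev (s i) @ s k))"
proof -
  define st where "st n = s(i := drop n (s i), j := rev (take n (s i)) @ s j,
    k := rev (take n (s i)) @ s k)" for n
  have "exec m (pour2 m i j k) u (st 0) (12 * length (s i) + 1) u (st (length (s i)))"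
    unfolding pour2_def
  proof (rule exec_drain[where u = "\<lambda>_. u" and n = "length (s i)" and t = 10])
    fix n assume n: "n < length (s i)"
    let ?b = "s i ! n"
    have top: "st n i = ?b # drop (Suc n) (s i)" using n assms by (simp add: st_def Cons_nth_drop_Suc)
    have 0: "exec m (Seq (push m j ?b) (push m k ?b)) u (st n) (Suc (3 + 3)) u
      ((st n)(j := ?b # st n j, k := ?b # st n k))"
      using exec_Seq[OF exec_push[of m j ?b u "st n"] exec_push[of m k ?b]] assms by simp
    have 1: "exec m (Cond (\<lambda>r. r (m + i) = 2) (Seq (push m j True) (push m k True))
        (Seq (push m j False) (push m k False))) u (st n) (Suc (Suc (3 + 3))) u
      ((st n)(j := ?b # st n j, k := ?b # st n k))"
      using 0 by (intro exec_Cond_top[where s = "st n" and i = i, OF top]) (cases ?b, auto)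
    have "((st n)(j := ?b # st n j, k := ?b # st n k))(i := drop (Suc n) (s i)) = st (Suc n)"
      using assms n by (auto simp: st_def take_Suc_conv_app_nth)
    moreover have "tl (((st n)(j := ?b # st n j, k := ?b # st n k)) i) = drop (Suc n) (s i)"
      using assms top by simp
    ultimately show "exec m (Seq (Cond (\<lambda>r. r (m + i) = 2) (Seq (push m j True) (push m k True))
        (Seq (push m j False) (push m k False))) (pop m i)) u (st n) 10 u (st (Suc n))"
      using exec_Seq[OF 1 exec_pop, of i] by (simp add: eval_nat_numeral)
  qed (use assms in \<open>auto simp: st_def\<close>)
  then show ?thesis using assms by (simp add: st_def)
qed

lemma okc_clear: "okc (clear m i)"
  unfolding clear_def by (intro okc_While okc_pop)

lemma okc_pour: "okc (pour m i j)" and okc_pour2: "okc (pour2 m i j k)"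
  unfolding pour_def pour2_def by (intro okc_While okc_Seq okc_Cond okc_pop okc_push)+

text \<open>Two pours, through the scratch register \<open>Suc i\<close>, restore the order of the
  bits.\<close>

definition replace :: "nat \<Rightarrow> nat \<Rightarrow> nat \<Rightarrow> com" where
  "replace m i j = Seq (clear m j) (Seq (pour m i (Suc i)) (pour m (Suc i) j))"

lemma okc_replace: "okc (replace m i j)"
  unfolding replace_def by (intro okc_Seq okc_clear okc_pour)

lemma exec_replace:
  assumes "j < i" "s (Suc i) = []"
  shows "exec m (replace m i j) u s (3 * length (s j) + 16 * length (s i) + 5) u
    (s(j := s i, i := []))"
proof -
  have 1: "exec m (pour m i (Suc i)) u (s(j := [])) (8 * length (s i) + 1) u
    (s(j := [], i := [], Suc i := rev (s i)))"
    using exec_pour[of i "Suc i" m u "s(j := [])"] assms by simp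
  have 2: "exec m (pour m (Suc i) j) u (s(j := [], i := [], Suc i := rev (s i))) (8 * length (s i) + 1) u
    (s(j := s i, i := []))"
  proof -
    have "s(j := [], i := [], Suc i := rev (s i), Suc i := [], j := s i) = s(j := s i, i := [])"
      using assms by auto
    then show ?thesis
      using exec_pour[of "Suc i" j m u "s(j := [], i := [], Suc i := rev (s i))"] assms by simp
  qed
  show ?thesis unfolding replace_def
    by (rule exec_mono[OF exec_Seq[OF exec_clear exec_Seq[OF 1 2]]]) simp
qed

section \<open>Polynomial bounds\<close>

text \<open>The size \<open>L\<close> lives on an arbitrary type of environments, so that several
  variables can share one polynomial in their total length.\<close>

definition pbd :: "('e \<Rightarrow> nat) \<Rightarrow> ('e \<Rightarrow> nat) \<Rightarrow> bool" where
  "pbd L T \<longleftrightarrow> (\<exists>p :: nat poly. \<forall>e. T e \<le> poly p (L e))"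

lemma poly_mono_nat: "x \<le> y \<Longrightarrow> poly p x \<le> poly p (y :: nat)"
  by (induction p) (auto intro!: mult_mono)

lemma pbd_poly: "pbd L (\<lambda>e. poly p (L e))"
  unfolding pbd_def by blast

lemma pbd_const: "pbd L (\<lambda>e. c)"
  unfolding pbd_def by (rule exI[of _ "[:c:]"]) simp

lemma pbd_self: "pbd L L"
  unfolding pbd_def by (rule exI[of _ "[:0, 1:]"]) simp

lemma pbd_add: "pbd L S \<Longrightarrow> pbd L T \<Longrightarrow> pbd L (\<lambda>e. S e + T e)"
  unfolding pbd_def by (metis add_mono poly_add)

lemma pbd_mult: "pbd L S \<Longrightarrow> pbd L T \<Longrightarrow> pbd L (\<lambda>e. S e * T e)"
  unfolding pbd_def by (metis mult_le_mono poly_mult)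

lemma pbd_power: "pbd L S \<Longrightarrow> pbd L (\<lambda>e. S e ^ k)"
  by (induction k) (auto intro: pbd_const pbd_mult)

lemma pbd_Suc: "pbd L S \<Longrightarrow> pbd L (\<lambda>e. Suc (S e))"
  using pbd_add[of L S "\<lambda>_. 1"] by (simp add: pbd_const)

lemma pbd_le: "pbd L T \<Longrightarrow> (\<And>e. S e \<le> T e) \<Longrightarrow> pbd L S"
  unfolding pbd_def by (meson le_trans)

text \<open>Polynomials compose, and natural coefficients make them monotone.\<close>

lemma pbd_trans: "pbd L S \<Longrightarrow> pbd S T \<Longrightarrow> pbd L T"
  unfolding pbd_def
proof (elim exE)
  fix p q :: "nat poly" assume p: "\<forall>e. S e \<le> poly p (L e)" and q: "\<forall>e. T e \<le> poly q (S e)"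
  have "T e \<le> poly (pcompose q p) (L e)" for e
    using le_trans[OF spec[OF q] poly_mono_nat[OF spec[OF p]]] by (simp add: poly_pcompose)
  then show "\<exists>p. \<forall>e. T e \<le> poly p (L e)" by blast
qed

lemma pbd_reindex: "pbd L T \<Longrightarrow> pbd (\<lambda>z. L (h z)) (\<lambda>z. T (h z))"
  unfolding pbd_def by blast

lemmas pbd_intros = pbd_const pbd_self pbd_add pbd_mult pbd_Suc pbd_power

section \<open>Polynomial-time functions of several variables\<close>

text \<open>\<open>PF \<Gamma> f\<close>: some stack program computes \<open>f e\<close> in polynomial time from the values
  \<open>a e\<close>, \<open>a \<in> set \<Gamma>\<close>, placed in arbitrary registers \<open>\<rho>\<close> below \<open>r\<close>. It may use the
  registers from \<open>r\<close> on, which have to be empty, and leaves its result in register \<open>r\<close>.\<close>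

definition clen :: "('e \<Rightarrow> bool list) list \<Rightarrow> 'e \<Rightarrow> nat" where
  "clen \<Gamma> e = (\<Sum>a\<leftarrow>\<Gamma>. length (a e))"

definition impl :: "('e \<Rightarrow> bool list) list \<Rightarrow> ('e \<Rightarrow> bool list) \<Rightarrow> nat \<Rightarrow> nat list \<Rightarrow> nat \<Rightarrow>
    com \<Rightarrow> ('e \<Rightarrow> nat) \<Rightarrow> bool" where
  "impl \<Gamma> f m \<rho> r c T \<longleftrightarrow> okc c \<and>
     (\<forall>e s u. map s \<rho> = map (\<lambda>a. a e) \<Gamma> \<and> (\<forall>i\<ge>r. s i = []) \<longrightarrow>
        exec m c u s (T e) u (s(r := f e)))"

definition PF :: "('e \<Rightarrow> bool list) list \<Rightarrow> ('e \<Rightarrow> bool list) \<Rightarrow> bool" where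
  "PF \<Gamma> f \<longleftrightarrow> pbd (clen \<Gamma>) (\<lambda>e. length (f e)) \<and>
     (\<forall>m \<rho> r. (\<forall>i\<in>set \<rho>. i < r) \<longrightarrow> (\<exists>c T. pbd (clen \<Gamma>) T \<and> impl \<Gamma> f m \<rho> r c T))"

lemma PF_len: "PF \<Gamma> f \<Longrightarrow> pbd (clen \<Gamma>) (\<lambda>e. length (f e))"
  by (simp add: PF_def)

lemma PF_obtain:
  assumes "PF \<Gamma> f" "\<forall>i\<in>set \<rho>. i < r"
  obtains c T where "pbd (clen \<Gamma>) T" "impl \<Gamma> f m \<rho> r c T"
  using assms unfolding PF_def by blast

lemma implD:
  "impl \<Gamma> f m \<rho> r c T \<Longrightarrow> map s \<rho> = map (\<lambda>a. a e) \<Gamma> \<Longrightarrow> (\<And>i. r \<le> i \<Longrightarrow> s i = []) \<Longrightarrow>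
   exec m c u s (T e) u (s(r := f e))"
  by (simp add: impl_def)

lemma impl_okc: "impl \<Gamma> f m \<rho> r c T \<Longrightarrow> okc c"
  by (simp add: impl_def)

lemma PF_intro:
  assumes "pbd (clen \<Gamma>) (\<lambda>e. length (f e))"
    and "\<And>m \<rho> r. \<forall>i\<in>set \<rho>. i < r \<Longrightarrow> \<exists>c T. pbd (clen \<Gamma>) T \<and> okc c \<and>
     (\<forall>e s u. map s \<rho> = map (\<lambda>a. a e) \<Gamma> \<longrightarrow> (\<forall>i\<ge>r. s i = []) \<longrightarrow>
        exec m c u s (T e) u (s(r := f e)))"
  shows "PF \<Gamma> f"
  unfolding PF_def
proof (intro conjI allI impI assms(1))
  fix m \<rho> r assume "\<forall>i\<in>set \<rho>. i < (r :: nat)"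
  from assms(2)[OF this, of m] show "\<exists>c T. pbd (clen \<Gamma>) T \<and> impl \<Gamma> f m \<rho> r c T"
    unfolding impl_def imp_conjL .
qed

lemma clen_ge: "a \<in> set \<Gamma> \<Longrightarrow> length (a e) \<le> clen \<Gamma> e"
  unfolding clen_def by (rule member_le_sum_list) auto

lemma clen_append: "clen (\<Gamma> @ \<Delta>) e = clen \<Gamma> e + clen \<Delta> e"
  by (simp add: clen_def)

lemma clen_Nil: "clen [] e = 0" and clen_Cons: "clen (a # \<Gamma>) e = length (a e) + clen \<Gamma> e"
  by (simp_all add: clen_def)

lemma map_upd_fresh: "\<forall>i\<in>set \<rho>. i < (r :: nat) \<Longrightarrow> r \<le> j \<Longrightarrow> map (s(j := x)) \<rho> = map s \<rho>"
  by auto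

lemma PF_var: assumes "f \<in> set \<Gamma>" shows "PF \<Gamma> f"
proof (rule PF_intro)
  show len: "pbd (clen \<Gamma>) (\<lambda>e. length (f e))"
    using clen_ge[OF assms] by (rule pbd_le[OF pbd_self])
  fix m r :: nat and \<rho> assume lt: "\<forall>i\<in>set \<rho>. i < r"
  obtain n where n: "n < length \<Gamma>" "\<Gamma> ! n = f" using assms by (auto simp: in_set_conv_nth)
  \<comment> \<open>That \<open>\<rho>\<close> is as long as \<open>\<Gamma>\<close> is known only
    from the equation assumed after the program has been chosen; hence the default 0.\<close>
  define a where "a = (if n < length \<rho> then \<rho> ! n else 0)"
  let ?c = "Seq (pour m a (Suc r)) (pour2 m (Suc r) a r)"
  have "exec m ?c u s (20 * length (f e) + 3) u (s(r := f e))"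
    if eq: "map s \<rho> = map (\<lambda>a. a e) \<Gamma>" and em: "\<forall>i\<ge>r. s i = []" for s e u
  proof -
    have ln: "n < length \<rho>" using arg_cong[OF eq, of length] n by simp
    have ar: "a < r" using ln lt by (simp add: a_def)
    have sa: "s a = f e" using arg_cong[OF eq, of "\<lambda>l. l ! n"] n ln by (simp add: a_def)
    have 1: "exec m (pour m a (Suc r)) u s (8 * length (f e) + 1) u (s(a := [], Suc r := rev (f e)))"
      using exec_pour[of a "Suc r" m u s] ar em sa by simp
    have "s(a := [], Suc r := [], a := f e, r := f e) = s(r := f e)"
      using ar em sa by auto
    then have 2: "exec m (pour2 m (Suc r) a r) u (s(a := [], Suc r := rev (f e))) (12 * length (f e) + 1)
      u (s(r := f e))"
      using exec_pour2[of "Suc r" a r m u "s(a := [], Suc r := rev (f e))"] ar em by simp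
    show ?thesis by (rule exec_mono[OF exec_Seq[OF 1 2]]) simp
  qed
  then show "\<exists>c T. pbd (clen \<Gamma>) T \<and> okc c \<and> (\<forall>e s u. map s \<rho> = map (\<lambda>a. a e) \<Gamma> \<longrightarrow>
      (\<forall>i\<ge>r. s i = []) \<longrightarrow> exec m c u s (T e) u (s(r := f e)))"
    by (intro exI[of _ ?c] exI[of _ "\<lambda>e. 20 * length (f e) + 3"] conjI pbd_intros len
        okc_Seq okc_pour okc_pour2) blast
qed

lemma PF_Nil: "PF \<Gamma> (\<lambda>e. [])"
proof (rule PF_intro)
  fix m r :: nat and \<rho> :: "nat list"
  have "exec m Skip u s 0 u (s(r := []))" if "\<forall>i\<ge>r. s i = []" for u s
    using that exec_Skip[of m u s 0] by (metis fun_upd_triv order_refl)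
  then show "\<exists>c T. pbd (clen \<Gamma>) T \<and> okc c \<and> (\<forall>e s u. map s \<rho> = map (\<lambda>a. a e) \<Gamma> \<longrightarrow>
      (\<forall>i\<ge>r. s i = []) \<longrightarrow> exec m c u s (T e) u (s(r := [])))"
    by (intro exI[of _ Skip] exI[of _ "\<lambda>e. 0"]) (auto intro: okc_Skip pbd_const)
qed (simp add: pbd_const)

lemma PF_post:
  assumes "PF \<Gamma> f" "pbd (clen \<Gamma>) (\<lambda>e. length (g (f e)))"
    and "\<And>m r u s. exec m (c m r) u s t u (s(r := g (s r)))" "\<And>m r. okc (c m r)"
  shows "PF \<Gamma> (\<lambda>e. g (f e))"
proof (rule PF_intro[OF assms(2)])
  fix m r :: nat and \<rho> assume lt: "\<forall>i\<in>set \<rho>. i < r"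
  obtain cf T where T: "pbd (clen \<Gamma>) T" and cf: "impl \<Gamma> f m \<rho> r cf T"
    using PF_obtain[OF assms(1) lt] by blast
  have "exec m (Seq cf (c m r)) u s (Suc (T e + t)) u (s(r := g (f e)))"
    if "map s \<rho> = map (\<lambda>a. a e) \<Gamma>" "\<forall>i\<ge>r. s i = []" for e s u
    using exec_Seq[OF implD[OF cf that(1)] assms(3), of r] that(2) by simp
  then show "\<exists>c T. pbd (clen \<Gamma>) T \<and> okc c \<and> (\<forall>e s u. map s \<rho> = map (\<lambda>a. a e) \<Gamma> \<longrightarrow>
      (\<forall>i\<ge>r. s i = []) \<longrightarrow> exec m c u s (T e) u (s(r := g (f e))))"
    using T impl_okc[OF cf] assms(4)
    by (intro exI[of _ "Seq cf (c m r)"] exI[of _ "\<lambda>e. Suc (T e + t)"])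
      (auto intro!: okc_Seq pbd_intros)
qed

lemma PF_Cons: "PF \<Gamma> f \<Longrightarrow> PF \<Gamma> (\<lambda>e. b # f e)"
  by (rule PF_post[where c = "\<lambda>m r. push m r b" and t = 3])
    (auto intro: exec_push okc_push pbd_Suc PF_len)

lemma PF_tl: "PF \<Gamma> f \<Longrightarrow> PF \<Gamma> (\<lambda>e. tl (f e))"
  by (rule PF_post[where c = "\<lambda>m r. pop m r" and t = 1])
    (auto intro: exec_pop okc_pop pbd_le[OF PF_len] simp del: One_nat_def)

text \<open>The three outcomes are the three symbols a head can see on top of a stack.
  \<open>PF_Cons\<close> pushes a constant bit only, so later step functions say
  \<open>if b then True # acc else False # acc\<close> instead of \<open>b # acc\<close> to match
  this shape.\<close>

lemma PF_case:
  assumes d: "PF \<Gamma> d" and f: "PF \<Gamma> f" and g: "PF \<Gamma> g" and h: "PF \<Gamma> h"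
  shows "PF \<Gamma> (\<lambda>e. case d e of [] \<Rightarrow> f e | b # _ \<Rightarrow> if b then g e else h e)" (is "PF \<Gamma> ?F")
proof (rule PF_intro)
  show "pbd (clen \<Gamma>) (\<lambda>e. length (?F e))"
    by (rule pbd_le[OF pbd_add[OF pbd_add[OF PF_len[OF f] PF_len[OF g]] PF_len[OF h]]])
      (auto split: list.splits)
  fix m r :: nat and \<rho> assume lt: "\<forall>i\<in>set \<rho>. i < r"
  obtain cd Td where Td: "pbd (clen \<Gamma>) Td" and cd: "impl \<Gamma> d m \<rho> r cd Td"
    using PF_obtain[OF d lt] by blast
  obtain cf Tf where Tf: "pbd (clen \<Gamma>) Tf" and cf: "impl \<Gamma> f m \<rho> r cf Tf"
    using PF_obtain[OF f lt] by blast
  obtain cg Tg where Tg: "pbd (clen \<Gamma>) Tg" and cg: "impl \<Gamma> g m \<rho> r cg Tg"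
    using PF_obtain[OF g lt] by blast
  obtain ch Th where Th: "pbd (clen \<Gamma>) Th" and ch: "impl \<Gamma> h m \<rho> r ch Th"
    using PF_obtain[OF h lt] by blast
  let ?c = "Seq cd (Cond (\<lambda>q. q (m + r) = 0) cf
    (Cond (\<lambda>q. q (m + r) = 2) (Seq (clear m r) cg) (Seq (clear m r) ch)))"
  let ?B = "\<lambda>e. Suc (3 * length (d e) + 1 + (Tf e + Tg e + Th e))"
  have "exec m ?c u s (Suc (Td e + Suc (Suc (?B e)))) u (s(r := ?F e))"
    if eq: "map s \<rho> = map (\<lambda>a. a e) \<Gamma>" and em: "\<forall>i\<ge>r. s i = []" for e s u
  proof (rule exec_Seq[OF implD[OF cd eq]])
    have s0: "s(r := []) = s" using em by (metis fun_upd_triv order_refl)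
    show "exec m (Cond (\<lambda>q. q (m + r) = 0) cf (Cond (\<lambda>q. q (m + r) = 2) (Seq (clear m r) cg) (Seq (clear m r) ch)))
      u (s(r := d e)) (Suc (Suc (?B e))) u (s(r := ?F e))"
    proof (rule exec_Cond_empty)
      assume "(s(r := d e)) r = []"
      then show "exec m cf u (s(r := d e)) (Suc (?B e)) u (s(r := ?F e))"
        using exec_mono[OF implD[OF cf eq, where u = u], of "Suc (?B e)"] em s0 by simp
    next
      assume "(s(r := d e)) r \<noteq> []"
      then obtain b xs where bx: "d e = b # xs" by (cases "d e") auto
      have cl: "exec m (clear m r) u (s(r := d e)) (3 * length (d e) + 1) u s"
        using exec_clear[of m r u "s(r := d e)"] s0 by simp
      have "exec m (Seq (clear m r) cg) u (s(r := d e)) (?B e) u (s(r := g e))"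
        by (rule exec_mono[OF exec_Seq[OF cl implD[OF cg eq]]]) (use em in auto)
      moreover have "exec m (Seq (clear m r) ch) u (s(r := d e)) (?B e) u (s(r := h e))"
        by (rule exec_mono[OF exec_Seq[OF cl implD[OF ch eq]]]) (use em in auto)
      ultimately have "exec m (if b then Seq (clear m r) cg else Seq (clear m r) ch) u (s(r := d e)) (?B e) u
        (s(r := ?F e))"
        using bx by (cases b) auto
      then show "exec m (Cond (\<lambda>q. q (m + r) = 2) (Seq (clear m r) cg) (Seq (clear m r) ch)) u (s(r := d e))
         (Suc (?B e)) u (s(r := ?F e))"
        by (intro exec_Cond_top[where s = "s(r := d e)" and i = r and b = b and xs = xs]) (auto simp: bx)
    qed
  qed (use em in auto)
  then show "\<exists>c T. pbd (clen \<Gamma>) T \<and> okc c \<and> (\<forall>e s u. map s \<rho> = map (\<lambda>a. a e) \<Gamma> \<longrightarrow>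
      (\<forall>i\<ge>r. s i = []) \<longrightarrow> exec m c u s (T e) u (s(r := ?F e)))"
    by (intro exI[of _ ?c] exI[of _ "\<lambda>e. Suc (Td e + Suc (Suc (?B e)))"] conjI pbd_intros
        Td Tf Tg Th PF_len[OF d] okc_Seq okc_Cond okc_clear impl_okc[OF cd] impl_okc[OF cf]
        impl_okc[OF cg] impl_okc[OF ch]) blast
qed

text \<open>The value of \<open>g\<close> occupies register \<open>r\<close>; \<open>f\<close> is
  computed one register higher and then overwrites it. The length of \<open>g\<close> is polynomial
  in that of \<open>\<Gamma>\<close>, so bounds in the extended context remain polynomial in the old
  one.\<close>

lemma PF_let:
  assumes g: "PF \<Gamma> g" and f: "PF (\<Gamma> @ [g]) f"
  shows "PF \<Gamma> f"
proof (rule PF_intro)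
  have cl: "pbd (clen \<Gamma>) (clen (\<Gamma> @ [g]))"
    by (rule pbd_le[OF pbd_add[OF pbd_self PF_len[OF g]]]) (simp add: clen_append clen_Cons clen_Nil)
  show lf: "pbd (clen \<Gamma>) (\<lambda>e. length (f e))"
    by (rule pbd_trans[OF cl PF_len[OF f]])
  fix m r :: nat and \<rho> assume lt: "\<forall>i\<in>set \<rho>. i < r"
  obtain cg Tg where Tg: "pbd (clen \<Gamma>) Tg" and cg: "impl \<Gamma> g m \<rho> r cg Tg"
    using PF_obtain[OF g lt] by blast
  have lt2: "\<forall>i\<in>set (\<rho> @ [r]). i < Suc r" using lt by (auto simp: less_Suc_eq)
  obtain cf Tf where Tf: "pbd (clen (\<Gamma> @ [g])) Tf" and cf: "impl (\<Gamma> @ [g]) f m (\<rho> @ [r]) (Suc r) cf Tf"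
    using PF_obtain[OF f lt2] by blast
  let ?c = "Seq cg (Seq cf (replace m (Suc r) r))"
  let ?T = "\<lambda>e. Suc (Tg e + Suc (Tf e + (3 * length (g e) + 16 * length (f e) + 5)))"
  have "exec m ?c u s (?T e) u (s(r := f e))"
    if eq: "map s \<rho> = map (\<lambda>a. a e) \<Gamma>" and em: "\<forall>i\<ge>r. s i = []" for e s u
  proof (rule exec_Seq[OF implD[OF cg eq] exec_Seq])
    show "exec m cf u (s(r := g e)) (Tf e) u (s(r := g e, Suc r := f e))"
    proof (rule implD[OF cf])
      show "map (s(r := g e)) (\<rho> @ [r]) = map (\<lambda>a. a e) (\<Gamma> @ [g])"
        unfolding map_append map_upd_fresh[OF lt order_refl] eq by simp
    qed (use em in auto)
    have "s(r := f e, Suc r := []) = s(r := f e)" using em by auto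
    then show "exec m (replace m (Suc r) r) u (s(r := g e, Suc r := f e))
       (3 * length (g e) + 16 * length (f e) + 5) u (s(r := f e))"
      using exec_replace[of r "Suc r" "s(r := g e, Suc r := f e)" m u] em by (simp add: fun_upd_twist)
  qed (use em in auto)
  then show "\<exists>c T. pbd (clen \<Gamma>) T \<and> okc c \<and> (\<forall>e s u. map s \<rho> = map (\<lambda>a. a e) \<Gamma> \<longrightarrow>
      (\<forall>i\<ge>r. s i = []) \<longrightarrow> exec m c u s (T e) u (s(r := f e)))"
    by (intro exI[of _ ?c] exI[of _ ?T] conjI pbd_intros pbd_trans[OF cl Tf] Tg lf PF_len[OF g]
        okc_Seq okc_replace impl_okc[OF cf] impl_okc[OF cg]) blast
qed

lemma PF_weaken:
  assumes f: "PF \<Gamma> f" and sub: "set \<Gamma> \<subseteq> set \<Delta>"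
  shows "PF \<Delta> f"
proof (rule PF_intro)
  have "clen \<Gamma> e \<le> length \<Gamma> * clen \<Delta> e" for e
    using sub clen_ge[of _ \<Delta> e] by (induction \<Gamma>) (auto simp: clen_def intro!: add_mono)
  then have cl: "pbd (clen \<Delta>) (clen \<Gamma>)"
    by (rule pbd_le[OF pbd_mult[OF pbd_const pbd_self]])
  show "pbd (clen \<Delta>) (\<lambda>e. length (f e))"
    by (rule pbd_trans[OF cl PF_len[OF f]])
  fix m r :: nat and \<rho> assume lt: "\<forall>i\<in>set \<rho>. i < r"
  show "\<exists>c T. pbd (clen \<Delta>) T \<and> okc c \<and> (\<forall>e s u. map s \<rho> = map (\<lambda>a. a e) \<Delta> \<longrightarrow>
      (\<forall>i\<ge>r. s i = []) \<longrightarrow> exec m c u s (T e) u (s(r := f e)))"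
  proof (cases "length \<rho> = length \<Delta>")
    case True
    \<comment> \<open>\<open>PF\<close> permits arbitrary registers for the variables, so permuting
      or repeating variables moves no data: each variable of \<open>\<Gamma>\<close> is simply
      looked up at a place where \<open>\<Delta>\<close> holds it.\<close>
    define pos where "pos a = (SOME n. n < length \<Delta> \<and> \<Delta> ! n = a)" for a
    have pos: "pos a < length \<Delta> \<and> \<Delta> ! pos a = a" if "a \<in> set \<Gamma>" for a
    proof -
      have "\<exists>n. n < length \<Delta> \<and> \<Delta> ! n = a" using that sub by (metis in_set_conv_nth subsetD)
      from someI_ex[OF this] show ?thesis unfolding pos_def .
    qed
    define \<rho>' where "\<rho>' = map (\<lambda>a. \<rho> ! pos a) \<Gamma>"
    have lt': "\<forall>i\<in>set \<rho>'. i < r" using lt pos True by (simp add: \<rho>'_def)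
    obtain c T where T: "pbd (clen \<Gamma>) T" and c: "impl \<Gamma> f m \<rho>' r c T"
      using PF_obtain[OF f lt'] by blast
    have "map s \<rho>' = map (\<lambda>a. a e) \<Gamma>" if "map s \<rho> = map (\<lambda>a. a e) \<Delta>" for s e
    proof -
      have "s (\<rho> ! n) = (\<Delta> ! n) e" if "n < length \<Delta>" for n
        using arg_cong[OF \<open>map s \<rho> = _\<close>, of "\<lambda>l. l ! n"] that True by simp
      then show ?thesis using pos by (simp add: \<rho>'_def)
    qed
    then show ?thesis
      using c pbd_trans[OF cl T] unfolding impl_def by (intro exI[of _ c] exI[of _ T]) blast
  next
    case False
    then have "map s \<rho> \<noteq> map (\<lambda>a. a e) \<Delta>" for s and e :: 'a by (metis length_map)
    then show ?thesis by (intro exI[of _ Skip] exI[of _ "\<lambda>_. 0"]) (auto intro: okc_Skip pbd_const)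
  qed
qed

lemma clen_map: "clen (map (\<lambda>a z. a (h z)) \<Gamma>) = (\<lambda>z. clen \<Gamma> (h z))"
  by (simp add: clen_def fun_eq_iff o_def)

text \<open>Substitution: a program sees only the values of the variables, so the program for
  \<open>f\<close> serves at the environments \<open>h z\<close> too.\<close>

lemma PF_reindex:
  assumes "PF \<Gamma> f"
  shows "PF (map (\<lambda>a z. a (h z)) \<Gamma>) (\<lambda>z. f (h z))"
proof (rule PF_intro)
  show "pbd (clen (map (\<lambda>a z. a (h z)) \<Gamma>)) (\<lambda>z. length (f (h z)))"
    unfolding clen_map by (rule pbd_reindex[OF PF_len[OF assms]])
  fix m r :: nat and \<rho> assume lt: "\<forall>i\<in>set \<rho>. i < r"
  obtain c T where T: "pbd (clen \<Gamma>) T" and c: "impl \<Gamma> f m \<rho> r c T"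
    using PF_obtain[OF assms lt] by blast
  show "\<exists>c T. pbd (clen (map (\<lambda>a z. a (h z)) \<Gamma>)) T \<and> okc c \<and>
    (\<forall>e s u. map s \<rho> = map (\<lambda>a. a e) (map (\<lambda>a z. a (h z)) \<Gamma>) \<longrightarrow>
      (\<forall>i\<ge>r. s i = []) \<longrightarrow> exec m c u s (T e) u (s(r := f (h e))))"
    unfolding clen_map using c pbd_reindex[OF T, of h]
    by (intro exI[of _ c] exI[of _ "\<lambda>z. T (h z)"]) (auto simp: impl_def o_def)
qed

text \<open>Recursion on notation, from the right end. The step function also receives the suffix
  starting at the current bit, which supplies position counters.\<close>

primrec prec :: "(bool list \<Rightarrow> bool list \<Rightarrow> bool list) \<Rightarrow> bool list \<Rightarrow> bool list \<Rightarrow> bool list" where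
  "prec G i [] = i"
| "prec G i (b # xs) = G (b # xs) (prec G i xs)"

definition lift :: "('e \<Rightarrow> bool list) list \<Rightarrow> ('e \<times> 'd \<Rightarrow> bool list) list" where
  "lift \<Gamma> = map (\<lambda>a z. a (fst z)) \<Gamma>"

text \<open>Cobham's bounded recursion on notation. Without \<open>B\<close> the accumulator could
  double in every round; with it all rounds obey one polynomial bound.\<close>

lemma PF_prec:
  assumes i: "PF \<Gamma> i" and x: "PF \<Gamma> x"
    and G: "PF (lift \<Gamma> @ [\<lambda>z. fst (snd z), \<lambda>z. snd (snd z)]) (\<lambda>z. G (fst z) (snd (snd z)) (fst (snd z)))"
    and B: "pbd (clen \<Gamma>) B" "\<And>e n. length (prec (G e) (i e) (drop n (x e))) \<le> B e"
  shows "PF \<Gamma> (\<lambda>e. prec (G e) (i e) (x e))"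
proof (rule PF_intro)
  show "pbd (clen \<Gamma>) (\<lambda>e. length (prec (G e) (i e) (x e)))"
    using B(2)[of _ 0] by (intro pbd_le[OF B(1)]) simp
  fix m r :: nat and \<rho> assume lt: "\<forall>i\<in>set \<rho>. i < r"
  have lt1: "\<forall>i\<in>set \<rho>. i < r + 1" and lt2: "\<forall>i\<in>set (\<rho> @ [r, r + 2]). i < r + 3"
    using lt by (auto intro: less_trans)
  obtain ci Ti where Ti: "pbd (clen \<Gamma>) Ti" and ci: "impl \<Gamma> i m \<rho> r ci Ti"
    using PF_obtain[OF i lt] by blast
  obtain cx Tx where Tx: "pbd (clen \<Gamma>) Tx" and cx: "impl \<Gamma> x m \<rho> (r + 1) cx Tx"
    using PF_obtain[OF x lt1] by blast
  obtain cG TG where TG: "pbd (clen (lift \<Gamma> @ [\<lambda>z. fst (snd z), \<lambda>z. snd (snd z)])) TG"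
    and cG: "impl (lift \<Gamma> @ [\<lambda>z. fst (snd z), \<lambda>z. snd (snd z)])
      (\<lambda>z. G (fst z) (snd (snd z)) (fst (snd z))) m (\<rho> @ [r, r + 2]) (r + 3) cG TG"
    using PF_obtain[OF G lt2] by blast
  from TG obtain p where p: "TG (e, acc, ys) \<le> poly p (clen \<Gamma> e + (length acc + length ys))"
    for e acc ys
    unfolding pbd_def by (auto simp: clen_append clen_Cons clen_Nil lift_def clen_map)
  let ?P = "\<lambda>e ys. prec (G e) (i e) ys"
  define body where "body = Seq (Cond (\<lambda>q. q (m + (r + 1)) = 2) (push m (r + 2) True) (push m (r + 2) False))
    (Seq (pop m (r + 1)) (Seq cG (replace m (r + 3) r)))"
  define tb where "tb e = Suc (4 + Suc (1 + Suc (poly p (clen \<Gamma> e + (B e + length (x e))) +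
    (3 * B e + 16 * B e + 5))))" for e
  define tl where "tl e = length (x e) * (tb e + 2) + 1" for e
  \<comment> \<open>Three pours leave \<open>x\<close> reversed in \<open>r + 1\<close>, so popping
    starts with its last bit. Register \<open>r\<close> holds the accumulator, \<open>r + 2\<close>
    collects the suffix consumed so far, and \<open>r + 3\<close> receives the new value.\<close>
  let ?c = "Seq ci (Seq cx (Seq (pour m (r + 1) (r + 2)) (Seq (pour m (r + 2) (r + 3))
    (Seq (pour m (r + 3) (r + 1)) (Seq (While (\<lambda>q. q (m + (r + 1)) \<noteq> 0) body) (clear m (r + 2)))))))"
  let ?T = "\<lambda>e. Suc (Ti e + Suc (Tx e + Suc (8 * length (x e) + 1 + Suc (8 * length (x e) + 1 +
    Suc (8 * length (x e) + 1 + Suc (tl e + (3 * length (x e) + 1)))))))"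
  have "exec m ?c u s (?T e) u (s(r := ?P e (x e)))"
    if eq: "map s \<rho> = map (\<lambda>a. a e) \<Gamma>" and em: "\<forall>i\<ge>r. s i = []" for e s u
  proof (rule exec_Seq[OF implD[OF ci eq] exec_Seq[OF _ exec_Seq[OF _ exec_Seq[OF _ exec_Seq[OF _ exec_Seq]]]]])
    let ?n = "length (x e)"
    let ?s = "\<lambda>a b c d. s(r := a, r + 1 := b, r + 2 := c, r + 3 := d)"
    have s0: "s(r := a) = ?s a [] [] []" "s(r := a, r + 1 := b) = ?s a b [] []" for a b
      using em by auto
    show "exec m cx u (s(r := i e)) (Tx e) u (?s (i e) (x e) [] [])"
      unfolding s0(2)[symmetric]
    proof (rule implD[OF cx])
      show "map (s(r := i e)) \<rho> = map (\<lambda>a. a e) \<Gamma>"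
        unfolding map_upd_fresh[OF lt order_refl] eq by simp
    qed (use em in auto)
    show "exec m (pour m (r + 1) (r + 2)) u (?s (i e) (x e) [] []) (8 * ?n + 1) u
      (?s (i e) [] (rev (x e)) [])"
    proof -
      have "(?s (i e) (x e) [] [])(r + 1 := [], r + 2 := rev (x e)) = ?s (i e) [] (rev (x e)) []" by auto
      then show ?thesis
        using exec_pour[of "r + 1" "r + 2" m u "?s (i e) (x e) [] []"] by simp
    qed
    show "exec m (pour m (r + 2) (r + 3)) u (?s (i e) [] (rev (x e)) []) (8 * ?n + 1) u
      (?s (i e) [] [] (x e))"
    proof -
      have "(?s (i e) [] (rev (x e)) [])(r + 2 := [], r + 3 := x e) = ?s (i e) [] [] (x e)" by auto
      then show ?thesis
        using exec_pour[of "r + 2" "r + 3" m u "?s (i e) [] (rev (x e)) []"] by simp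
    qed
    show "exec m (pour m (r + 3) (r + 1)) u (?s (i e) [] [] (x e)) (8 * ?n + 1) u
      (?s (i e) (rev (x e)) [] [])"
    proof -
      have "(?s (i e) [] [] (x e))(r + 3 := [], r + 1 := rev (x e)) = ?s (i e) (rev (x e)) [] []" by auto
      then show ?thesis
        using exec_pour[of "r + 3" "r + 1" m u "?s (i e) [] [] (x e)"] by simp
    qed
    define st where "st k = ?s (?P e (drop (?n - k) (x e))) (rev (take (?n - k) (x e)))
      (drop (?n - k) (x e)) []" for k
    have "exec m (While (\<lambda>q. q (m + (r + 1)) \<noteq> 0) body) u (st 0) (tl e) u (st ?n)"
    proof (rule exec_drain[where u = "\<lambda>_. u" and t = "tb e"])
      fix k assume k: "k < ?n"
      define n where "n = ?n - Suc k"
      have n: "?n - k = Suc n" "?n - Suc k = n" "n < ?n" using k by (auto simp: n_def)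
      let ?b = "x e ! n"
      let ?ys = "drop (Suc n) (x e)" and ?zs = "rev (take n (x e))"
      let ?acc = "?P e ?ys"
      have bys: "?b # ?ys = drop n (x e)" using n by (simp add: Cons_nth_drop_Suc)
      have P: "G e (?b # ?ys) ?acc = ?P e (drop n (x e))" by (simp flip: bys)
      have st0: "st k = ?s ?acc (?b # ?zs) ?ys []"
        unfolding st_def n using n by (simp add: take_Suc_conv_app_nth)
      have st1: "st (Suc k) = ?s (?P e (drop n (x e))) ?zs (drop n (x e)) []"
        unfolding st_def n by simp
      have 1: "exec m (Cond (\<lambda>q. q (m + (r + 1)) = 2) (push m (r + 2) True) (push m (r + 2) False))
        u (st k) 4 u (?s ?acc (?b # ?zs) (?b # ?ys) [])"
      proof -
        have "(st k)(r + 2 := ?b # ?ys) = ?s ?acc (?b # ?zs) (?b # ?ys) []" by (auto simp: st0)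
        then have "exec m (if ?b then push m (r + 2) True else push m (r + 2) False) u (st k) 3 u
          (?s ?acc (?b # ?zs) (?b # ?ys) [])"
          using exec_push[of m "r + 2" ?b u "st k"] by (cases ?b) (auto simp: st0)
        then have "exec m (Cond (\<lambda>q. q (m + (r + 1)) = 2) (push m (r + 2) True) (push m (r + 2) False))
          u (st k) (Suc 3) u (?s ?acc (?b # ?zs) (?b # ?ys) [])"
          by (intro exec_Cond_top[where s = "st k" and i = "r + 1" and b = ?b and xs = ?zs])
            (auto simp: st0)
        then show ?thesis by simp
      qed
      have 2: "exec m (pop m (r + 1)) u (?s ?acc (?b # ?zs) (?b # ?ys) []) 1 u
        (?s ?acc ?zs (?b # ?ys) [])"
      proof -
        have "(?s ?acc (?b # ?zs) (?b # ?ys) [])(r + 1 := ?zs) = ?s ?acc ?zs (?b # ?ys) []" by auto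
        then show ?thesis
          using exec_pop[of m "r + 1" u "?s ?acc (?b # ?zs) (?b # ?ys) []"] by simp
      qed
      have 3: "exec m cG u (?s ?acc ?zs (?b # ?ys) []) (TG (e, ?acc, ?b # ?ys)) u
        (?s ?acc ?zs (?b # ?ys) (?P e (drop n (x e))))"
      proof -
        have "map (?s ?acc ?zs (?b # ?ys) []) \<rho> = map s \<rho>" using lt by auto
        then have "map (?s ?acc ?zs (?b # ?ys) []) (\<rho> @ [r, r + 2]) =
          map (\<lambda>a. a (e, ?acc, ?b # ?ys)) (lift \<Gamma> @ [\<lambda>z. fst (snd z), \<lambda>z. snd (snd z)])"
          by (simp add: eq lift_def)
        from implD[OF cG this, of u] show ?thesis using em P by simp
      qed
      have 4: "exec m (replace m (r + 3) r) u (?s ?acc ?zs (?b # ?ys) (?P e (drop n (x e))))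
        (3 * B e + 16 * B e + 5) u (st (Suc k))"
      proof -
        have "(?s ?acc ?zs (?b # ?ys) (?P e (drop n (x e))))(r := ?P e (drop n (x e)), r + 3 := []) = st (Suc k)"
          unfolding st1 bys by auto
        then have "exec m (replace m (r + 3) r) u (?s ?acc ?zs (?b # ?ys) (?P e (drop n (x e))))
          (3 * length ?acc + 16 * length (?P e (drop n (x e))) + 5) u (st (Suc k))"
          using exec_replace[of r "r + 3" "?s ?acc ?zs (?b # ?ys) (?P e (drop n (x e)))" m u] em by simp
        then show ?thesis by (rule exec_mono) (intro add_mono mult_le_mono2 B(2) order_refl)
      qed
      have "TG (e, ?acc, ?b # ?ys) \<le> poly p (clen \<Gamma> e + (B e + length (x e)))"
        using B(2)[of e "Suc n"] n by (intro order_trans[OF p] poly_mono_nat add_mono) auto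
      then show "exec m body u (st k) (tb e) u (st (Suc k))"
        unfolding body_def tb_def
        by (intro exec_Seq[OF 1 exec_Seq[OF 2 exec_Seq[OF _ 4]]] exec_mono[OF 3])
    qed (auto simp: st_def tl_def)
    then show "exec m (While (\<lambda>q. q (m + (r + 1)) \<noteq> 0) body) u (?s (i e) (rev (x e)) [] []) (tl e) u
      (?s (?P e (x e)) [] (x e) [])"
      by (simp add: st_def)
    have "(?s (?P e (x e)) [] (x e) [])(r + 2 := []) = s(r := ?P e (x e))" using em by auto
    then show "exec m (clear m (r + 2)) u (?s (?P e (x e)) [] (x e) []) (3 * ?n + 1) u (s(r := ?P e (x e)))"
      using exec_clear[of m "r + 2" u "?s (?P e (x e)) [] (x e) []"] by simp
  qed (use em in auto)
  moreover have "pbd (clen \<Gamma>) (\<lambda>e. poly p (clen \<Gamma> e + (B e + length (x e))))"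
    by (rule pbd_trans[where S = "\<lambda>e. clen \<Gamma> e + (B e + length (x e))"])
      (intro pbd_intros B PF_len[OF x] pbd_poly)+
  then have "pbd (clen \<Gamma>) ?T"
    unfolding tl_def tb_def by (intro pbd_intros Ti Tx PF_len[OF x] B(1))
  moreover have "okc ?c"
    unfolding body_def by (intro okc_Seq okc_While okc_Cond okc_pop okc_push okc_pour okc_clear
        okc_replace impl_okc[OF ci] impl_okc[OF cx] impl_okc[OF cG])
  ultimately show "\<exists>c T. pbd (clen \<Gamma>) T \<and> okc c \<and> (\<forall>e s u. map s \<rho> = map (\<lambda>a. a e) \<Gamma> \<longrightarrow>
      (\<forall>i\<ge>r. s i = []) \<longrightarrow> exec m c u s (T e) u (s(r := ?P e (x e))))"
    by (intro exI[of _ ?c] exI[of _ ?T]) blast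
qed

section \<open>A library of polynomial-time functions\<close>

lemma PF_app1:
  assumes "PF [\<lambda>x. x] F" "PF \<Gamma> a"
  shows "PF \<Gamma> (\<lambda>e. F (a e))"
proof (rule PF_let[OF assms(2)])
  have "PF [a] (\<lambda>e. F (a e))" using PF_reindex[OF assms(1), of a] by simp
  then show "PF (\<Gamma> @ [a]) (\<lambda>e. F (a e))" by (rule PF_weaken) simp
qed

lemma PF_app2:
  assumes "PF [fst, snd] (\<lambda>z. F (fst z) (snd z))" "PF \<Gamma> a" "PF \<Gamma> b"
  shows "PF \<Gamma> (\<lambda>e. F (a e) (b e))"
proof (rule PF_let[OF assms(2)], rule PF_let)
  show "PF (\<Gamma> @ [a]) b" by (rule PF_weaken[OF assms(3)]) auto
  have "PF [a, b] (\<lambda>e. F (a e) (b e))" using PF_reindex[OF assms(1), of "\<lambda>e. (a e, b e)"] by simp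
  then show "PF ((\<Gamma> @ [a]) @ [b]) (\<lambda>e. F (a e) (b e))" by (rule PF_weaken) simp
qed

lemma PF_cong: "PF \<Gamma> f \<Longrightarrow> (\<And>e. g e = f e) \<Longrightarrow> PF \<Gamma> g"
  by presburger

lemma PF_const: "PF \<Gamma> (\<lambda>e. xs)"
  by (induction xs) (auto intro: PF_Nil PF_Cons)

lemma PF_append:
  assumes "PF \<Gamma> a" "PF \<Gamma> b" shows "PF \<Gamma> (\<lambda>e. a e @ b e)"
proof (rule PF_app2[where F = append, OF _ assms])
  let ?G = "\<lambda>(e :: bool list \<times> bool list) ys acc.
    case ys of [] \<Rightarrow> [] | b # _ \<Rightarrow> if b then True # acc else False # acc"
  have eq: "prec (?G e) y x = x @ y" for e x y
    by (induction x) (auto split: list.splits)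
  have "PF [fst, snd] (\<lambda>z. prec (?G z) (snd z) (fst z))"
  proof (rule PF_prec)
    show "pbd (clen [fst, snd]) (clen [fst, snd] :: bool list \<times> bool list \<Rightarrow> nat)"
      by (rule pbd_self)
  qed ((rule PF_case PF_Cons PF_Nil | (rule PF_var, simp add: lift_def))+, simp add: eq clen_def)
  then show "PF [fst, snd] (\<lambda>z. fst z @ snd z)" by (simp add: eq)
qed

text \<open>Numbers that control loops are kept in unary, so membership already includes a
  polynomial bound on the value, see \<open>PU_len\<close>.\<close>

abbreviation PU :: "('e \<Rightarrow> bool list) list \<Rightarrow> ('e \<Rightarrow> nat) \<Rightarrow> bool" where
  "PU \<Gamma> n \<equiv> PF \<Gamma> (\<lambda>e. replicate (n e) True)"

lemma PU_len: "PU \<Gamma> n \<Longrightarrow> pbd (clen \<Gamma>) n"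
  using PF_len[of \<Gamma> "\<lambda>e. replicate (n e) True"] by simp

lemma PU_const: "PU \<Gamma> (\<lambda>e. c)"
  by (rule PF_const)

lemma PU_add: "PU \<Gamma> a \<Longrightarrow> PU \<Gamma> b \<Longrightarrow> PU \<Gamma> (\<lambda>e. a e + b e)"
  using PF_append[of \<Gamma> "\<lambda>e. replicate (a e) True" "\<lambda>e. replicate (b e) True"]
  by (simp add: replicate_add)

lemma PU_Suc: "PU \<Gamma> a \<Longrightarrow> PU \<Gamma> (\<lambda>e. Suc (a e))"
  using PF_Cons[of \<Gamma> "\<lambda>e. replicate (a e) True" True] by simp

lemma PU_length:
  assumes "PF \<Gamma> a" shows "PU \<Gamma> (\<lambda>e. length (a e))"
proof (rule PF_app1[where F = "\<lambda>x. replicate (length x) True", OF _ assms])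
  have eq: "prec (\<lambda>ys acc. True # acc) [] x = replicate (length x) True" for x
    by (induction x) auto
  have "PF [\<lambda>x. x] (\<lambda>x. prec ((\<lambda>x ys acc. True # acc) x) [] x)"
    by (rule PF_prec[where B = "clen [\<lambda>x. x]"])
      (auto simp: eq clen_def lift_def intro!: PF_var PF_Cons PF_Nil pbd_self)
  then show "PF [\<lambda>x. x] (\<lambda>x. replicate (length x) True)" by (simp add: eq)
qed

lemma PU_mult:
  assumes "PU \<Gamma> a" "PU \<Gamma> b" shows "PU \<Gamma> (\<lambda>e. a e * b e)"
proof -
  let ?G = "\<lambda>(e :: bool list \<times> bool list) ys acc. replicate (length (snd e)) True @ acc"
  have eq: "prec (?G e) [] x = replicate (length x * length (snd e)) True" for e x
    by (induction x) (auto simp: replicate_add)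
  have "PF [fst, snd] (\<lambda>z. prec (?G z) [] (fst z))"
  proof (rule PF_prec)
    show "pbd (clen [fst, snd]) (\<lambda>e. clen [fst, snd] e * clen [fst, snd] (e :: bool list \<times> bool list))"
      by (intro pbd_intros)
  qed ((rule PF_append PU_length PF_Nil | (rule PF_var, simp add: lift_def))+,
      auto simp: eq clen_def intro!: mult_le_mono)
  then have "PF [fst, snd] (\<lambda>z. replicate (length (fst z) * length (snd z)) True)" by (simp add: eq)
  from PF_app2[where F = "\<lambda>x y. replicate (length x * length y) True", OF this assms]
  show ?thesis by simp
qed

lemma PU_poly: "PU \<Gamma> n \<Longrightarrow> PU \<Gamma> (\<lambda>e. poly p (n e))"
  by (induction p) (auto intro!: PU_add PU_mult PU_const PF_Nil)

lemma PF_drop: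
  assumes "PU \<Gamma> n" "PF \<Gamma> a" shows "PF \<Gamma> (\<lambda>e. drop (n e) (a e))"
proof -
  have eq: "prec (\<lambda>ys acc. tl acc) y x = drop (length x) y" for x y
    by (induction x) (auto simp: drop_Suc tl_drop)
  have "PF [fst, snd] (\<lambda>z. prec ((\<lambda>z ys acc. tl acc) z) (snd z) (fst z))"
    by (rule PF_prec[where B = "clen [fst, snd]"])
      (auto simp: eq clen_def lift_def intro!: PF_var PF_tl pbd_self)
  then have "PF [fst, snd] (\<lambda>z. drop (length (fst z)) (snd z))" by (simp add: eq)
  from PF_app2[where F = "\<lambda>x y. drop (length x) y", OF this assms]
  show ?thesis by simp
qed

lemma PU_diff: "PU \<Gamma> a \<Longrightarrow> PU \<Gamma> b \<Longrightarrow> PU \<Gamma> (\<lambda>e. a e - b e)"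
  using PF_drop[of \<Gamma> b "\<lambda>e. replicate (a e) True"] by simp

definition PB :: "('e \<Rightarrow> bool list) list \<Rightarrow> ('e \<Rightarrow> bool) \<Rightarrow> bool" where
  "PB \<Gamma> P \<longleftrightarrow> PF \<Gamma> (\<lambda>e. if P e then [True] else [])"

lemma PF_if: "PB \<Gamma> P \<Longrightarrow> PF \<Gamma> a \<Longrightarrow> PF \<Gamma> b \<Longrightarrow> PF \<Gamma> (\<lambda>e. if P e then a e else b e)"
  unfolding PB_def
  by (rule PF_cong[OF PF_case[of \<Gamma> "\<lambda>e. if P e then [True] else []" b a a]]) auto

lemma PB_const: "PB \<Gamma> (\<lambda>e. c)"
  unfolding PB_def by (cases c) (auto intro: PF_const)

lemma PB_if: "PB \<Gamma> P \<Longrightarrow> PB \<Gamma> Q \<Longrightarrow> PB \<Gamma> R \<Longrightarrow> PB \<Gamma> (\<lambda>e. if P e then Q e else R e)"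
  using PF_if[of \<Gamma> P "\<lambda>e. if Q e then [True] else []" "\<lambda>e. if R e then [True] else []"]
  unfolding PB_def by (rule PF_cong) auto

lemma PB_not: "PB \<Gamma> P \<Longrightarrow> PB \<Gamma> (\<lambda>e. \<not> P e)"
  using PB_if[of \<Gamma> P "\<lambda>e. False" "\<lambda>e. True"] by (simp add: PB_const if_bool_eq_conj)

lemma PB_conj: "PB \<Gamma> P \<Longrightarrow> PB \<Gamma> Q \<Longrightarrow> PB \<Gamma> (\<lambda>e. P e \<and> Q e)"
  using PB_if[of \<Gamma> P Q "\<lambda>e. False"] by (simp add: PB_const if_bool_eq_disj)

lemma PB_imp: "PB \<Gamma> P \<Longrightarrow> PB \<Gamma> Q \<Longrightarrow> PB \<Gamma> (\<lambda>e. P e \<longrightarrow> Q e)"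
  using PB_if[of \<Gamma> P Q "\<lambda>e. True"] by (simp add: PB_const if_bool_eq_conj)

lemma PB_nonempty: "PF \<Gamma> a \<Longrightarrow> PB \<Gamma> (\<lambda>e. a e \<noteq> [])"
  unfolding PB_def
  by (rule PF_cong[OF PF_case[of \<Gamma> a "\<lambda>e. []" "\<lambda>e. [True]" "\<lambda>e. [True]"]])
    (auto intro: PF_const split: list.splits)

lemma PB_hd: "PF \<Gamma> a \<Longrightarrow> PB \<Gamma> (\<lambda>e. a e \<noteq> [] \<and> hd (a e))"
  unfolding PB_def
  by (rule PF_cong[OF PF_case[of \<Gamma> a "\<lambda>e. []" "\<lambda>e. [True]" "\<lambda>e. []"]])
    (auto intro: PF_const split: list.splits)

lemma PB_less: "PU \<Gamma> a \<Longrightarrow> PU \<Gamma> b \<Longrightarrow> PB \<Gamma> (\<lambda>e. a e < b e)"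
  using PB_nonempty[OF PU_diff[of \<Gamma> b a]] by (simp add: not_le)

lemma PB_eq: "PU \<Gamma> a \<Longrightarrow> PU \<Gamma> b \<Longrightarrow> PB \<Gamma> (\<lambda>e. a e = b e)"
  using PB_conj[OF PB_not[OF PB_less[of \<Gamma> a b]] PB_not[OF PB_less[of \<Gamma> b a]]]
  by (simp add: not_less eq_iff conj_commute)

text \<open>A for-loop by \<open>prec\<close> over the unary bound: when the suffix
  \<open>True # replicate i True\<close> is processed, its tail has length \<open>i\<close>, which
  recovers the counter.\<close>

lemma PF_loop:
  assumes n: "PU \<Gamma> n"
    and F: "PF (lift \<Gamma> @ [\<lambda>z. replicate (snd z) True]) (\<lambda>z. F (fst z) (snd z))"
  shows "PF \<Gamma> (\<lambda>e. concat (map (F e) [0..<n e]))"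
proof -
  let ?G = "\<lambda>e ys acc. acc @ F e (length (tl ys))"
  have eq: "prec (?G e) [] (replicate k True) = concat (map (F e) [0..<k])" for e k
    by (induction k) auto
  obtain p where p: "length (F e i) \<le> poly p (clen \<Gamma> e + i)" for e i
    using PF_len[OF F] unfolding pbd_def
    by (auto simp: clen_append clen_Cons clen_Nil lift_def clen_map)
  define B where "B e = n e * poly p (clen \<Gamma> e + n e)" for e
  have "PF \<Gamma> (\<lambda>e. prec (?G e) [] (replicate (n e) True))"
  proof (rule PF_prec[OF PF_Nil n])
    let ?D = "lift \<Gamma> @ [\<lambda>z. fst (snd z), \<lambda>z. snd (snd z)] :: ('a \<times> bool list \<times> bool list \<Rightarrow> bool list) list"
    let ?g = "\<lambda>z :: 'a \<times> bool list \<times> bool list. replicate (length (tl (snd (snd z)))) True"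
    have g: "PF ?D ?g" by (intro PU_length PF_tl PF_var) simp
    let ?h = "\<lambda>z :: 'a \<times> bool list \<times> bool list. (fst z, length (tl (snd (snd z))))"
    have R: "PF (map (\<lambda>a z. a (?h z)) (lift \<Gamma> @ [\<lambda>z. replicate (snd z) True]))
      (\<lambda>z. F (fst z) (length (tl (snd (snd z)))))"
      using PF_reindex[OF F, of ?h] unfolding fst_conv snd_conv .
    have "PF (?D @ [?g]) (\<lambda>z. F (fst z) (length (tl (snd (snd z)))))"
      by (rule PF_weaken[OF R]) (auto simp: lift_def)
    then have H: "PF ?D (\<lambda>z. F (fst z) (length (tl (snd (snd z)))))" by (rule PF_let[OF g])
    show "PF ?D (\<lambda>z. fst (snd z) @ F (fst z) (length (tl (snd (snd z)))))"
      by (rule PF_append[OF PF_var H]) simp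
    have "pbd (clen \<Gamma>) (\<lambda>e. clen \<Gamma> e + n e)" by (intro pbd_intros PU_len n)
    from pbd_trans[OF this pbd_poly] show "pbd (clen \<Gamma>) B"
      unfolding B_def by (rule pbd_mult[OF PU_len[OF n]])
    fix e k
    have "length (concat (map (F e) [0..<j])) \<le> B e" if "j \<le> n e" for j
    proof -
      have "length (concat (map (F e) [0..<j])) = (\<Sum>i<j. length (F e i))"
        by (simp add: length_concat o_def interv_sum_list_conv_sum_set_nat atLeast0LessThan)
      also have "\<dots> \<le> (\<Sum>i<j. poly p (clen \<Gamma> e + n e))"
        using that by (intro sum_mono order_trans[OF p] poly_mono_nat) auto
      also have "\<dots> \<le> B e" using that by (simp add: B_def)
      finally show ?thesis .
    qed
    then show "length (prec (?G e) [] (drop k (replicate (n e) True))) \<le> B e"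
      by (simp only: drop_replicate eq diff_le_self)
  qed
  then show ?thesis unfolding eq .
qed

text \<open>For lists fixed in advance, such as the tiles of a machine: the loop is unrolled into
  the program, and \<open>f s\<close> may depend on \<open>s\<close> in any way.\<close>

lemma PF_concat_const:
  "(\<And>s. s \<in> set l \<Longrightarrow> PF \<Gamma> (f s)) \<Longrightarrow> PF \<Gamma> (\<lambda>e. concat (map (\<lambda>s. f s e) l))"
  by (induction l) (auto intro: PF_Nil PF_append)

section \<open>Binary numerals and self-delimiting codes\<close>

fun inc :: "bool list \<Rightarrow> bool list" where
  "inc [] = [True]"
| "inc (b # bs) = (if b then False # inc bs else True # bs)"

lemma inc_nat_bits: "inc (nat_bits n) = nat_bits (Suc n)"
proof (induction n rule: nat_bits.induct)
  case (1 n)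
  show ?case
  proof (cases "n = 0")
    case True
    then show ?thesis by (simp add: nat_bits.simps)
  next
    case False
    then show ?thesis
      using 1 by (subst nat_bits.simps, subst (2) nat_bits.simps) (auto elim!: oddE evenE)
  qed
qed

lemma length_nat_bits: "n < 2 ^ k \<Longrightarrow> length (nat_bits n) \<le> k"
proof (induction k arbitrary: n)
  case (Suc k)
  then have "length (nat_bits (n div 2)) \<le> k" by (intro Suc.IH) auto
  then show ?case by (subst nat_bits.simps) auto
qed (simp add: nat_bits.simps)

lemma length_inc: "length (inc xs) \<le> Suc (length xs)"
  by (induction xs) auto

lemma PF_inc: "PF \<Gamma> a \<Longrightarrow> PF \<Gamma> (\<lambda>e. inc (a e))"
proof (rule PF_app1[where F = inc])
  let ?G = "\<lambda>(e :: bool list) ys acc. case ys of [] \<Rightarrow> [] | b # _ \<Rightarrow> if b then False # acc else True # tl ys"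
  have eq: "prec (?G e) [True] x = inc x" for e x
    by (induction x) auto
  have "PF [\<lambda>x. x] (\<lambda>z. prec (?G z) [True] z)"
  proof (rule PF_prec)
    show "pbd (clen [\<lambda>x. x]) (\<lambda>e. Suc (clen [\<lambda>x. x] e))" by (intro pbd_intros)
    fix e :: "bool list" and n
    show "length (prec (?G e) [True] (drop n e)) \<le> Suc (clen [\<lambda>x. x] e)"
      using length_inc[of "drop n e"] by (simp add: eq clen_def)
  qed (rule PF_case PF_Cons PF_Nil PF_tl | (rule PF_var, simp add: lift_def))+
  then show "PF [\<lambda>x. x] inc" by (simp add: eq)
qed

lemma PF_nat_bits:
  assumes "PU \<Gamma> n" shows "PF \<Gamma> (\<lambda>e. nat_bits (n e))"
proof -
  let ?G = "\<lambda>(e :: bool list) (ys :: bool list) acc. inc acc"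
  have eq: "prec (?G e) [] x = nat_bits (length x)" for e x
    by (induction x) (auto simp: inc_nat_bits nat_bits.simps[of 0])
  have "PF [\<lambda>x. x] (\<lambda>z. prec (?G z) [] z)"
  proof (rule PF_prec)
    show "pbd (clen [\<lambda>x. x]) (\<lambda>e. clen [\<lambda>x. x] e)" by (intro pbd_intros)
    fix e :: "bool list" and n
    have "length (nat_bits (length e - n)) \<le> length e"
      by (rule length_nat_bits) (rule le_less_trans[OF _ less_exp], simp)
    then show "length (prec (?G e) [] (drop n e)) \<le> clen [\<lambda>x. x] e"
      by (simp add: eq clen_def)
  qed (auto simp: lift_def intro!: PF_var PF_inc PF_Nil)
  then have "PF [\<lambda>x. x] (\<lambda>x. nat_bits (length x))" by (simp add: eq)
  from PF_app1[OF this assms] show ?thesis by simp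
qed

lemma delimit_simps: "delimit [] = [False]" "delimit (b # xs) = True # b # delimit xs"
  by (simp_all add: delimit_def)

lemma length_delimit: "length (delimit xs) = 2 * length xs + 1"
  by (induction xs) (auto simp: delimit_simps)

lemma PF_delimit: "PF \<Gamma> a \<Longrightarrow> PF \<Gamma> (\<lambda>e. delimit (a e))"
proof (rule PF_app1[where F = delimit])
  let ?G = "\<lambda>(e :: bool list) ys acc. case ys of [] \<Rightarrow> [] | b # _ \<Rightarrow> if b then True # True # acc else True # False # acc"
  have eq: "prec (?G e) [False] x = delimit x" for e x
    by (induction x) (auto simp: delimit_simps)
  have "PF [\<lambda>x. x] (\<lambda>z. prec (?G z) [False] z)"
  proof (rule PF_prec)
    show "pbd (clen [\<lambda>x. x]) (\<lambda>e. 2 * clen [\<lambda>x. x] e + 1)" by (intro pbd_intros)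
  qed ((rule PF_case PF_Cons PF_Nil | (rule PF_var, simp add: lift_def))+,
      auto simp: eq clen_def length_delimit)
  then show "PF [\<lambda>x. x] delimit" by (simp add: eq)
qed

lemma PF_rev: "PF \<Gamma> a \<Longrightarrow> PF \<Gamma> (\<lambda>e. rev (a e))"
proof (rule PF_app1[where F = rev])
  let ?G = "\<lambda>(e :: bool list) ys acc. acc @ (case ys of [] \<Rightarrow> [] | b # _ \<Rightarrow> if b then [True] else [False])"
  have eq: "prec (?G e) [] x = rev x" for e x
    by (induction x) auto
  have "PF [\<lambda>x. x] (\<lambda>z. prec (?G z) [] z)"
    by (rule PF_prec[where B = "clen [\<lambda>x. x]"])
      ((rule PF_append PF_case PF_const pbd_self | (rule PF_var, simp add: lift_def))+,
       simp add: eq clen_def)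
  then show "PF [\<lambda>x. x] rev" by (simp add: eq)
qed

section \<open>Running a machine as a subroutine\<close>

text \<open>\<open>turing_machine\<close> constrains \<open>delta\<close> on legal states and
  symbols only, so legality of configurations has to be carried along.\<close>

definition wf_cfg :: "tm \<Rightarrow> config \<Rightarrow> bool" where
  "wf_cfg M = (\<lambda>(q, ts). q < nstates M \<and> length ts = ntapes M \<and>
     (\<forall>j<ntapes M. \<forall>p. fst (ts ! j) p < nsymbols M))"

lemma delta_wf:
  assumes "turing_machine M" "wf_cfg M (q, ts)" "delta M q (map (\<lambda>(c, h). c h) ts) = (q', as)"
  shows "q' < nstates M" "length as = ntapes M"
    "\<And>j. j < ntapes M \<Longrightarrow> fst (as ! j) < nsymbols M \<and> snd (as ! j) \<in> {-1, 0, 1}"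
proof -
  let ?ss = "map (\<lambda>(c, h). c h) ts"
  have "q < nstates M" "length ?ss = ntapes M" "\<forall>s\<in>set ?ss. s < nsymbols M"
    using assms(2) by (auto simp: wf_cfg_def in_set_conv_nth) (metis fst_conv)
  moreover have T: "\<forall>q<nstates M. \<forall>ss. length ss = ntapes M \<and> (\<forall>s\<in>set ss. s < nsymbols M) \<longrightarrow>
      (case delta M q ss of (q', as) \<Rightarrow> q' < nstates M \<and> length as = ntapes M \<and>
        (\<forall>(s, d)\<in>set as. s < nsymbols M \<and> d \<in> {-1, 0, 1}))"
    using assms(1) unfolding turing_machine_def Let_def by (elim conjE)
  ultimately have *: "q' < nstates M \<and> length as = ntapes M \<and>
      (\<forall>(s, d)\<in>set as. s < nsymbols M \<and> d \<in> {-1, 0, 1})"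
    using T[rule_format, of q ?ss] assms(3) by simp
  then show "q' < nstates M" "length as = ntapes M" by auto
  fix j assume "j < ntapes M"
  then have "as ! j \<in> set as" using * by simp
  with * show "fst (as ! j) < nsymbols M \<and> snd (as ! j) \<in> {-1, 0, 1}"
    by (cases "as ! j") auto
qed

lemma step_eq:
  assumes "q \<noteq> 1" "delta M q (map (\<lambda>(c, h). c h) ts) = (q', as)" "length as = length ts"
  shows "step M (q, ts) = (q', map (\<lambda>j. upd_tape (as ! j) (ts ! j)) [0..<length ts])"
  using assms by (auto simp: step_def upd_tape_def split_beta intro!: nth_equalityI)

lemma wf_cfg_step:
  assumes "turing_machine M" "wf_cfg M C"
  shows "wf_cfg M (step M C)"
proof (cases C)
  case (Pair q ts)
  show ?thesis
  proof (cases "q = 1")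
    case True
    then show ?thesis using assms Pair by (simp add: step_def)
  next
    case False
    obtain q' as where d: "delta M q (map (\<lambda>(c, h). c h) ts) = (q', as)" by force
    note w = delta_wf[OF assms(1) assms(2)[unfolded Pair] d]
    have l: "length ts = ntapes M" using assms(2) Pair by (simp add: wf_cfg_def)
    show ?thesis using assms(2) w l
      unfolding Pair by (subst step_eq[OF False d])
        (auto simp: wf_cfg_def upd_tape_def split_beta)
  qed
qed

lemma wf_cfg_initial:
  assumes "turing_machine M" shows "wf_cfg M (initial_config M w)"
  using assms by (auto simp: wf_cfg_def initial_config_def turing_machine_def tape_of_def nth_Cons')

lemma wf_cfg_run: "turing_machine M \<Longrightarrow> wf_cfg M ((step M ^^ t) (initial_config M w))"
  by (induction t) (auto intro: wf_cfg_step wf_cfg_initial)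

lemma step_halted: "fst C = 1 \<Longrightarrow> (step M ^^ t) C = C"
  by (cases C, induction t) (auto simp: step_def)

lemma computes_within_mono:
  assumes "computes_within M xs ys t" "t \<le> t'" shows "computes_within M xs ys t'"
proof -
  obtain d where d: "t' = d + t" using assms(2) by (metis add.commute le_Suc_ex)
  have "fst ((step M ^^ t) (initial_config M xs)) = 1"
    using assms(1) by (auto simp: computes_within_def split_beta Let_def)
  from step_halted[OF this, of d M] show ?thesis
    using assms(1) by (simp add: computes_within_def d funpow_add)
qed

section \<open>Moving words between machine tapes and registers\<close>

definition readin :: "nat \<Rightarrow> nat \<Rightarrow> nat \<Rightarrow> com" where
  "readin m i j = While (\<lambda>r. r i \<noteq> 0)
     (Seq (Cond (\<lambda>r. r i = 2) (push m j True) (push m j False)) (act1 i (\<lambda>_. (0, 1))))"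

lemma exec_readin:
  assumes i: "i < m" and ui: "u i = (tape_of xs, 0)"
  shows "exec m (readin m i j) u s (8 * length xs + 1) (u(i := (\<lambda>_. 0, int (length xs))))
    (s(j := rev xs @ s j))"
proof -
  define ut where "ut k = u(i := (\<lambda>p. if p < int k then 0 else tape_of xs p, int k))" for k
  define st where "st k = s(j := rev (take k xs) @ s j)" for k
  have rd: "reads \<sigma> i = tape_of xs (int k)" if "rep m \<sigma> (ut k) (st k)" for \<sigma> k
    using rep_reads_low[OF that i] by (simp add: reads_def ut_def)
  have "exec m (readin m i j) (ut 0) (st 0) (length xs * (6 + 2) + 1) (ut (length xs)) (st (length xs))"
    unfolding readin_def
  proof (rule exec_While)
    fix k \<sigma> assume "k < length xs" "rep m \<sigma> (ut k) (st k)"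
    then show "reads \<sigma> i \<noteq> 0" using rd[of \<sigma> k] by (simp add: tape_of_def)
  next
    fix \<sigma> assume "rep m \<sigma> (ut (length xs)) (st (length xs))"
    then show "\<not> reads \<sigma> i \<noteq> 0" using rd by (simp add: tape_of_def)
  next
    fix k assume k: "k < length xs"
    have "(st k)(j := xs ! k # st k j) = st (Suc k)"
      using k by (auto simp: st_def take_Suc_conv_app_nth)
    then have p: "exec m (push m j (xs ! k)) (ut k) (st k) 3 (ut k) (st (Suc k))"
      using exec_push[of m j "xs ! k" "ut k" "st k"] by simp
    have 1: "exec m (Cond (\<lambda>r. r i = 2) (push m j True) (push m j False)) (ut k) (st k) (Suc 3) (ut k) (st (Suc k))"
    proof (cases "xs ! k")
      case True
      then show ?thesis using p k by (intro exec_Cond_True) (auto simp: rd tape_of_def)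
    next
      case False
      then show ?thesis using p k by (intro exec_Cond_False) (auto simp: rd tape_of_def)
    qed
    have "(ut k)(i := upd_tape (0, 1) (ut k i)) = ut (Suc k)"
      by (auto simp: ut_def upd_tape_def fun_eq_iff)
    then have 2: "exec m (act1 i (\<lambda>_. (0, 1))) (ut k) (st (Suc k)) 1 (ut (Suc k)) (st (Suc k))"
      using exec_act1_low[OF i, of "\<lambda>_. (0, 1)" "ut k"] by simp
    show "exec m (Seq (Cond (\<lambda>r. r i = 2) (push m j True) (push m j False)) (act1 i (\<lambda>_. (0, 1))))
      (ut k) (st k) 6 (ut (Suc k)) (st (Suc k))"
      using exec_Seq[OF 1 2] by (simp add: eval_nat_numeral)
  qed
  moreover have "ut 0 = u" using ui by (auto simp: ut_def tape_of_def fun_eq_iff)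
  moreover have "ut (length xs) = u(i := (\<lambda>_. 0, int (length xs)))"
    by (auto simp: ut_def tape_of_def fun_eq_iff)
  ultimately show ?thesis by (simp add: st_def algebra_simps)
qed

definition writeout :: "nat \<Rightarrow> nat \<Rightarrow> nat \<Rightarrow> com" where
  "writeout m j i = While (\<lambda>r. r (m + j) \<noteq> 0)
     (Seq (Cond (\<lambda>r. r (m + j) = 2) (act1 i (\<lambda>_. (bitsym True, 1))) (act1 i (\<lambda>_. (bitsym False, 1)))) (pop m j))"

lemma exec_writeout:
  assumes i: "i < m" and ui: "u i = (\<lambda>_. 0, 0)"
  shows "exec m (writeout m j i) u s (6 * length (s j) + 1) (u(i := (tape_of (s j), int (length (s j)))))
    (s(j := []))"
proof -
  let ?xs = "s j"
  define ut where "ut k = u(i := (tape_of (take k ?xs), int k))" for k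
  define st where "st k = s(j := drop k ?xs)" for k
  have "exec m (writeout m j i) (ut 0) (st 0) (6 * length ?xs + 1) (ut (length ?xs)) (st (length ?xs))"
    unfolding writeout_def
  proof (rule exec_drain[where t = 4])
    fix k assume k: "k < length ?xs"
    let ?b = "?xs ! k"
    have top: "st k j = ?b # drop (Suc k) ?xs" using k by (simp add: st_def Cons_nth_drop_Suc)
    have "(tape_of (take k ?xs))(int k := bitsym ?b) = tape_of (take (Suc k) ?xs)"
    proof
      fix p show "((tape_of (take k ?xs))(int k := bitsym ?b)) p = tape_of (take (Suc k) ?xs) p"
      proof (cases "p = int k")
        case True
        then show ?thesis using k by (simp add: tape_of_def bitsym_def)
      next
        case False
        then show ?thesis using k by (auto simp: tape_of_def min_def nth_append take_Suc_conv_app_nth)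
      qed
    qed
    then have "(ut k)(i := upd_tape (bitsym ?b, 1) (ut k i)) = ut (Suc k)"
      by (simp add: ut_def upd_tape_def add.commute)
    then have "exec m (act1 i (\<lambda>_. (bitsym ?b, 1))) (ut k) (st k) 1 (ut (Suc k)) (st k)"
      using exec_act1_low[OF i, of "\<lambda>_. (bitsym ?b, 1)" "ut k"] by simp
    then have 1: "exec m (Cond (\<lambda>r. r (m + j) = 2) (act1 i (\<lambda>_. (bitsym True, 1))) (act1 i (\<lambda>_. (bitsym False, 1))))
      (ut k) (st k) (Suc 1) (ut (Suc k)) (st k)"
      by (intro exec_Cond_top[where s = "st k" and i = j, OF top]) (cases ?b, auto)
    have "(st k)(j := tl (st k j)) = st (Suc k)" unfolding top by (simp add: st_def)
    then show "exec m (Seq (Cond (\<lambda>r. r (m + j) = 2) (act1 i (\<lambda>_. (bitsym True, 1))) (act1 i (\<lambda>_. (bitsym False, 1))))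
      (pop m j)) (ut k) (st k) 4 (ut (Suc k)) (st (Suc k))"
      using exec_Seq[OF 1 exec_pop, of j] by (simp add: eval_nat_numeral)
  qed (auto simp: st_def)
  moreover have "ut 0 = u" using ui by (auto simp: ut_def)
  ultimately show ?thesis using ui by (simp add: st_def ut_def)
qed

text \<open>No tape stores a head position; a register of matching length counts the steps back to
  cell 0.\<close>

definition rewind :: "nat \<Rightarrow> nat \<Rightarrow> nat \<Rightarrow> com" where
  "rewind m j i = While (\<lambda>r. r (m + j) \<noteq> 0) (Seq (act1 i (\<lambda>x. (x, -1))) (pop m j))"

lemma exec_rewind:
  assumes i: "i < m" and ui: "u i = (c, int (length (s j)))"
  shows "exec m (rewind m j i) u s (5 * length (s j) + 1) (u(i := (c, 0))) (s(j := []))"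
proof -
  let ?xs = "s j"
  define ut where "ut k = u(i := (c, int (length ?xs) - int k))" for k
  define st where "st k = s(j := drop k ?xs)" for k
  have "exec m (rewind m j i) (ut 0) (st 0) (5 * length ?xs + 1) (ut (length ?xs)) (st (length ?xs))"
    unfolding rewind_def
  proof (rule exec_drain[where t = 3])
    fix k assume k: "k < length ?xs"
    have "(ut k)(i := upd_tape (reads (ut k) i, -1) (ut k i)) = ut (Suc k)"
      by (simp add: ut_def upd_tape_def reads_def algebra_simps)
    then have 1: "exec m (act1 i (\<lambda>x. (x, -1))) (ut k) (st k) 1 (ut (Suc k)) (st k)"
      using exec_act1_low[OF i, of "\<lambda>x. (x, -1)" "ut k"] by simp
    have "(st k)(j := tl (st k j)) = st (Suc k)" by (simp add: st_def tl_drop drop_Suc)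
    then show "exec m (Seq (act1 i (\<lambda>x. (x, -1))) (pop m j)) (ut k) (st k) 3 (ut (Suc k)) (st (Suc k))"
      using exec_Seq[OF 1 exec_pop, of j] by (simp add: eval_nat_numeral)
  qed (auto simp: st_def)
  moreover have "ut 0 = u" using ui by (auto simp: ut_def)
  ultimately show ?thesis by (simp add: st_def ut_def)
qed

lemma okc_readin: "okc (readin m i j)" and okc_writeout: "okc (writeout m j i)"
  and okc_rewind: "okc (rewind m j i)"
  unfolding readin_def writeout_def rewind_def
  by (intro okc_While okc_Seq okc_Cond okc_push okc_pop okc_act1; simp add: bitsym_le)+


text \<open>The simulation writes states of the subroutine as symbols, so it fits only alphabets
  that are large enough; here the alphabet is fixed, where \<open>okc\<close> leaves it
  open.\<close>

definition okS :: "nat \<Rightarrow> com \<Rightarrow> bool" where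
  "okS S c \<longleftrightarrow> (\<exists>K. wf_com K S c)"

lemma okS_okc: "okc c \<Longrightarrow> 3 \<le> S \<Longrightarrow> okS S c"
  unfolding okS_def okc_def by blast

lemma okS_Seq: "okS S c \<Longrightarrow> okS S d \<Longrightarrow> okS S (Seq c d)"
  unfolding okS_def wf_com.simps by (metis wf_com_mono max.cobounded1 max.cobounded2)

lemma okS_While: "okS S c \<Longrightarrow> okS S (While b c)"
  unfolding okS_def wf_com.simps .

text \<open>Layout: tape 0 is the input and output tape, tapes \<open>1..k\<close> are those of the subroutine, tape
  \<open>k + 1\<close> stores its state as a symbol, and tape \<open>k + 2\<close> logs the moves of its first head, which
  are undone in the end in order to find the first symbol of its output.\<close>

definition layout :: "nat \<Rightarrow> tape \<Rightarrow> config \<Rightarrow> tape \<Rightarrow> tapes" where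
  "layout k y C lg i = (if i = 0 then y else if i \<le> k then snd C ! (i - 1)
     else if i = k + 1 then ((\<lambda>_. 0)(0 := fst C), 0) else if i = k + 2 then lg else (\<lambda>_. 0, 0))"

text \<open>A log entry is the move plus 2, hence 1, 2 or 3 and never the blank that marks where the
  log begins. The guard keeps the action legal on symbols out of range for \<open>M\<close>, where
  \<open>delta\<close> is unconstrained.\<close>

definition sim_act :: "tm \<Rightarrow> (nat \<Rightarrow> nat) \<Rightarrow> nat \<Rightarrow> nat \<times> int" where
  "sim_act M r i = (let k = ntapes M; (q, as) = delta M (r (k + 1)) (map (\<lambda>j. r (j + 1)) [0..<k]) in
     if r (k + 1) < nstates M \<and> (\<forall>j<k. r (j + 1) < nsymbols M) then
       if 1 \<le> i \<and> i \<le> k then as ! (i - 1)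
       else if i = k + 1 then (q, 0)
       else if i = k + 2 then (nat (snd (as ! 0) + 2), 1)
       else (r i, 0)
     else (r i, 0))"

text \<open>The entry being the move plus 2, \<open>2 - entry\<close> is the reverse move; the range
  test keeps the step legal on all other symbols.\<close>

definition undo_act :: "nat \<Rightarrow> (nat \<Rightarrow> nat) \<Rightarrow> nat \<Rightarrow> nat \<times> int" where
  "undo_act k r i =
     (if i = 1 then (r i, if r (k + 2) \<le> 3 \<and> 1 \<le> r (k + 2) then 2 - int (r (k + 2)) else 0)
      else if i = k + 2 then (r i, -1) else (r i, 0))"

lemma okS_sim:
  assumes M: "turing_machine M" and S: "nstates M \<le> S" "nsymbols M \<le> S" "4 \<le> S"
  shows "okS S (Act (sim_act M))"
  unfolding okS_def
proof (rule exI[of _ "ntapes M + 3"])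
  let ?k = "ntapes M"
  have "act_ok (?k + 3) S r (sim_act M r)" if r: "\<And>i. r i < S" for r
  proof -
    obtain q as where d: "delta M (r (?k + 1)) (map (\<lambda>j. r (j + 1)) [0..<?k]) = (q, as)" by force
    show ?thesis
    proof (cases "r (?k + 1) < nstates M \<and> (\<forall>j<?k. r (j + 1) < nsymbols M)")
      case True
      define ts where "ts = map (\<lambda>j. (\<lambda>_::int. r (j + 1), 0 :: int)) [0..<?k]"
      have ts: "map (\<lambda>(c, h). c h) ts = map (\<lambda>j. r (j + 1)) [0..<?k]"
        by (simp add: ts_def o_def)
      have w: "wf_cfg M (r (?k + 1), ts)" using True by (simp add: wf_cfg_def ts_def)
      note dw = delta_wf[OF M w d[folded ts]]
      have k: "1 \<le> ?k" using M by (simp add: turing_machine_def)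
      have "nat (snd (as ! 0) + 2) < S" using dw(3)[of 0] k S by auto
      moreover have "fst (as ! (j - 1)) < S \<and> snd (as ! (j - 1)) \<in> {-1, 0, 1}" if "1 \<le> j \<and> j \<le> ?k" for j
      proof -
        have "j - 1 < ?k" using that by linarith
        from dw(3)[OF this] show ?thesis using S by simp
      qed
      ultimately show ?thesis
        unfolding act_ok_def sim_act_def Let_def d prod.case
        using True dw(1) S r k by simp
    next
      case False
      then have "sim_act M r i = (r i, 0)" for i
        unfolding sim_act_def Let_def d prod.case by (rule if_not_P)
      then show ?thesis using r by (simp add: act_ok_def)
    qed
  qed
  then show "wf_com (?k + 3) S (Act (sim_act M))" by (simp add: act_wf_def)
qed

lemma okc_undo: "okc (Act (undo_act k))"
  unfolding okc_def
proof (intro exI allI impI)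
  fix S :: nat assume "3 \<le> S"
  have "act_ok (k + 3) S r (undo_act k r)" if "\<And>i. r i < S" for r
    using that by (auto simp: act_ok_def undo_act_def)
  then show "wf_com (k + 3) S (Act (undo_act k))" by (simp add: act_wf_def)
qed

lemma exec_Act_low:
  assumes "\<And>\<sigma> i. rep m \<sigma> u s \<Longrightarrow> i < m \<Longrightarrow> upd_tape (f (reads \<sigma>) i) (u i) = u' i"
    and "\<And>r i. m \<le> i \<Longrightarrow> f r i = (r i, 0)"
  shows "exec m (Act f) u s 1 u' s"
  unfolding exec_def
proof (intro allI impI)
  fix \<sigma> assume rep: "rep m \<sigma> u s"
  have "upd_tape (f (reads \<sigma>) i) (\<sigma> i) = u' i" if "i < m" for i
    using assms(1)[OF rep that] rep that by (simp add: rep_def)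
  moreover have "upd_tape (f (reads \<sigma>) (m + i)) (\<sigma> (m + i)) = \<sigma> (m + i)" for i
    by (simp add: assms(2))
  ultimately have "rep m (\<lambda>i. upd_tape (f (reads \<sigma>) i) (\<sigma> i)) u' s"
    using rep by (simp add: rep_def)
  then show "\<exists>\<sigma>'. runs (Act f) \<sigma> 1 \<sigma>' \<and> rep m \<sigma>' u' s"
    using runs_Act[of f \<sigma>] by blast
qed

lemma upd_tape_move: "upd_tape (reads u i, d) (u i) = (fst (u i), snd (u i) + d)"
  by (simp add: upd_tape_def reads_def split_beta)

text \<open>After the first loop the log head stands one cell past the last entry, hence the single
  step left; the second loop stops at the blank cell -1.\<close>

definition simulate :: "tm \<Rightarrow> com" where
  "simulate M = (let k = ntapes M in
     Seq (While (\<lambda>r. r (k + 1) \<noteq> 1) (Act (sim_act M)))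
    (Seq (act1 (k + 2) (\<lambda>x. (x, -1))) (While (\<lambda>r. r (k + 2) \<noteq> 0) (Act (undo_act k)))))"

lemma okS_simulate:
  assumes "turing_machine M" "nstates M \<le> S" "nsymbols M \<le> S" "4 \<le> S"
  shows "okS S (simulate M)"
  unfolding simulate_def Let_def using assms
  by (intro okS_Seq okS_While okS_sim okS_okc okc_undo okc_act1) auto

text \<open>Each loop takes \<open>3 * n + 1\<close> steps, where \<open>n \<le> t\<close> is the
  first halting time; the step back adds 1 and the two \<open>Seq\<close> add 2.\<close>

lemma exec_simulate:
  assumes M: "turing_machine M" and comp: "computes_within M w ys t" and m: "m = ntapes M + 3"
  shows "\<exists>C lg. length (snd C) = ntapes M \<and> snd C ! 0 = (tape_of ys, 0) \<and>
    exec m (simulate M) (layout (ntapes M) y (initial_config M w) (\<lambda>_. 0, 0)) s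
      (6 * t + 5) (layout (ntapes M) y C lg) s"
proof -
  define k where "k = ntapes M"
  have k: "1 \<le> k" using M by (simp add: turing_machine_def k_def)
  define cf where "cf t = (step M ^^ t) (initial_config M w)" for t
  have wf: "wf_cfg M (cf t)" for t unfolding cf_def by (rule wf_cfg_run[OF M])
  have lk: "length (snd (cf t)) = k" for t using wf[of t] by (simp add: wf_cfg_def k_def split_beta)
  have fin: "fst (cf t) = 1 \<and> fst (snd (cf t) ! 0) = tape_of ys"
    using comp by (auto simp: computes_within_def cf_def split_beta Let_def)
  \<comment> \<open>The simulating loop stops at the first halting time, possibly before
    \<open>t\<close>; from then on the configuration is constant.\<close>
  define n where "n = (LEAST t. fst (cf t) = 1)"
  have n1: "fst (cf n) = 1" unfolding n_def by (rule LeastI[of "\<lambda>t. fst (cf t) = 1", OF conjunct1[OF fin]])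
  have nt: "n \<le> t" unfolding n_def by (rule Least_le[of "\<lambda>t. fst (cf t) = 1", OF conjunct1[OF fin]])
  have nl: "fst (cf j) \<noteq> 1" if "j < n" for j using not_less_Least[of j "\<lambda>t. fst (cf t) = 1"] that n_def by blast
  have "cf t = cf n"
  proof -
    obtain d where "t = d + n" using nt by (metis add.commute le_Suc_ex)
    then show ?thesis using step_halted[OF n1, of d M] by (simp add: cf_def funpow_add)
  qed
  with fin have out: "fst (snd (cf n) ! 0) = tape_of ys" by simp
  define hd0 where "hd0 j = snd (snd (cf j) ! 0)" for j
  have hd00: "hd0 0 = 0" by (simp add: hd0_def cf_def initial_config_def)
  define dl where "dl j = hd0 (Suc j) - hd0 j" for j
  define lg where "lg j = (\<lambda>p::int. if 0 \<le> p \<and> p < int j then nat (dl (nat p) + 2) else 0)" for j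
  have stp: "\<exists>q as. delta M (fst (cf j)) (map (\<lambda>(c, h). c h) (snd (cf j))) = (q, as) \<and> length as = k \<and>
    cf (Suc j) = (q, map (\<lambda>i. upd_tape (as ! i) (snd (cf j) ! i)) [0..<k]) \<and> dl j = snd (as ! 0)"
    if "j < n" for j
  proof -
    obtain q as where d: "delta M (fst (cf j)) (map (\<lambda>(c, h). c h) (snd (cf j))) = (q, as)" by force
    have w: "wf_cfg M (fst (cf j), snd (cf j))" using wf[of j] by simp
    have la: "length as = k" using delta_wf(2)[OF M w d] by (simp add: k_def)
    have "step M (fst (cf j), snd (cf j)) = (q, map (\<lambda>i. upd_tape (as ! i) (snd (cf j) ! i)) [0..<k])"
      using step_eq[OF nl[OF that] d] la lk by simp
    then have c: "cf (Suc j) = (q, map (\<lambda>i. upd_tape (as ! i) (snd (cf j) ! i)) [0..<k])"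
      by (simp add: cf_def)
    have "dl j = snd (as ! 0)" using k
      by (simp add: dl_def hd0_def c upd_tape_def split_beta)
    then show ?thesis using d la c by blast
  qed
  have dlr: "dl j \<in> {-1, 0, 1}" if jn: "j < n" for j
  proof -
    obtain q as where d: "delta M (fst (cf j)) (map (\<lambda>(c, h). c h) (snd (cf j))) = (q, as)" "dl j = snd (as ! 0)"
      using stp[OF jn] by blast
    have w: "wf_cfg M (fst (cf j), snd (cf j))" using wf[of j] by simp
    show ?thesis using delta_wf(3)[OF M w d(1), of 0] k d(2) by (simp add: k_def)
  qed
  have low: "reads \<sigma> i = reads u i" if "rep m \<sigma> u s" "i < m" for \<sigma> u i using rep_reads_low that .
  have 1: "exec m (While (\<lambda>r. r (k + 1) \<noteq> 1) (Act (sim_act M))) (layout k y (cf 0) (lg 0, int 0)) s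
    (n * (1 + 2) + 1) (layout k y (cf n) (lg n, int n)) s"
  proof (rule exec_While[where s = "\<lambda>_. s" and u = "\<lambda>j. layout k y (cf j) (lg j, int j)"])
    fix j \<sigma> assume j: "j < n" and rep: "rep m \<sigma> (layout k y (cf j) (lg j, int j)) s"
    have "reads \<sigma> (k + 1) = fst (cf j)" using low[OF rep, of "k + 1"] m
      by (simp add: reads_def layout_def k_def)
    then show "reads \<sigma> (k + 1) \<noteq> 1" using nl[OF j] by simp
  next
    fix \<sigma> assume rep: "rep m \<sigma> (layout k y (cf n) (lg n, int n)) s"
    have "reads \<sigma> (k + 1) = fst (cf n)" using low[OF rep, of "k + 1"] m
      by (simp add: reads_def layout_def k_def)
    then show "\<not> reads \<sigma> (k + 1) \<noteq> 1" using n1 by simp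
  next
    fix j assume j: "j < n"
    obtain q as where d: "delta M (fst (cf j)) (map (\<lambda>(c, h). c h) (snd (cf j))) = (q, as)" "length as = k"
      "cf (Suc j) = (q, map (\<lambda>i. upd_tape (as ! i) (snd (cf j) ! i)) [0..<k])" "dl j = snd (as ! 0)"
      using stp[OF j] by blast
    show "exec m (Act (sim_act M)) (layout k y (cf j) (lg j, int j)) s 1
      (layout k y (cf (Suc j)) (lg (Suc j), int (Suc j))) s"
    proof (rule exec_Act_low)
      fix \<sigma> i assume rep: "rep m \<sigma> (layout k y (cf j) (lg j, int j)) s" and i: "i < m"
      let ?r = "reads \<sigma>"
      have rq: "?r (k + 1) = fst (cf j)" using low[OF rep, of "k + 1"] m
        by (simp add: reads_def layout_def k_def)
      have rt: "?r (Suc l) = fst (snd (cf j) ! l) (snd (snd (cf j) ! l))" if "l < k" for l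
        using low[OF rep, of "Suc l"] m that by (simp add: reads_def layout_def k_def)
      have ri: "?r i = reads (layout k y (cf j) (lg j, int j)) i" by (rule low[OF rep i])
      have "map (\<lambda>l. ?r (l + 1)) [0..<k] = map (\<lambda>(c, h). c h) (snd (cf j))"
        using lk[of j] by (intro nth_equalityI) (auto simp: rt split_beta)
      then have dd: "delta M (?r (k + 1)) (map (\<lambda>l. ?r (l + 1)) [0..<k]) = (q, as)"
        using d(1) rq by simp
      have g: "?r (k + 1) < nstates M \<and> (\<forall>l<k. ?r (l + 1) < nsymbols M)"
        using wf[of j] unfolding rq wf_cfg_def k_def[symmetric] by (simp add: rt split_beta)
      have sa: "sim_act M ?r i = (if 1 \<le> i \<and> i \<le> k then as ! (i - 1) else if i = k + 1 then (q, 0)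
        else if i = k + 2 then (nat (dl j + 2), 1) else (?r i, 0))"
        unfolding sim_act_def k_def[symmetric] Let_def dd prod.case if_P[OF g] d(4) ..
      have lgs: "(lg j)(int j := nat (dl j + 2)) = lg (Suc j)"
        by (auto simp: lg_def fun_eq_iff)
      have "i = 0 \<or> 1 \<le> i \<and> i \<le> k \<or> i = k + 1 \<or> i = k + 2" using i m k_def by linarith
      then show "upd_tape (sim_act M ?r i) (layout k y (cf j) (lg j, int j) i) =
        layout k y (cf (Suc j)) (lg (Suc j), int (Suc j)) i"
      proof (elim disjE)
        assume i0: "i = 0"
        have "sim_act M ?r i = (reads (layout k y (cf j) (lg j, int j)) i, 0)"
          using sa ri i0 k by simp
        then have "upd_tape (sim_act M ?r i) (layout k y (cf j) (lg j, int j) i) =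
          layout k y (cf j) (lg j, int j) i" by (simp only: upd_tape_reads)
        also have "\<dots> = layout k y (cf (Suc j)) (lg (Suc j), int (Suc j)) i"
          by (simp add: layout_def i0)
        finally show ?thesis .
      next
        assume i: "1 \<le> i \<and> i \<le> k"
        then have "i - 1 < k" by linarith
        then show ?thesis unfolding sa using i by (simp add: layout_def d(3))
      next
        assume i: "i = k + 1"
        show ?thesis unfolding sa using i by (simp add: layout_def d(3) upd_tape_def)
      next
        assume i: "i = k + 2"
        show ?thesis unfolding sa using i lgs by (simp add: layout_def upd_tape_def)
      qed
    next
      fix r i assume "m \<le> i"
      then show "sim_act M r i = (r i, 0)" using m by (simp add: sim_act_def Let_def split_beta)
    qed
  qed
  \<comment> \<open>After \<open>j\<close> undone moves the first head is where it was at time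
    \<open>n - j\<close>, while state and tape contents remain the final ones.\<close>
  let ?L = "\<lambda>j. layout k y (fst (cf n), (snd (cf n))[0 := (tape_of ys, hd0 (n - j))]) (lg n, int n - 1 - int j)"
  have cfn: "layout k y (cf n) (lg n, int n - 1) = ?L 0"
  proof -
    have "(snd (cf n))[0 := (tape_of ys, hd0 n)] = snd (cf n)"
      using out by (simp add: hd0_def flip: out)
    then show ?thesis by simp
  qed
  have 2: "exec m (act1 (k + 2) (\<lambda>x. (x, -1))) (layout k y (cf n) (lg n, int n)) s 1 (?L 0) s"
  proof -
    have "(layout k y (cf n) (lg n, int n))(k + 2 := upd_tape (reads (layout k y (cf n) (lg n, int n)) (k + 2), -1)
      (layout k y (cf n) (lg n, int n) (k + 2))) = ?L 0"
      unfolding cfn[symmetric] by (auto simp: layout_def upd_tape_def reads_def fun_eq_iff)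
    then show ?thesis
      using exec_act1_low[of "k + 2" m "\<lambda>x. (x, -1)" "layout k y (cf n) (lg n, int n)" s] m
      by (simp add: k_def)
  qed
  have 3: "exec m (While (\<lambda>r. r (k + 2) \<noteq> 0) (Act (undo_act k))) (?L 0) s (n * (1 + 2) + 1) (?L n) s"
  proof (rule exec_While[where s = "\<lambda>_. s" and u = ?L])
    fix j \<sigma> assume j: "j < n" and rep: "rep m \<sigma> (?L j) s"
    have "reads \<sigma> (k + 2) = nat (dl (n - 1 - j) + 2)" using low[OF rep, of "k + 2"] m j
      by (simp add: reads_def layout_def k_def lg_def nat_diff_distrib')
    then show "reads \<sigma> (k + 2) \<noteq> 0" using dlr[of "n - 1 - j"] j by auto
  next
    fix \<sigma> assume rep: "rep m \<sigma> (?L n) s"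
    have "reads \<sigma> (k + 2) = 0" using low[OF rep, of "k + 2"] m
      by (simp add: reads_def layout_def k_def lg_def)
    then show "\<not> reads \<sigma> (k + 2) \<noteq> 0" by simp
  next
    fix j assume j: "j < n"
    show "exec m (Act (undo_act k)) (?L j) s 1 (?L (Suc j)) s"
    proof (rule exec_Act_low)
      fix \<sigma> i assume rep: "rep m \<sigma> (?L j) s" and i: "i < m"
      let ?r = "reads \<sigma>"
      have rl: "?r (k + 2) = nat (dl (n - 1 - j) + 2)" using low[OF rep, of "k + 2"] m j
        by (simp add: reads_def layout_def k_def lg_def nat_diff_distrib')
      have ri: "?r i = reads (?L j) i" by (rule low[OF rep i])
      have h: "hd0 (n - j) - dl (n - 1 - j) = hd0 (n - Suc j)"
        using j by (simp add: dl_def Suc_diff_Suc)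
      have mv: "(if ?r (k + 2) \<le> 3 \<and> 1 \<le> ?r (k + 2) then 2 - int (?r (k + 2)) else 0) = - dl (n - 1 - j)"
        unfolding rl using dlr[of "n - 1 - j"] j by auto
      have "undo_act k ?r i =
        (reads (?L j) i, if i = 1 then - dl (n - 1 - j) else if i = k + 2 then -1 else 0)"
        unfolding undo_act_def mv ri by simp
      then have "upd_tape (undo_act k ?r i) (?L j i) = (fst (?L j i), snd (?L j i) +
        (if i = 1 then - dl (n - 1 - j) else if i = k + 2 then -1 else 0))"
        by (simp only: upd_tape_move)
      also have "\<dots> = ?L (Suc j) i"
        using k h lk[of n] by (auto simp: layout_def nth_list_update)
      finally show "upd_tape (undo_act k ?r i) (?L j i) = ?L (Suc j) i" .
    next
      fix r i assume "m \<le> i"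
      then show "undo_act k r i = (r i, 0)" using m k by (simp add: undo_act_def k_def)
    qed
  qed
  have init: "layout k y (initial_config M w) (\<lambda>_. 0, 0) = layout k y (cf 0) (lg 0, int 0)"
  proof -
    have "lg 0 = (\<lambda>_. 0)" by (auto simp: lg_def)
    then show ?thesis by (simp add: cf_def)
  qed
  have "exec m (simulate M) (layout k y (initial_config M w) (\<lambda>_. 0, 0)) s (6 * t + 5) (?L n) s"
    unfolding simulate_def Let_def k_def[symmetric] init
    by (rule exec_mono[OF exec_Seq[OF 1 exec_Seq[OF 2 3]]]) (use nt in simp)
  moreover have "(snd (cf n))[0 := (tape_of ys, hd0 (n - n))] ! 0 = (tape_of ys, 0)"
    using k lk[of n] hd00 by simp
  ultimately show ?thesis using lk[of n] unfolding k_def[symmetric]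
    by (intro exI conjI) (auto simp: hd00)
qed

text \<open>\<open>lans\<close> turns time polynomial in input and output together into time
  polynomial in \<open>x\<close>. Since \<open>post\<close> needs \<open>x\<close> again, register 0
  keeps it while \<open>M\<close> runs on its own tapes.\<close>

theorem subroutine_composition:
  assumes M: "turing_machine M"
    and ans: "\<And>x. computes_within M (red x) (ans x) (poly p (length (red x) + length (ans x)))"
    and red: "PF [\<lambda>x. x] red" and lans: "pbd length (\<lambda>x. length (ans x))"
    and post: "PF [fst, snd] (\<lambda>z. post (fst z) (snd z))"
  shows "polytime_computable (\<lambda>x. post x (ans x))"
proof -
  define k where "k = ntapes M"
  define m where "m = k + 3"
  have k: "1 \<le> k" using M by (simp add: turing_machine_def k_def)
  have c1: "clen [\<lambda>x. x] = length" by (simp add: clen_def fun_eq_iff)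
  obtain cr Tr where Tr: "pbd length Tr" and cr: "impl [\<lambda>x. x] red m [0] 1 cr Tr"
  proof (rule PF_obtain[OF red, unfolded c1, of "[0]" 1 m])
  qed auto
  obtain cp Tp where Tp: "pbd (clen [fst, snd]) Tp"
    and cp: "impl [fst, snd] (\<lambda>z. post (fst z) (snd z)) m [0, 1] 2 cp Tp"
  proof (rule PF_obtain[OF post, of "[0, 1]" 2 m])
  qed auto
  have lred: "pbd length (\<lambda>x. length (red x))" using PF_len[OF red] c1 by simp
  have cl2: "pbd length (\<lambda>x. clen [fst, snd] (x, ans x))"
    using pbd_add[OF pbd_self lans] by (simp add: clen_def)
  have Tp': "pbd length (\<lambda>x. Tp (x, ans x))"
    by (rule pbd_trans[OF cl2]) (rule pbd_reindex[OF Tp])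
  have lpost: "pbd length (\<lambda>x. length (post x (ans x)))"
    by (rule pbd_trans[OF cl2]) (use pbd_reindex[OF PF_len[OF post], of "\<lambda>x. (x, ans x)"] in simp)
  define tM where "tM x = poly p (length (red x) + length (ans x))" for x
  have tM: "pbd length tM"
    unfolding tM_def by (rule pbd_trans[OF pbd_add[OF lred lans] pbd_poly])
  let ?c = "Seq (readin m 0 1) (Seq (pour2 m 1 0 2) (Seq (rewind m 2 0) (Seq cr
    (Seq (pour2 m 1 2 3) (Seq (pour m 2 1) (Seq (writeout m 1 1) (Seq (rewind m 3 1)
    (Seq (simulate M) (Seq (readin m 1 2) (Seq (pour m 2 1) (Seq cp (writeout m 2 0))))))))))))"
  define tt where "tt x = Suc (8 * length x + 1 + Suc (12 * length x + 1 + Suc (5 * length x + 1 + Suc (Tr x +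
    Suc (12 * length (red x) + 1 + Suc (8 * length (red x) + 1 + Suc (6 * length (red x) + 1 +
    Suc (5 * length (red x) + 1 + Suc (6 * tM x + 5 + Suc (8 * length (ans x) + 1 + Suc (8 * length (ans x) + 1 +
    Suc (Tp (x, ans x) + (6 * length (post x (ans x)) + 1)))))))))))))" for x
  have ptt: "pbd length tt"
    unfolding tt_def by (intro pbd_intros Tr lred tM lans Tp' lpost)
  have main: "\<exists>u'. exec m ?c (start_tapes x) (\<lambda>_. []) (tt x) u' ((\<lambda>_. [])(0 := x, 1 := ans x)) \<and>
      fst (u' 0) = tape_of (post x (ans x))" for x
  proof -
    let ?e = "\<lambda>_::nat. [] :: bool list"
    let ?b = "(\<lambda>_. 0, 0) :: tape"
    define I where "I w = initial_config M w" for w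
    \<comment> \<open>The initial state 0 is stored as the blank symbol 0, so the start tapes
      already form the layout of \<open>M\<close> on the empty input.\<close>
    have LI: "layout k y (I []) ?b = start_tapes x" if "y = (tape_of x, 0)" for y
      using that k by (auto simp: layout_def start_tapes_def fun_eq_iff I_def initial_config_def k_def nth_Cons')
    have L0: "(layout k y C lg)(0 := y') = layout k y' C lg" for y y' C lg
      by (auto simp: layout_def fun_eq_iff)
    have L1: "(layout k y C lg)(Suc 0 := y') = layout k y (fst C, (snd C)[0 := y']) lg"
      if "length (snd C) = k" for y y' C lg
      using that k by (auto simp: layout_def fun_eq_iff nth_list_update)
    have lI: "length (snd (I w)) = k" for w
      using M by (simp add: I_def initial_config_def k_def turing_machine_def)
    have Iw: "(fst (I []), (snd (I []))[0 := (tape_of w, 0)]) = I w" for w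
      by (simp add: I_def initial_config_def)
    have 1: "exec m (readin m 0 1) (start_tapes x) ?e (8 * length x + 1)
       (layout k (\<lambda>_. 0, int (length x)) (I []) ?b) (?e(1 := rev x))"
      using exec_readin[of 0 m "start_tapes x" x 1 ?e] L0[of "(tape_of x, 0)" "I []" ?b]
      by (simp add: LI start_tapes_def[of x 0] m_def)
    have 2: "exec m (pour2 m 1 0 2) u (?e(1 := rev x)) (12 * length x + 1) u (?e(0 := x, 2 := x))" for u
    proof -
      have "?e(1 := rev x, 1 := [], 0 := x, 2 := x) = ?e(0 := x, 2 := x)" by auto
      then show ?thesis using exec_pour2[of 1 0 2 m u "?e(1 := rev x)"] by simp
    qed
    have 3: "exec m (rewind m 2 0) (layout k (\<lambda>_. 0, int (length x)) (I []) ?b) (?e(0 := x, 2 := x))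
       (5 * length x + 1) (layout k ?b (I []) ?b) (?e(0 := x))"
    proof -
      have "?e(0 := x, 2 := x, 2 := []) = ?e(0 := x)" by auto
      then show ?thesis
        using exec_rewind[of 0 m "layout k (\<lambda>_. 0, int (length x)) (I []) ?b" "\<lambda>_. 0" "?e(0 := x, 2 := x)" 2]
        by (simp add: L0) (simp add: layout_def m_def)
    qed
    have 4: "exec m cr u (?e(0 := x)) (Tr x) u (?e(0 := x, 1 := red x))" for u
      by (rule implD[OF cr]) auto
    let ?w = "red x"
    have 5: "exec m (pour2 m 1 2 3) u (?e(0 := x, 1 := ?w)) (12 * length ?w + 1) u
       (?e(0 := x, 2 := rev ?w, 3 := rev ?w))" for u
    proof -
      have "?e(0 := x, 1 := ?w, 1 := [], 2 := rev ?w, 3 := rev ?w) = ?e(0 := x, 2 := rev ?w, 3 := rev ?w)" by auto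
      then show ?thesis using exec_pour2[of 1 2 3 m u "?e(0 := x, 1 := ?w)"] by simp
    qed
    have 6: "exec m (pour m 2 1) u (?e(0 := x, 2 := rev ?w, 3 := rev ?w)) (8 * length ?w + 1) u
       (?e(0 := x, 1 := ?w, 3 := rev ?w))" for u
    proof -
      have "?e(0 := x, 2 := rev ?w, 3 := rev ?w, 2 := [], 1 := ?w) = ?e(0 := x, 1 := ?w, 3 := rev ?w)" by auto
      then show ?thesis using exec_pour[of 2 1 m u "?e(0 := x, 2 := rev ?w, 3 := rev ?w)"] by simp
    qed
    let ?C = "(fst (I []), (snd (I []))[0 := (tape_of ?w, int (length ?w))])"
    have I1: "layout k ?b (I []) ?b 1 = ?b"
      using k by (simp add: layout_def I_def initial_config_def)
    have 7: "exec m (writeout m 1 1) (layout k ?b (I []) ?b) (?e(0 := x, 1 := ?w, 3 := rev ?w))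
       (6 * length ?w + 1) (layout k ?b ?C ?b) (?e(0 := x, 3 := rev ?w))"
    proof -
      have "?e(0 := x, 1 := ?w, 3 := rev ?w, 1 := []) = ?e(0 := x, 3 := rev ?w)" by auto
      then show ?thesis
        using exec_writeout[of 1 m "layout k ?b (I []) ?b" 1 "?e(0 := x, 1 := ?w, 3 := rev ?w)"] I1
        by (simp add: L1 lI m_def)
    qed
    have C1: "layout k ?b ?C ?b 1 = (tape_of ?w, int (length ?w))"
      using k lI[of "[]"] by (simp add: layout_def)
    have 8: "exec m (rewind m 3 1) (layout k ?b ?C ?b) (?e(0 := x, 3 := rev ?w))
       (5 * length ?w + 1) (layout k ?b (I ?w) ?b) (?e(0 := x))"
    proof -
      have "?e(0 := x, 3 := rev ?w, 3 := []) = ?e(0 := x)" by auto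
      then show ?thesis
        using exec_rewind[of 1 m "layout k ?b ?C ?b" "tape_of ?w" "?e(0 := x, 3 := rev ?w)" 3] C1
        by (simp add: L1 lI m_def Iw)
    qed
    obtain C lg where C: "length (snd C) = k" "snd C ! 0 = (tape_of (ans x), 0)"
      and 9: "exec m (simulate M) (layout k ?b (I ?w) ?b) (?e(0 := x)) (6 * tM x + 5)
        (layout k ?b C lg) (?e(0 := x))"
      using exec_simulate[OF M ans, of m x ?b "?e(0 := x)"] unfolding k_def m_def I_def tM_def by blast
    let ?a = "ans x"
    let ?D = "(fst C, (snd C)[0 := (\<lambda>_. 0, int (length ?a))])"
    have 10: "exec m (readin m 1 2) (layout k ?b C lg) (?e(0 := x)) (8 * length ?a + 1)
       (layout k ?b ?D lg) (?e(0 := x, 2 := rev ?a))"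
      using exec_readin[of 1 m "layout k ?b C lg" ?a 2 "?e(0 := x)"] k C
      by (simp add: L1 m_def) (simp add: layout_def)
    have 11: "exec m (pour m 2 1) u (?e(0 := x, 2 := rev ?a)) (8 * length ?a + 1) u
       (?e(0 := x, 1 := ?a))" for u
    proof -
      have "?e(0 := x, 2 := rev ?a, 2 := [], 1 := ?a) = ?e(0 := x, 1 := ?a)" by auto
      then show ?thesis using exec_pour[of 2 1 m u "?e(0 := x, 2 := rev ?a)"] by simp
    qed
    have 12: "exec m cp u (?e(0 := x, 1 := ?a)) (Tp (x, ?a)) u (?e(0 := x, 1 := ?a, 2 := post x ?a))" for u
      using implD[OF cp, of "?e(0 := x, 1 := ?a)" "(x, ?a)" u] by auto
    have 13: "exec m (writeout m 2 0) (layout k ?b ?D lg) (?e(0 := x, 1 := ?a, 2 := post x ?a))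
       (6 * length (post x ?a) + 1) (layout k (tape_of (post x ?a), int (length (post x ?a))) ?D lg)
       (?e(0 := x, 1 := ?a))"
    proof -
      have "?e(0 := x, 1 := ?a, 2 := post x ?a, 2 := []) = ?e(0 := x, 1 := ?a)" by auto
      then show ?thesis
        using exec_writeout[of 0 m "layout k ?b ?D lg" 2 "?e(0 := x, 1 := ?a, 2 := post x ?a)"]
        by (simp add: L0) (simp add: layout_def m_def)
    qed
    have "exec m ?c (start_tapes x) ?e (tt x) (layout k (tape_of (post x ?a), int (length (post x ?a))) ?D lg)
      (?e(0 := x, 1 := ?a))"
      unfolding tt_def
      by (rule exec_Seq[OF 1 exec_Seq[OF 2 exec_Seq[OF 3 exec_Seq[OF 4 exec_Seq[OF 5 exec_Seq[OF 6
        exec_Seq[OF 7 exec_Seq[OF 8 exec_Seq[OF 9 exec_Seq[OF 10 exec_Seq[OF 11 exec_Seq[OF 12 13]]]]]]]]]]]])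
    then show ?thesis by (intro exI conjI) (auto simp: layout_def)
  qed
  \<comment> \<open>Room for the alphabet of \<open>M\<close>, its states written as symbols, and
    log entries up to 3.\<close>
  define S where "S = nstates M + nsymbols M + 4"
  have "okS S ?c"
    by (intro okS_Seq okS_simulate[OF M] okS_okc okc_readin okc_pour2 okc_rewind okc_pour okc_writeout
        impl_okc[OF cr] impl_okc[OF cp]) (auto simp: S_def)
  then obtain K where "wf_com K S ?c" unfolding okS_def by blast
  then have W: "wf_com (K + 1) S ?c" by (rule wf_com_mono) simp
  obtain N where N: "turing_machine N" "\<And>xs ys t \<sigma>'. runs ?c (start_tapes xs) t \<sigma>' \<Longrightarrow>
      fst (\<sigma>' 0) = tape_of ys \<Longrightarrow> computes_within N xs ys t"
  proof -
    have "?c \<noteq> Skip" by simp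
    moreover have "1 \<le> K + 1" "3 \<le> S" by (simp_all add: S_def)
    ultimately show thesis using com_machine[OF W] that by blast
  qed
  obtain q where q: "\<And>x. tt x \<le> poly q (length x)" using ptt unfolding pbd_def by blast
  have "computes_within N x (post x (ans x)) (poly q (length x))" for x
  proof -
    have "rep m (start_tapes x) (start_tapes x) (\<lambda>_. [])"
      by (auto simp: rep_def stk_def start_tapes_def m_def)
    then obtain \<sigma>' u' where "runs ?c (start_tapes x) (tt x) \<sigma>'" "rep m \<sigma>' u' ((\<lambda>_. [])(0 := x, 1 := ans x))"
      "fst (u' 0) = tape_of (post x (ans x))"
      using main[of x] unfolding exec_def by blast
    moreover from this have "fst (\<sigma>' 0) = tape_of (post x (ans x))" by (simp add: rep_def m_def)
    ultimately show ?thesis using computes_within_mono[OF N(2) q] by blast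
  qed
  then show ?thesis
    unfolding polytime_computable_def polytime_algorithm_def using N(1) by blast
qed

section \<open>Counting independent sets with a partition function\<close>

definition pairs :: "nat \<Rightarrow> nat set set" where
  "pairs n = {e. e \<subseteq> {1..n} \<and> card e = 2}"

lemma pairs_iff: "{u, v} \<in> pairs n \<longleftrightarrow> u \<in> {1..n} \<and> v \<in> {1..n} \<and> u \<noteq> v"
  by (auto simp: pairs_def card_insert_if)

lemma pairs_cases:
  assumes "e \<in> pairs n" obtains u v where "e = {u, v}" "u < v" "1 \<le> u" "v \<le> n"
proof -
  obtain u v where "e = {u, v}" "u \<noteq> v" using assms by (auto simp: pairs_def card_2_iff)
  then show ?thesis using assms that[of u v] that[of v u] by (cases "u < v") (auto simp: pairs_def)
qed

lemma pairs_subset: "pairs n \<subseteq> (\<lambda>(u, v). {u, v}) ` ({1..n} \<times> {1..n})"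
  by (auto elim!: pairs_cases simp: image_iff)

lemma finite_pairs: "finite (pairs n)"
  by (rule finite_subset[OF pairs_subset]) auto

lemma card_pairs: "card (pairs n) \<le> n ^ 2"
  using surj_card_le[OF _ pairs_subset] by (simp add: power2_eq_square)

definition triangles :: "graph \<Rightarrow> nat set set" where
  "triangles H = {T. card T = 3 \<and> (\<forall>e. e \<subseteq> T \<and> card e = 2 \<longrightarrow> e \<in> H)}"

lemma triangle_count_eq: "triangle_count H = card (triangles H)"
  by (simp add: triangle_count_def triangles_def)

lemma triangle_iff:
  assumes "a \<noteq> b" "b \<noteq> c" "a \<noteq> c"
  shows "{a, b, c} \<in> triangles H \<longleftrightarrow> {a, b} \<in> H \<and> {b, c} \<in> H \<and> {a, c} \<in> H"
proof
  assume "{a, b, c} \<in> triangles H"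
  then have "e \<in> H" if "e \<subseteq> {a, b, c}" "card e = 2" for e
    using that by (auto simp: triangles_def)
  then show "{a, b} \<in> H \<and> {b, c} \<in> H \<and> {a, c} \<in> H" using assms by auto
next
  assume *: "{a, b} \<in> H \<and> {b, c} \<in> H \<and> {a, c} \<in> H"
  have "e \<in> H" if e: "e \<subseteq> {a, b, c}" "card e = 2" for e
  proof -
    obtain x y where "e = {x, y}" "x \<noteq> y" using e(2) by (auto simp: card_2_iff)
    then show ?thesis using * e(1) by (auto simp: insert_commute)
  qed
  then show "{a, b, c} \<in> triangles H" using assms by (auto simp: triangles_def)
qed

lemma triangles_cases:
  assumes "T \<in> triangles H"
  obtains a b c where "T = {a, b, c}" "a \<noteq> b" "b \<noteq> c" "a \<noteq> c" "{a, b} \<in> H" "{b, c} \<in> H" "{a, c} \<in> H"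
proof -
  obtain a b c where T: "T = {a, b, c}" "a \<noteq> b" "b \<noteq> c" "a \<noteq> c"
    using assms by (auto simp: triangles_def card_3_iff)
  then show ?thesis using that triangle_iff[OF T(2-4)] assms by blast
qed

lemma triangles_subset:
  assumes "H \<subseteq> pairs n"
  shows "triangles H \<subseteq> (\<lambda>(a, b, c). {a, b, c}) ` ({1..n} \<times> {1..n} \<times> {1..n})"
proof
  fix T assume "T \<in> triangles H"
  then obtain a b c where "T = {a, b, c}" "{a, b} \<in> H" "{b, c} \<in> H" by (rule triangles_cases)
  moreover from this have "a \<in> {1..n}" "b \<in> {1..n}" "c \<in> {1..n}" using assms pairs_iff by blast+
  ultimately show "T \<in> (\<lambda>(a, b, c). {a, b, c}) ` ({1..n} \<times> {1..n} \<times> {1..n})"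
    by (intro image_eqI[of _ _ "(a, b, c)"]) auto
qed

lemma finite_triangles: "H \<subseteq> pairs n \<Longrightarrow> finite (triangles H)"
  by (rule finite_subset[OF triangles_subset]) auto

lemma triangle_count_le: "H \<subseteq> pairs n \<Longrightarrow> triangle_count H \<le> n ^ 3"
  unfolding triangle_count_eq using surj_card_le[OF _ triangles_subset]
  by (simp add: power3_eq_cube mult.assoc)

lemma powi_mono: "a \<le> b \<Longrightarrow> (2 :: rat) powi a \<le> 2 powi b"
  by (rule power_int_increasing) auto

text \<open>Vertex 1 is a hub whose edges select a set, 2 is the marker, \<open>X\<close> holds the
  admissible vertices. \<open>M\<close> covers the total gain \<open>2 * A * n\<close> of all hub
  edges, so a single new triangle is ruinous. \<open>B\<close> also covers \<open>M * n ^ 3\<close>,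
  the most that could be regained by destroying triangles inside \<open>G\<close>. The margin
  \<open>n ^ 2 + 1\<close> in both makes all bad graphs together, at most \<open>2 ^ (n ^ 2)\<close>
  of them, weigh at most half of the common factor \<open>2 ^ C\<close>.\<close>

theorem partition_sum_independent_sets:
  fixes w :: "nat set \<Rightarrow> int" and A B M m n :: nat
  assumes G: "G \<subseteq> pairs n" "\<And>e. e \<in> G \<Longrightarrow> 1 \<notin> e"
    and wG: "\<And>e. e \<in> G \<Longrightarrow> int B \<le> w e"
    and wN: "\<And>e. e \<in> pairs n \<Longrightarrow> 1 \<notin> e \<Longrightarrow> e \<notin> G \<Longrightarrow> w e \<le> - int B"
    and X: "X \<subseteq> {3..n}" "\<And>v. v \<in> X \<Longrightarrow> w {1, v} = int A"
    and w2: "w {1, 2} = int (A * (m + 1))"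
    and wX: "\<And>v. v \<in> {3..n} \<Longrightarrow> v \<notin> X \<Longrightarrow> w {1, v} \<le> - int B"
    and G2: "\<And>v. v \<in> {3..n} \<Longrightarrow> {2, v} \<in> G"
    and IS: "\<And>S. IS S \<longleftrightarrow> S \<subseteq> X \<and> (\<forall>u\<in>S. \<forall>v\<in>S. u \<noteq> v \<longrightarrow> {u, v} \<notin> G)"
    and m: "\<And>S. IS S \<Longrightarrow> card S \<le> m" "1 \<le> m" "m + 1 \<le> n"
    and n: "3 \<le> n" and A: "n + 1 \<le> A"
    and M: "2 * A * n + n ^ 2 + 1 \<le> M" and B: "M * n ^ 3 + 2 * A * n + n ^ 2 + 1 \<le> B"
  shows "\<exists>(C :: nat) (r :: rat). 0 \<le> r \<and> r < 2 ^ (A * m) \<and>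
    (\<Sum>H\<in>Pow (pairs n). 2 powi ((\<Sum>e\<in>H. w e) - int M * int (triangle_count H))) =
    2 ^ C * (2 ^ (A * (m + 1)) + of_nat (card {S. IS S \<and> card S = m}) * 2 ^ (A * m) + r)"
proof -
  define star where "star v = {1 :: nat, v}" for v
  have star_inj: "star u = star v \<longleftrightarrow> u = v" for u v by (auto simp: star_def doubleton_eq_iff)
  define ex where "ex H = (\<Sum>e\<in>H. w e) - int M * int (triangle_count H)" for H
  have finG: "finite G" using finite_subset[OF G(1) finite_pairs] .
  have finX: "finite X" using finite_subset[OF X(1)] by auto
  have tG: "triangle_count G \<le> n ^ 3" by (rule triangle_count_le[OF G(1)])
  have wG0: "0 \<le> w e" if "e \<in> G" for e using wG[OF that] by simp
  have "int B \<le> w {2, 3}" using G2[of 3] n by (intro wG) auto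
  also have "\<dots> \<le> (\<Sum>e\<in>G. w e)" using G2[of 3] n by (intro member_le_sum finG) (auto simp: wG0)
  finally have sG: "int B \<le> (\<Sum>e\<in>G. w e)" .
  have MT: "int M * int (triangle_count H) \<le> int (M * n ^ 3)" if "H \<subseteq> pairs n" for H
    using triangle_count_le[OF that] by (simp flip: of_nat_mult of_nat_power)
  \<comment> \<open>The exponent of \<open>G\<close> itself, that is, of the empty choice. It is
    nonnegative: \<open>{2, 3}\<close> lies in \<open>G\<close> and alone contributes
    \<open>B\<close>, more than all triangles of \<open>G\<close> can cost.\<close>
  define C where "C = nat (ex G)"
  have C: "int C = (\<Sum>e\<in>G. w e) - int M * int (triangle_count G)"
  proof -
    have "int (M * n ^ 3) \<le> int B" using B by (intro of_nat_mono) linarith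
    then show ?thesis using sG MT[OF G(1)] by (simp add: C_def ex_def)
  qed
  \<comment> \<open>The hub edges yield at most \<open>A * (m + 1)\<close> from the marker and
    \<open>A\<close> from each of the \<open>n - 2\<close> other vertices, and
    \<open>m + 1 \<le> n\<close>.\<close>
  define P where "P = 2 * A * n"
  have star_le: "(\<Sum>v\<in>S. w (star v)) \<le> int P" if S: "S \<subseteq> {2..n}" for S
  proof -
    have "(\<Sum>v\<in>S. w (star v)) \<le> (\<Sum>v\<in>S. if v = 2 then int (A * (m + 1)) else int A)"
    proof (rule sum_mono)
      fix v assume "v \<in> S"
      then have "v = 2 \<or> v \<in> {3..n}" using S by force
      then show "w (star v) \<le> (if v = 2 then int (A * (m + 1)) else int A)"
        using w2 X(2)[of v] wX[of v] by (cases "v \<in> X") (auto simp: star_def)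
    qed
    also have "\<dots> \<le> (\<Sum>v\<in>{2..n}. if v = 2 then int (A * (m + 1)) else int A)"
      by (rule sum_mono2) (use S in auto)
    also have "\<dots> = int (A * (m + 1)) + (\<Sum>v\<in>{3..n}. int A)"
    proof -
      have "{2..n} = insert 2 {3..n}" using n by auto
      then show ?thesis by simp
    qed
    also have "\<dots> = int (A * (m + 1) + A * (n - 2))" 
    proof -
      have "card {3..n} = n - 2" by simp
      then show ?thesis by (simp only: sum_constant of_nat_add of_nat_mult of_nat_id mult.commute)
    qed
    also have "\<dots> \<le> int P"
    proof -
      have "A * (m + 1) \<le> A * n" "A * (n - 2) \<le> A * n" using m(3) by (intro mult_le_mono2; simp)+
      then show ?thesis unfolding P_def by linarith
    qed
    finally show ?thesis .
  qed
  have star_bad: "(\<Sum>v\<in>S. w (star v)) \<le> int P - int B" if S: "S \<subseteq> {2..n}" "v \<in> S" "v \<noteq> 2" "v \<notin> X" for S v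
  proof -
    have fS: "finite S" using S finite_subset by auto
    have "(\<Sum>v\<in>S. w (star v)) = w (star v) + (\<Sum>v\<in>S - {v}. w (star v))"
      by (rule sum.remove[OF fS S(2)])
    also have "\<dots> \<le> - int B + int P"
    proof (rule add_mono)
      have "v \<in> {3..n}" using S by force
      then show "w (star v) \<le> - int B" using wX S unfolding star_def by blast
      show "(\<Sum>v\<in>S - {v}. w (star v)) \<le> int P" using S by (intro star_le) auto
    qed
    finally show ?thesis by simp
  qed
  \<comment> \<open>Away from the hub, omitting an edge of \<open>G\<close> and adding a pair
    outside \<open>G\<close> both cost at least \<open>B\<close>, so \<open>G\<close> is the optimum
    and every other inner part loses \<open>B\<close>.\<close>
  have inner_le: "(\<Sum>e\<in>Y. w e) \<le> (\<Sum>e\<in>G. w e) \<and> (Y \<noteq> G \<longrightarrow> (\<Sum>e\<in>Y. w e) \<le> (\<Sum>e\<in>G. w e) - int B)"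
    if Y: "Y \<subseteq> pairs n" "\<And>e. e \<in> Y \<Longrightarrow> 1 \<notin> e" for Y
  proof -
    have fY: "finite Y" using finite_subset[OF Y(1) finite_pairs] .
    have 1: "(\<Sum>e\<in>Y. w e) = (\<Sum>e\<in>Y \<inter> G. w e) + (\<Sum>e\<in>Y - G. w e)"
      by (rule sum.Int_Diff[OF fY])
    have 2: "(\<Sum>e\<in>G. w e) = (\<Sum>e\<in>Y \<inter> G. w e) + (\<Sum>e\<in>G - Y. w e)"
      using sum.Int_Diff[OF finG, of w Y] by (simp add: Int_commute)
    have yg: "w e \<le> - int B" if "e \<in> Y - G" for e using wN Y that by blast
    have a: "(\<Sum>e\<in>Y - G. w e) \<le> 0" using yg by (intro sum_nonpos) force
    have b: "0 \<le> (\<Sum>e\<in>G - Y. w e)" using wG0 by (intro sum_nonneg) auto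
    have c: "(\<Sum>e\<in>Y - G. w e) \<le> - int B \<or> int B \<le> (\<Sum>e\<in>G - Y. w e)" if "Y \<noteq> G"
    proof -
      from that consider e where "e \<in> Y - G" | e where "e \<in> G - Y" by blast
      then show ?thesis
      proof cases
        case 1
        have "(\<Sum>e\<in>Y - G. w e) = w e + (\<Sum>e\<in>Y - G - {e}. w e)"
          using fY 1 by (intro sum.remove) auto
        also have "\<dots> \<le> - int B + 0" using yg[OF 1] yg by (intro add_mono sum_nonpos) force+
        finally show ?thesis by simp
      next
        case 2
        have "int B \<le> w e" using 2 wG by auto
        also have "\<dots> \<le> (\<Sum>e\<in>G - Y. w e)" using 2 finG wG0 by (intro member_le_sum) auto
        finally show ?thesis by simp
      qed
    qed
    show ?thesis
    proof (intro conjI impI)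
      show "(\<Sum>e\<in>Y. w e) \<le> (\<Sum>e\<in>G. w e)" using 1 2 a b by linarith
      assume "Y \<noteq> G"
      from c[OF this] show "(\<Sum>e\<in>Y. w e) \<le> (\<Sum>e\<in>G. w e) - int B" using 1 2 a b by linarith
    qed
  qed
  define hS where "hS S = G \<union> star ` S" for S
  have starG: "star v \<notin> G" for v using G(2) by (auto simp: star_def)
  have hS_inj: "inj_on hS (Pow UNIV)"
  proof (rule inj_onI)
    fix S S' assume "hS S = hS S'"
    then have "star ` S = star ` S'" using starG by (auto simp: hS_def)
    then show "S = S'" using star_inj by (metis injI inj_image_eq_iff)
  qed
  \<comment> \<open>The good choices: independent sets, and the marker alone. The marker is adjacent
    in \<open>G\<close> to all vertices from 3 on, so it joins no other choice.\<close>
  define FF where "FF = insert {2} {S. IS S}"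
  have fin_IS: "finite {S. IS S}" by (rule finite_subset[of _ "Pow X"]) (auto simp: IS finX)
  have two: "{2} \<notin> {S. IS S}" using X(1) by (auto simp: IS)
  have FF_sub: "S \<subseteq> {2..n}" if "S \<in> FF" for S using that X(1) n by (auto simp: FF_def IS)
  have FF_free: "{u, v} \<notin> G" if "S \<in> FF" "u \<in> S" "v \<in> S" for S u v
  proof (cases "u = v")
    case True
    then show ?thesis using G(1) by (auto simp: pairs_def)
  next
    case False
    then show ?thesis using that by (auto simp: FF_def IS)
  qed
  have hS_pairs: "hS S \<subseteq> pairs n" if "S \<subseteq> {2..n}" for S
    using that G(1) by (auto simp: hS_def star_def pairs_iff subset_iff)
  \<comment> \<open>A triangle through the hub would need two chosen vertices that are adjacent in
    \<open>G\<close>.\<close>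
  have tri_hS: "triangles (hS S) = triangles G" if "S \<in> FF" for S
  proof
    show "triangles G \<subseteq> triangles (hS S)" by (auto simp: triangles_def hS_def)
    show "triangles (hS S) \<subseteq> triangles G"
    proof
      fix T assume "T \<in> triangles (hS S)"
      then obtain a b c where T: "T = {a, b, c}" "a \<noteq> b" "b \<noteq> c" "a \<noteq> c"
        "{a, b} \<in> hS S" "{b, c} \<in> hS S" "{a, c} \<in> hS S" by (rule triangles_cases)
      have inner: "{x, y} \<in> G" if "{x, y} \<in> hS S" "x \<noteq> 1" "y \<noteq> 1" for x y
      proof -
        have "1 \<notin> {x, y}" using that by simp
        then show ?thesis using that(1) unfolding hS_def star_def by blast
      qed
      have st: "x \<in> S" if "{1, x} \<in> hS S" for x
      proof -
        have "star x \<in> star ` S" using that starG unfolding hS_def star_def by blast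
        then obtain z where "z \<in> S" "star x = star z" by (rule imageE)
        then show ?thesis using star_inj[of x z] by simp
      qed
      have no: False if "{1, x} \<in> hS S" "{1, y} \<in> hS S" "{x, y} \<in> hS S" "x \<noteq> 1" "y \<noteq> 1" for x y
        using FF_free[OF \<open>S \<in> FF\<close> st st] inner that by blast
      have a1: "a \<noteq> 1" using no[of b c] T by metis
      have b1: "b \<noteq> 1" using no[of a c] T by (metis insert_commute)
      have c1: "c \<noteq> 1" using no[of a b] T by (metis insert_commute)
      have "{a, b} \<in> G \<and> {b, c} \<in> G \<and> {a, c} \<in> G"
        using T inner a1 b1 c1 by blast
      then show "T \<in> triangles G" using triangle_iff[OF T(2-4)] T(1) by simp
    qed
  qed
  have sum_hS: "(\<Sum>e\<in>Y \<union> star ` S. w e) = (\<Sum>e\<in>Y. w e) + (\<Sum>v\<in>S. w (star v))"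
    if "finite Y" "finite S" "\<And>e. e \<in> Y \<Longrightarrow> 1 \<notin> e" for Y S
  proof -
    have "Y \<inter> star ` S = {}" using that(3) by (auto simp: star_def)
    moreover have "(\<Sum>e\<in>star ` S. w e) = (\<Sum>v\<in>S. w (star v))"
      by (subst sum.reindex) (auto simp: inj_on_def star_inj)
    ultimately show ?thesis using that by (simp add: sum.union_disjoint)
  qed
  have ex_hS: "ex (hS S) = int C + (\<Sum>v\<in>S. w (star v))" if "S \<in> FF" for S
  proof -
    have "finite S" using FF_sub[OF that] finite_subset by auto
    then show ?thesis
      using sum_hS[OF finG _ G(2)] tri_hS[OF that] C by (simp add: ex_def hS_def triangle_count_eq)
  qed
  \<comment> \<open>A bad graph either contains \<open>G\<close> exactly and picks admissible
    vertices two of which are adjacent, which adds a triangle and costs \<open>M\<close>, or picks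
    an inadmissible vertex or has a wrong inner part, which costs \<open>B\<close>.\<close>
  have rest: "ex H \<le> int C - int (n ^ 2 + 1)" if H: "H \<in> Pow (pairs n) - hS ` FF" for H
  proof -
    define S where "S = {v. star v \<in> H}"
    define Y where "Y = {e \<in> H. 1 \<notin> e}"
    have Hp: "H \<subseteq> pairs n" using H by auto
    have S: "S \<subseteq> {2..n}"
    proof
      fix v assume "v \<in> S"
      then have "{1, v} \<in> pairs n" using Hp by (auto simp: S_def star_def)
      then show "v \<in> {2..n}" unfolding pairs_iff by auto
    qed
    have Y: "Y \<subseteq> pairs n" "\<And>e. e \<in> Y \<Longrightarrow> 1 \<notin> e" using Hp by (auto simp: Y_def)
    have HY: "H = Y \<union> star ` S"
    proof
      show "H \<subseteq> Y \<union> star ` S"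
      proof
        fix e assume e: "e \<in> H"
        show "e \<in> Y \<union> star ` S"
        proof (cases "1 \<in> e")
          case True
          obtain u v where uv: "e = {u, v}" using e Hp by (blast elim: pairs_cases)
          then have "e = star u \<or> e = star v" using True by (auto simp: star_def)
          then show ?thesis using e by (auto simp: S_def)
        qed (use e in \<open>auto simp: Y_def\<close>)
      qed
    qed (auto simp: Y_def S_def)
    have finS: "finite S" using S finite_subset by auto
    have finY: "finite Y" using finite_subset[OF Y(1) finite_pairs] .
    have sumH: "(\<Sum>e\<in>H. w e) = (\<Sum>e\<in>Y. w e) + (\<Sum>v\<in>S. w (star v))"
      unfolding HY by (rule sum_hS[OF finY finS Y(2)])
    show ?thesis
    proof (cases "Y = G \<and> S \<subseteq> insert 2 X")
      case True
      have "S \<notin> FF" using H HY True by (auto simp: hS_def)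
      have "\<exists>u\<in>S. \<exists>v\<in>S. u \<noteq> v \<and> {u, v} \<in> G"
      proof (cases "2 \<in> S")
        case two: True
        then obtain v where v: "v \<in> S" "v \<noteq> 2" using \<open>S \<notin> FF\<close> by (auto simp: FF_def)
        then have "v \<in> {3..n}" using S by force
        from G2[OF this] v two show ?thesis by (intro bexI[of _ 2] bexI[of _ v] conjI) simp_all
      next
        case False
        then have "S \<subseteq> X" using True by auto
        moreover have "\<not> IS S" using \<open>S \<notin> FF\<close> by (simp add: FF_def)
        ultimately show ?thesis unfolding IS by simp
      qed
      then obtain u v where uv: "u \<in> S" "v \<in> S" "u \<noteq> v" "{u, v} \<in> G" by blast
      have ne: "1 \<noteq> u" "1 \<noteq> v" using uv S by auto
      have "{1, u, v} \<in> triangles H"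
        using uv True HY by (subst triangle_iff) (use ne uv in \<open>auto simp: star_def\<close>)
      moreover have "{1, u, v} \<notin> triangles G"
        using G(2) ne uv by (subst triangle_iff) auto
      moreover have "triangles G \<subseteq> triangles H" using HY True by (auto simp: triangles_def)
      ultimately have "triangles G \<subset> triangles H" by blast
      then have "triangle_count G < triangle_count H"
        unfolding triangle_count_eq by (rule psubset_card_mono[OF finite_triangles[OF Hp]])
      then have "int M * (int (triangle_count G) + 1) \<le> int M * int (triangle_count H)"
        by (intro mult_left_mono) auto
      then have "int M * int (triangle_count G) + int M \<le> int M * int (triangle_count H)"
        by (simp add: distrib_left)
      moreover have "int P + int (n ^ 2 + 1) \<le> int M" using M unfolding P_def of_nat_add[symmetric] by (intro of_nat_mono) simp
      ultimately show ?thesis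
        using star_le[OF S] sumH True C by (simp add: ex_def)
    next
      case False
      have "(\<Sum>e\<in>H. w e) \<le> (\<Sum>e\<in>G. w e) + int P - int B"
      proof (cases "Y = G")
        case True
        then obtain v where v: "v \<in> S" "v \<noteq> 2" "v \<notin> X" using False by blast
        show ?thesis using star_bad[OF S v] True sumH by simp
      next
        case False
        then show ?thesis using inner_le[OF Y] star_le[OF S] sumH by simp
      qed
      moreover have "0 \<le> int M * int (triangle_count H)" by simp
      moreover have "int (M * n ^ 3) + int P + int (n ^ 2 + 1) \<le> int B"
        using B unfolding P_def of_nat_add[symmetric] by (intro of_nat_mono) simp
      ultimately show ?thesis using C MT[OF G(1)] unfolding ex_def by linarith
    qed
  qed
  define \<rho> where "\<rho> = (\<Sum>H\<in>Pow (pairs n) - hS ` FF. (2::rat) powi (ex H - int C))"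
  have "\<rho> \<le> (\<Sum>H\<in>Pow (pairs n) - hS ` FF. (2::rat) powi (- int (n ^ 2 + 1)))"
    unfolding \<rho>_def by (intro sum_mono powi_mono) (use rest in force)
  also have "\<dots> \<le> (\<Sum>H\<in>Pow (pairs n). (2::rat) powi (- int (n ^ 2 + 1)))"
    by (intro sum_mono2) (auto simp: finite_pairs)
  also have "\<dots> = 2 ^ card (pairs n) * 2 powi (- int (n ^ 2 + 1))"
    by (simp add: card_Pow finite_pairs)
  also have "\<dots> \<le> 2 ^ (n ^ 2) * 2 powi (- int (n ^ 2 + 1))"
    by (intro mult_right_mono power_increasing card_pairs) auto
  also have "\<dots> = 1 / 2"
    unfolding power_int_minus power_int_of_nat by (simp add: field_simps)
  finally have \<rho>: "\<rho> \<le> 1 / 2" .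
  have \<rho>0: "0 \<le> \<rho>" unfolding \<rho>_def by (intro sum_nonneg) auto
  \<comment> \<open>Smaller independent sets: at most \<open>2 ^ n\<close> of them, each of weight
    at most \<open>2 ^ (A * (m - 1))\<close>. By \<open>n + 1 \<le> A\<close> they fill at most half
    of the unit \<open>2 ^ (A * m)\<close>, and the other half leaves room for
    \<open>\<rho>\<close>.\<close>
  define lo where "lo = (\<Sum>S\<in>{S. IS S \<and> card S \<noteq> m}. (2::rat) ^ (A * card S))"
  have lo0: "0 \<le> lo" unfolding lo_def by (intro sum_nonneg) auto
  have "lo \<le> (\<Sum>S\<in>{S. IS S \<and> card S \<noteq> m}. (2::rat) ^ (A * (m - 1)))"
    unfolding lo_def
  proof (intro sum_mono power_increasing mult_le_mono2)
    fix S assume "S \<in> {S. IS S \<and> card S \<noteq> m}"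
    then show "card S \<le> m - 1" using m(1)[of S] by auto
  qed simp
  also have "\<dots> = of_nat (card {S. IS S \<and> card S \<noteq> m}) * 2 ^ (A * (m - 1))" by simp
  also have "\<dots> \<le> 2 ^ n * 2 ^ (A * (m - 1))"
  proof (intro mult_right_mono)
    have "card {S. IS S \<and> card S \<noteq> m} \<le> card (Pow X)"
      by (intro card_mono) (auto simp: IS finX)
    also have "\<dots> = 2 ^ card X" by (simp add: card_Pow finX)
    also have "\<dots> \<le> 2 ^ n"
    proof (intro power_increasing)
      show "card X \<le> n" using card_mono[OF _ X(1)] n by simp
    qed simp
    finally show "of_nat (card {S. IS S \<and> card S \<noteq> m}) \<le> (2::rat) ^ n"
      by (metis of_nat_le_iff of_nat_numeral of_nat_power)
  qed simp
  also have "\<dots> = 2 ^ (n + A * (m - 1))" by (simp add: power_add)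
  also have "\<dots> \<le> 2 ^ (A * m - 1)"
  proof (intro power_increasing)
    have "A * m = A + A * (m - 1)" using m(2) by (cases m) auto
    then show "n + A * (m - 1) \<le> A * m - 1" using A by linarith
  qed simp
  finally have lo: "lo \<le> 2 ^ (A * m - 1)" .
  have Am: "1 \<le> A * m" using A m(2) by (simp add: Suc_le_eq)
  then have half: "(2::rat) ^ (A * m) = 2 * 2 ^ (A * m - 1)" by (simp flip: power_Suc)
  have "(1::rat) \<le> 2 ^ (A * m - 1)" by simp
  then have r: "lo + \<rho> < 2 ^ (A * m)" using lo \<rho> half by linarith
  have sum_IS: "(\<Sum>v\<in>S. w (star v)) = int (A * card S)" if "IS S" for S
  proof -
    have "(\<Sum>v\<in>S. w (star v)) = (\<Sum>v\<in>S. int A)"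
      using that X(2) by (intro sum.cong) (auto simp: IS star_def)
    then show ?thesis by simp
  qed
  have "(\<Sum>H\<in>hS ` FF. (2::rat) powi ex H) = (\<Sum>S\<in>FF. 2 powi ex (hS S))"
    using hS_inj by (subst sum.reindex) (auto intro: inj_on_subset)
  also have "\<dots> = (\<Sum>S\<in>FF. 2 ^ C * 2 powi (\<Sum>v\<in>S. w (star v)))"
    by (intro sum.cong) (auto simp: ex_hS power_int_add)
  also have "\<dots> = 2 ^ C * (2 ^ (A * (m + 1)) + (\<Sum>S\<in>{S. IS S}. 2 powi (\<Sum>v\<in>S. w (star v))))"
  proof -
    have "(2::rat) powi w (star 2) = 2 ^ (A * (m + 1))" unfolding star_def w2 power_int_of_nat ..
    then show ?thesis unfolding FF_def sum_distrib_left[symmetric] sum.insert[OF fin_IS two] by simp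
  qed
  also have "(\<Sum>S\<in>{S. IS S}. (2::rat) powi (\<Sum>v\<in>S. w (star v))) = (\<Sum>S\<in>{S. IS S}. 2 ^ (A * card S))"
    by (intro sum.cong refl) (simp add: sum_IS del: of_nat_mult)
  also have "\<dots> = (\<Sum>S\<in>{S. IS S \<and> card S = m}. 2 ^ (A * card S)) + lo"
  proof -
    have eq: "{S. IS S} = {S. IS S \<and> card S = m} \<union> {S. IS S \<and> card S \<noteq> m}" by blast
    have f: "finite {S. IS S \<and> card S = m}" "finite {S. IS S \<and> card S \<noteq> m}"
      by (rule finite_subset[OF _ fin_IS], blast)+
    show ?thesis unfolding lo_def by (subst eq, rule sum.union_disjoint[OF f]) blast
  qed
  also have "(\<Sum>S\<in>{S. IS S \<and> card S = m}. (2::rat) ^ (A * card S)) =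
    of_nat (card {S. IS S \<and> card S = m}) * 2 ^ (A * m)" by simp
  finally have main: "(\<Sum>H\<in>hS ` FF. (2::rat) powi ex H) =
    2 ^ C * (2 ^ (A * (m + 1)) + (of_nat (card {S. IS S \<and> card S = m}) * 2 ^ (A * m) + lo))" .
  have "(\<Sum>H\<in>Pow (pairs n). (2::rat) powi ex H) =
    (\<Sum>H\<in>Pow (pairs n) - hS ` FF. 2 powi ex H) + (\<Sum>H\<in>hS ` FF. 2 powi ex H)"
    using hS_pairs FF_sub by (intro sum.subset_diff) (auto simp: finite_pairs)
  also have "(\<Sum>H\<in>Pow (pairs n) - hS ` FF. (2::rat) powi ex H) = 2 ^ C * \<rho>"
    unfolding \<rho>_def sum_distrib_left
    by (intro sum.cong refl) (simp add: power_int_diff)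
  finally have "(\<Sum>H\<in>Pow (pairs n). (2::rat) powi ex H) = 2 ^ C * (2 ^ (A * (m + 1)) +
    of_nat (card {S. IS S \<and> card S = m}) * 2 ^ (A * m) + (lo + \<rho>))"
    unfolding main by (simp add: algebra_simps)
  then show ?thesis using r lo0 \<rho>0 unfolding ex_def by (intro exI[of _ C] exI[of _ "lo + \<rho>"]) auto
qed

section \<open>Computations as tilings\<close>

text \<open>The tile at time \<open>t\<close> and column \<open>j\<close>, that is, at tape position \<open>j - T\<close>, records the state, the
  symbols under the heads, the symbols in this column, and the direction in which each head lies.\<close>

datatype tile = Tile (tq: nat) (trs: "nat list") (tss: "nat list") (tgs: "int list")

text \<open>The last clause ties the scanned symbols \<open>trs\<close>, repeated in every column,
  to the actual symbol in the column of the head.\<close>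

definition tiles :: "tm \<Rightarrow> tile set" where
  "tiles M = {a. tq a < nstates M \<and> length (trs a) = ntapes M \<and> length (tss a) = ntapes M \<and>
     length (tgs a) = ntapes M \<and> set (trs a) \<subseteq> {..<nsymbols M} \<and> set (tss a) \<subseteq> {..<nsymbols M} \<and>
     set (tgs a) \<subseteq> {-1, 0, 1} \<and> (\<forall>i<ntapes M. tgs a ! i = 0 \<longrightarrow> tss a ! i = trs a ! i)}"

text \<open>Halted configurations idle, so that every accepting run fills exactly the rows up to
  \<open>T\<close>.\<close>

definition act :: "tm \<Rightarrow> nat \<Rightarrow> nat list \<Rightarrow> nat \<times> (nat \<times> int) list" where
  "act M q rs = (if q = 1 then (1, map (\<lambda>s. (s, 0)) rs) else delta M q rs)"

text \<open>From left to right the direction is 1 before a head, 0 at it and -1 after it. Constant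
  rows pass this test too; that each head does occur in every row comes out of the induction in
  \<open>tiling_sound\<close>.\<close>

definition hrel :: "tm \<Rightarrow> tile \<Rightarrow> tile \<Rightarrow> bool" where
  "hrel M a b \<longleftrightarrow> tq b = tq a \<and> trs b = trs a \<and>
     (\<forall>i<ntapes M. (tgs a ! i, tgs b ! i) \<in> {(1, 1), (1, 0), (0, -1), (-1, -1)})"

text \<open>A head moves by at most one cell, so seen from a column that it did not occupy its
  direction may become 0 but never the opposite. Together with \<open>hrel\<close> this local ban
  places the head in the next row.\<close>

definition vrel :: "tm \<Rightarrow> tile \<Rightarrow> tile \<Rightarrow> bool" where
  "vrel M a b \<longleftrightarrow> tq b = fst (act M (tq a) (trs a)) \<and>
     (\<forall>i<ntapes M. if tgs a ! i = 0
        then tss b ! i = fst (snd (act M (tq a) (trs a)) ! i) \<and> tgs b ! i = snd (snd (act M (tq a) (trs a)) ! i)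
        else tss b ! i = tss a ! i \<and> tgs b ! i \<noteq> - (tgs a ! i))"

text \<open>Boundary conditions. In the first row the \<open>l\<close> cells after \<open>D\<close>
  may hold either bit: the certificate is the only freedom of a tiling. In the last row the output
  \<open>[True]\<close> means symbol 2 in column \<open>T\<close>, which is position 0, and blanks
  elsewhere.\<close>

definition uok :: "tm \<Rightarrow> nat \<Rightarrow> bool list \<Rightarrow> nat \<Rightarrow> nat \<Rightarrow> nat \<Rightarrow> tile \<Rightarrow> bool" where
  "uok M T D l t j a \<longleftrightarrow>
     (t = 0 \<longrightarrow> tq a = 0 \<and> (\<forall>i<ntapes M. i \<noteq> 0 \<longrightarrow> tss a ! i = 0) \<and>
        (\<forall>i<ntapes M. tgs a ! i = sgn (int T - int j)) \<and>
        (if j < T then tss a ! 0 = 0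
         else if j - T < length D then tss a ! 0 = bitsym (D ! (j - T))
         else if j - T < length D + l then tss a ! 0 \<in> {1, 2}
         else tss a ! 0 = 0)) \<and>
     (t = T \<longrightarrow> tq a = 1 \<and> tss a ! 0 = (if j = T then 2 else 0))"

definition tiling :: "tm \<Rightarrow> nat \<Rightarrow> bool list \<Rightarrow> nat \<Rightarrow> (nat \<Rightarrow> nat \<Rightarrow> tile) \<Rightarrow> bool" where
  "tiling M T D l \<tau> \<longleftrightarrow> (\<forall>t\<le>T. \<forall>j\<le>2 * T. \<tau> t j \<in> tiles M \<and> uok M T D l t j (\<tau> t j) \<and>
     (j < 2 * T \<longrightarrow> hrel M (\<tau> t j) (\<tau> t (Suc j))) \<and>
     (t < T \<longrightarrow> vrel M (\<tau> t j) (\<tau> (Suc t) j)))"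

definition tile_at :: "nat \<Rightarrow> config \<Rightarrow> nat \<Rightarrow> tile" where
  "tile_at T C j = Tile (fst C) (map (\<lambda>(c, h). c h) (snd C))
     (map (\<lambda>(c, h). c (int j - int T)) (snd C)) (map (\<lambda>(c, h). sgn (h - (int j - int T))) (snd C))"

lemma finite_tiles: "finite (tiles M)"
proof -
  let ?k = "ntapes M"
  let ?N = "{xs. set xs \<subseteq> {..<nsymbols M} \<and> length xs = ?k}"
  let ?Z = "{xs. set xs \<subseteq> {-1, 0, 1 :: int} \<and> length xs = ?k}"
  have "tiles M \<subseteq> (\<lambda>(q, r, s, g). Tile q r s g) ` ({..<nstates M} \<times> ?N \<times> ?N \<times> ?Z)"
  proof
    fix a assume "a \<in> tiles M"
    then show "a \<in> (\<lambda>(q, r, s, g). Tile q r s g) ` ({..<nstates M} \<times> ?N \<times> ?N \<times> ?Z)"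
      by (intro image_eqI[of _ _ "(tq a, trs a, tss a, tgs a)"]) (auto simp: tiles_def)
  qed
  moreover have "finite ({..<nstates M} \<times> ?N \<times> ?N \<times> ?Z)"
    by (intro finite_cartesian_product finite_lists_length_eq) auto
  ultimately show ?thesis by (meson finite_imageI finite_subset)
qed

lemma act_wf:
  assumes "turing_machine M" "wf_cfg M (q, ts)" "act M q (map (\<lambda>(c, h). c h) ts) = (q', as)"
  shows "length as = ntapes M" "\<And>j. j < ntapes M \<Longrightarrow> snd (as ! j) \<in> {-1, 0, 1}"
    "step M (q, ts) = (q', map (\<lambda>j. upd_tape (as ! j) (ts ! j)) [0..<ntapes M])"
proof -
  have l: "length ts = ntapes M" using assms(2) by (simp add: wf_cfg_def)
  have "length as = ntapes M \<and> (\<forall>j<ntapes M. snd (as ! j) \<in> {-1, 0, 1}) \<and>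
    step M (q, ts) = (q', map (\<lambda>j. upd_tape (as ! j) (ts ! j)) [0..<ntapes M])"
  proof (cases "q = 1")
    case True
    then have as: "q' = 1" "as = map (\<lambda>s. (s, 0)) (map (\<lambda>(c, h). c h) ts)"
      using assms(3) by (auto simp: act_def)
    have "upd_tape (as ! j) (ts ! j) = ts ! j" if "j < ntapes M" for j
      using that l unfolding as by (simp add: upd_tape_def split_beta)
    then have "map (\<lambda>j. upd_tape (as ! j) (ts ! j)) [0..<ntapes M] = ts"
      using l by (intro nth_equalityI) auto
    then show ?thesis using True as l by (simp add: step_def)
  next
    case False
    then have d: "delta M q (map (\<lambda>(c, h). c h) ts) = (q', as)" using assms(3) by (simp add: act_def)
    note w = delta_wf[OF assms(1,2) d]
    show ?thesis using w step_eq[OF False d] l by simp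
  qed
  then show "length as = ntapes M" "\<And>j. j < ntapes M \<Longrightarrow> snd (as ! j) \<in> {-1, 0, 1}"
    "step M (q, ts) = (q', map (\<lambda>j. upd_tape (as ! j) (ts ! j)) [0..<ntapes M])" by blast+
qed

lemma head_bound:
  assumes M: "turing_machine M" and i: "i < ntapes M"
  shows "\<bar>snd (snd ((step M ^^ t) (initial_config M w)) ! i)\<bar> \<le> int t"
proof (induction t)
  case 0
  then show ?case using i by (simp add: initial_config_def nth_Cons')
next
  case (Suc t)
  obtain q ts where C: "(step M ^^ t) (initial_config M w) = (q, ts)" by force
  obtain q' as where a: "act M q (map (\<lambda>(c, h). c h) ts) = (q', as)" by force
  have wf: "wf_cfg M (q, ts)" using wf_cfg_run[OF M, of t w] C by simp
  have "snd (as ! i) \<in> {-1, 0, 1}" by (rule act_wf(2)[OF M wf a i])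
  then show ?case using Suc act_wf(3)[OF M wf a] i by (auto simp: C upd_tape_def split_beta)
qed

text \<open>By \<open>head_bound\<close> no head gets beyond distance \<open>T\<close>, so nothing
  is written there; this is why \<open>2 * T + 1\<close> columns suffice.\<close>

lemma blank_outside:
  assumes M: "turing_machine M" and i: "i < ntapes M" and w: "length w \<le> T"
  shows "t \<le> T \<Longrightarrow> int T < \<bar>p\<bar> \<Longrightarrow> fst (snd ((step M ^^ t) (initial_config M w)) ! i) p = 0"
proof (induction t)
  case 0
  then show ?case using i w by (auto simp: initial_config_def nth_Cons' tape_of_def)
next
  case (Suc t)
  obtain q ts where C: "(step M ^^ t) (initial_config M w) = (q, ts)" by force
  obtain q' as where a: "act M q (map (\<lambda>(c, h). c h) ts) = (q', as)" by force
  have wf: "wf_cfg M (q, ts)" using wf_cfg_run[OF M, of t w] C by simp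
  have "p \<noteq> snd (ts ! i)" using head_bound[OF M i, of t w] C Suc.prems by auto
  then show ?case using Suc act_wf(3)[OF M wf a] i by (simp add: C upd_tape_def split_beta)
qed

text \<open>Starting from the zero, the admissible pairs force -1 everywhere to the right and 1
  everywhere to the left.\<close>

lemma sign_row:
  assumes h: "\<And>j. j < N \<Longrightarrow> (g j, g (Suc j)) \<in> {(1, 1), (1, 0), (0, -1), (-1, -1 :: int)}"
    and z: "z \<le> N" "g z = 0" and j: "j \<le> N"
  shows "g j = sgn (int z - int j)"
proof -
  have "z + d \<le> N \<Longrightarrow> g (z + d) = sgn (- int d)" for d
  proof (induction d)
    case (Suc d)
    then show ?case using h[of "z + d"] by (cases d) auto
  qed (use z in simp)
  note up = this
  have "d \<le> z \<Longrightarrow> g (z - d) = sgn (int d)" for d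
  proof (induction d)
    case (Suc d)
    then have "Suc (z - Suc d) = z - d" "z - Suc d < N" using z by auto
    then show ?case using h[of "z - Suc d"] Suc by (cases d) auto
  qed (use z in simp)
  note down = this
  show ?thesis
  proof (cases "z \<le> j")
    case True
    then show ?thesis using up[of "j - z"] j by (simp add: of_nat_diff)
  next
    case False
    then show ?thesis using down[of "z - j"] by (simp add: of_nat_diff)
  qed
qed

text \<open>One zero per head determines all directions by \<open>sign_row\<close>; the scanned
  symbols are constant along the row and correct in the column of the head.\<close>

lemma row_eq_tile_at:
  assumes C: "wf_cfg M C" "\<And>i. i < ntapes M \<Longrightarrow> \<bar>snd (snd C ! i)\<bar> \<le> int T"
    and R: "\<And>j. j \<le> 2 * T \<Longrightarrow> R j \<in> tiles M" "\<And>j. j < 2 * T \<Longrightarrow> hrel M (R j) (R (Suc j))"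
    and q: "\<And>j. j \<le> 2 * T \<Longrightarrow> tq (R j) = fst C"
    and s: "\<And>j i. j \<le> 2 * T \<Longrightarrow> i < ntapes M \<Longrightarrow> tss (R j) ! i = fst (snd C ! i) (int j - int T)"
    and z: "\<And>i. i < ntapes M \<Longrightarrow> tgs (R (nat (snd (snd C ! i) + int T))) ! i = 0"
    and j: "j \<le> 2 * T"
  shows "R j = tile_at T C j"
proof -
  have l: "length (snd C) = ntapes M" using C(1) by (simp add: wf_cfg_def split_beta)
  have rs: "trs (R j) = trs (R 0)" if "j \<le> 2 * T" for j
    using that
  proof (induction j)
    case (Suc j)
    then show ?case using R(2)[of j] by (simp add: hrel_def)
  qed simp
  have zi: "nat (snd (snd C ! i) + int T) \<le> 2 * T" "int (nat (snd (snd C ! i) + int T)) = snd (snd C ! i) + int T"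
    if "i < ntapes M" for i using C(2)[OF that] by auto
  have g: "tgs (R j) ! i = sgn (snd (snd C ! i) - (int j - int T))" if "i < ntapes M" for i
  proof -
    have "tgs (R j) ! i = sgn (int (nat (snd (snd C ! i) + int T)) - int j)"
    proof (rule sign_row[where g = "\<lambda>j. tgs (R j) ! i" and N = "2 * T"])
      fix j assume "j < 2 * T"
      then show "(tgs (R j) ! i, tgs (R (Suc j)) ! i) \<in> {(1, 1), (1, 0), (0, - 1), (- 1, - 1)}"
        using R(2)[of j] that unfolding hrel_def by blast
    qed (use zi(1)[OF that] z[OF that] j in auto)
    then show ?thesis using zi(2)[OF that] by (simp add: algebra_simps)
  qed
  have r: "trs (R j) ! i = fst (snd C ! i) (snd (snd C ! i))" if "i < ntapes M" for i
  proof -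
    let ?z = "nat (snd (snd C ! i) + int T)"
    have "trs (R ?z) ! i = tss (R ?z) ! i"
      using R(1)[OF zi(1)[OF that]] z[OF that] that by (simp add: tiles_def)
    also have "\<dots> = fst (snd C ! i) (snd (snd C ! i))"
      using s[OF zi(1)[OF that] that] zi(2)[OF that] by simp
    finally show ?thesis using rs[OF j] rs[OF zi(1)[OF that]] by simp
  qed
  have Rj: "R j \<in> tiles M" by (rule R(1)[OF j])
  show ?thesis
  proof (rule tile.expand, intro conjI)
    show "tq (R j) = tq (tile_at T C j)" using q[OF j] by (simp add: tile_at_def)
    show "trs (R j) = trs (tile_at T C j)"
      using Rj l r by (auto simp: tile_at_def tiles_def split_beta intro!: nth_equalityI)
    show "tss (R j) = tss (tile_at T C j)"
      using Rj l s[OF j] by (auto simp: tile_at_def tiles_def split_beta intro!: nth_equalityI)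
    show "tgs (R j) = tgs (tile_at T C j)"
      using Rj l g by (auto simp: tile_at_def tiles_def split_beta intro!: nth_equalityI)
  qed
qed

lemma tape_of_append_eq:
  assumes "j \<ge> T" "j - T < length D + length y"
  shows "tape_of (D @ y) (int j - int T) =
    (if j - T < length D then bitsym (D ! (j - T)) else bitsym (y ! (j - T - length D)))"
  using assms by (auto simp: tape_of_def bitsym_def nth_append nat_diff_distrib of_nat_diff simp flip: of_nat_diff)

lemma initial_tape:
  "i < ntapes M \<Longrightarrow> snd (initial_config M w) ! i = (if i = 0 then tape_of w else (\<lambda>_. 0), 0)"
  by (simp add: initial_config_def nth_Cons')

lemma nth_tile_at:
  assumes "i < length (snd C)"
  shows "trs (tile_at T C j) ! i = fst (snd C ! i) (snd (snd C ! i))"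
    "tss (tile_at T C j) ! i = fst (snd C ! i) (int j - int T)"
    "tgs (tile_at T C j) ! i = sgn (snd (snd C ! i) - (int j - int T))"
  using assms by (simp_all add: tile_at_def split_beta)

lemma tiling_complete:
  assumes M: "turing_machine M" and T: "length D + length y \<le> T"
    and cf: "\<And>t. cf t = (step M ^^ t) (initial_config M (D @ y))"
    and acc: "fst (cf T) = 1" "fst (snd (cf T) ! 0) = tape_of [True]"
  shows "tiling M T D (length y) (\<lambda>t. tile_at T (cf t))"
  unfolding tiling_def
proof (intro allI impI conjI)
  fix t j assume t: "t \<le> T" and j: "j \<le> 2 * T"
  let ?k = "ntapes M"
  have k: "1 \<le> ?k" using M by (simp add: turing_machine_def)
  have wf: "wf_cfg M (cf t)" for t unfolding cf by (rule wf_cfg_run[OF M])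
  have l: "length (snd (cf t)) = ?k" for t using wf[of t] by (simp add: wf_cfg_def split_beta)
  have sy: "fst (snd (cf t) ! i) p < nsymbols M" if "i < ?k" for i p t
    using wf[of t] that by (simp add: wf_cfg_def split_beta)
  show "tile_at T (cf t) j \<in> tiles M"
  proof -
    have q: "fst (cf t) < nstates M" using wf[of t] by (simp add: wf_cfg_def split_beta)
    have "fst T p < nsymbols M" if "T \<in> set (snd (cf t))" for T p
      using that sy l[of t] by (auto simp: in_set_conv_nth)
    then show ?thesis
      using q l[of t] unfolding tiles_def tile_at_def by (auto simp: split_beta sgn_if split: if_splits)
  qed
  show "uok M T D (length y) t j (tile_at T (cf t) j)"
    unfolding uok_def
  proof (intro conjI impI)
    assume t0: "t = 0"
    have c0: "snd (cf 0) ! i = (if i = 0 then tape_of (D @ y) else (\<lambda>_. 0), 0)" if "i < ?k" for i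
      using initial_tape[OF that] by (simp add: cf)
    show "tq (tile_at T (cf t) j) = 0" by (simp add: t0 cf tile_at_def initial_config_def)
    show "\<forall>i<?k. i \<noteq> 0 \<longrightarrow> tss (tile_at T (cf t) j) ! i = 0"
      using l[of 0] by (simp add: t0 nth_tile_at c0)
    show "\<forall>i<?k. tgs (tile_at T (cf t) j) ! i = sgn (int T - int j)"
      using l[of 0] by (simp add: t0 nth_tile_at c0)
    have "tss (tile_at T (cf t) j) ! 0 = tape_of (D @ y) (int j - int T)"
      using l[of 0] k by (simp add: t0 nth_tile_at c0)
    then show "if j < T then tss (tile_at T (cf t) j) ! 0 = 0
      else if j - T < length D then tss (tile_at T (cf t) j) ! 0 = bitsym (D ! (j - T))
      else if j - T < length D + length y then tss (tile_at T (cf t) j) ! 0 \<in> {1, 2}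
      else tss (tile_at T (cf t) j) ! 0 = 0"
      using tape_of_append_eq[of T j D y] by (auto simp: tape_of_def bitsym_def)
  next
    assume tT: "t = T"
    show "tq (tile_at T (cf t) j) = 1" using acc by (simp add: tT tile_at_def)
    have "tss (tile_at T (cf t) j) ! 0 = tape_of [True] (int j - int T)"
      using l[of T] k acc by (simp add: tT nth_tile_at)
    then show "tss (tile_at T (cf t) j) ! 0 = (if j = T then 2 else 0)"
      by (auto simp: tape_of_def)
  qed
  show "hrel M (tile_at T (cf t) j) (tile_at T (cf t) (Suc j))"
    unfolding hrel_def
  proof (intro conjI allI impI)
    fix i assume i: "i < ?k"
    show "(tgs (tile_at T (cf t) j) ! i, tgs (tile_at T (cf t) (Suc j)) ! i) \<in> {(1, 1), (1, 0), (0, - 1), (- 1, - 1)}"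
      using i l[of t] by (simp add: nth_tile_at) (simp add: sgn_if)
  qed (simp_all add: tile_at_def)
  show "vrel M (tile_at T (cf t) j) (tile_at T (cf (Suc t)) j)"
  proof -
    obtain q ts where C: "cf t = (q, ts)" by force
    obtain q' as where a: "act M q (map (\<lambda>(c, h). c h) ts) = (q', as)" by force
    have w: "wf_cfg M (q, ts)" using wf[of t] C by simp
    note aw = act_wf[OF M w a]
    have C': "cf (Suc t) = (q', map (\<lambda>j. upd_tape (as ! j) (ts ! j)) [0..<?k])"
      using aw(3) C by (simp add: cf)
    have lt: "length ts = ?k" using l[of t] C by simp
    have ac: "act M (tq (tile_at T (cf t) j)) (trs (tile_at T (cf t) j)) = (q', as)"
      using a by (simp add: tile_at_def C)
    show ?thesis
      unfolding vrel_def ac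
    proof (intro conjI allI impI)
      show "tq (tile_at T (cf (Suc t)) j) = fst (q', as)" by (simp add: tile_at_def C')
      fix i assume i: "i < ?k"
      obtain c h where ch: "ts ! i = (c, h)" by force
      obtain s d where sd: "as ! i = (s, d)" by force
      have d: "d \<in> {-1, 0, 1}" using aw(2)[OF i] sd by simp
      have g: "tgs (tile_at T (cf t) j) ! i = sgn (h - (int j - int T))"
        "tss (tile_at T (cf t) j) ! i = c (int j - int T)"
        using i lt ch by (simp_all add: C nth_tile_at)
      have g': "tgs (tile_at T (cf (Suc t)) j) ! i = sgn (h + d - (int j - int T))"
        "tss (tile_at T (cf (Suc t)) j) ! i = (c(h := s)) (int j - int T)"
        using i lt ch sd by (simp_all add: C' nth_tile_at upd_tape_def)
      show "if tgs (tile_at T (cf t) j) ! i = 0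
         then tss (tile_at T (cf (Suc t)) j) ! i = fst (snd (q', as) ! i) \<and>
              tgs (tile_at T (cf (Suc t)) j) ! i = snd (snd (q', as) ! i)
         else tss (tile_at T (cf (Suc t)) j) ! i = tss (tile_at T (cf t) j) ! i \<and>
              tgs (tile_at T (cf (Suc t)) j) ! i \<noteq> - (tgs (tile_at T (cf t) j) ! i)"
      proof (cases "h = int j - int T")
        case True
        then show ?thesis using d by (auto simp: g g' sd)
      next
        case False
        then have "sgn (h - (int j - int T)) \<noteq> 0" by (simp add: sgn_0_0)
        moreover have "sgn (h + d - (int j - int T)) \<noteq> - sgn (h - (int j - int T))"
          using d False by (auto simp: sgn_if)
        ultimately show ?thesis using False by (simp add: g g')
      qed
    qed
  qed
qed

text \<open>The certificate is read off the first row; from there each row forces the next because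
  the machine is deterministic.\<close>

lemma tiling_sound:
  assumes M: "turing_machine M" and T: "length D + l \<le> T" and \<tau>: "tiling M T D l \<tau>"
  obtains y where "length y = l"
    "\<And>t j. t \<le> T \<Longrightarrow> j \<le> 2 * T \<Longrightarrow> \<tau> t j = tile_at T ((step M ^^ t) (initial_config M (D @ y))) j"
proof -
  let ?k = "ntapes M"
  have k: "1 \<le> ?k" using M by (simp add: turing_machine_def)
  have ti: "\<tau> t j \<in> tiles M" and uo: "uok M T D l t j (\<tau> t j)" if "t \<le> T" "j \<le> 2 * T" for t j
    using \<tau> that unfolding tiling_def by blast+
  have hr: "hrel M (\<tau> t j) (\<tau> t (Suc j))" if "t \<le> T" "j < 2 * T" for t j
    using \<tau> that unfolding tiling_def by (metis less_imp_le)
  have vr: "vrel M (\<tau> t j) (\<tau> (Suc t) j)" if "t < T" "j \<le> 2 * T" for t j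
    using \<tau> that unfolding tiling_def by (metis less_imp_le)
  define y where "y = map (\<lambda>i. tss (\<tau> 0 (T + length D + i)) ! 0 = 2) [0..<l]"
  have ly: "length y = l" by (simp add: y_def)
  define cf where "cf t = (step M ^^ t) (initial_config M (D @ y))" for t
  have wf: "wf_cfg M (cf t)" for t unfolding cf_def by (rule wf_cfg_run[OF M])
  have lc: "length (snd (cf t)) = ?k" for t using wf[of t] by (simp add: wf_cfg_def split_beta)
  have hb: "\<bar>snd (snd (cf t) ! i)\<bar> \<le> int t" if "i < ?k" for t i
    unfolding cf_def by (rule head_bound[OF M that])
  have "t \<le> T \<longrightarrow> (\<forall>j\<le>2 * T. \<tau> t j = tile_at T (cf t) j)" for t
  proof (induction t)
    case 0
    have c0: "snd (cf 0) ! i = (if i = 0 then tape_of (D @ y) else (\<lambda>_. 0), 0)" if "i < ?k" for i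
      using initial_tape[OF that] by (simp add: cf_def)
    show ?case
    proof (intro impI allI)
      fix j assume j: "j \<le> 2 * T"
      show "\<tau> 0 j = tile_at T (cf 0) j"
      proof (rule row_eq_tile_at[OF wf, where R = "\<tau> 0" and j = j])
        fix i assume i: "i < ?k"
        show "\<bar>snd (snd (cf 0) ! i)\<bar> \<le> int T" using hb[OF i, of 0] by simp
        show "tgs (\<tau> 0 (nat (snd (snd (cf 0) ! i) + int T))) ! i = 0"
          using uo[of 0 T] i by (simp add: c0 uok_def)
      next
        fix j assume j: "j \<le> 2 * T"
        show "tq (\<tau> 0 j) = fst (cf 0)" using uo[of 0 j] j by (simp add: cf_def uok_def initial_config_def)
        fix i assume i: "i < ?k"
        show "tss (\<tau> 0 j) ! i = fst (snd (cf 0) ! i) (int j - int T)"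
        proof (cases "i = 0")
          case False
          then show ?thesis using uo[of 0 j] j i by (simp add: c0 uok_def)
        next
          case True
          have u: "if j < T then tss (\<tau> 0 j) ! 0 = 0
            else if j - T < length D then tss (\<tau> 0 j) ! 0 = bitsym (D ! (j - T))
            else if j - T < length D + l then tss (\<tau> 0 j) ! 0 \<in> {1, 2} else tss (\<tau> 0 j) ! 0 = 0"
            using uo[of 0 j] j unfolding uok_def by blast
          have "tss (\<tau> 0 j) ! 0 = tape_of (D @ y) (int j - int T)"
          proof (cases "j < T \<or> length D + l \<le> j - T")
            case True
            then show ?thesis using u ly by (auto simp: tape_of_def split: if_splits)
          next
            case False
            then have e: "tape_of (D @ y) (int j - int T) =
              (if j - T < length D then bitsym (D ! (j - T)) else bitsym (y ! (j - T - length D)))"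
              using ly by (intro tape_of_append_eq) auto
            show ?thesis
            proof (cases "j - T < length D")
              case True
              then show ?thesis using u e False by auto
            next
              case F: False
              then have "tss (\<tau> 0 j) ! 0 \<in> {1, 2}" using u False by auto
              moreover have "y ! (j - T - length D) \<longleftrightarrow> tss (\<tau> 0 j) ! 0 = 2"
              proof -
                define i where "i = j - T - length D"
                have "j = T + length D + i" "i < l" using False F by (auto simp: i_def)
                then show ?thesis unfolding i_def[symmetric] by (simp add: y_def)
              qed
              ultimately show ?thesis using e F by (auto simp: bitsym_def)
            qed
          qed
          then show ?thesis using True i by (simp add: c0)
        qed
      qed (use ti hr j in auto)
    qed
  next
    case (Suc t)
    show ?case
    proof (intro impI allI)
      fix j assume tT: "Suc t \<le> T" and j: "j \<le> 2 * T"
      have IH: "\<tau> t j = tile_at T (cf t) j" if "j \<le> 2 * T" for j using Suc tT that by auto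
      obtain q ts where C: "cf t = (q, ts)" by force
      obtain q' as where a: "act M q (map (\<lambda>(c, h). c h) ts) = (q', as)" by force
      have w: "wf_cfg M (q, ts)" using wf[of t] C by simp
      note aw = act_wf[OF M w a]
      have C': "cf (Suc t) = (q', map (\<lambda>j. upd_tape (as ! j) (ts ! j)) [0..<?k])"
        using aw(3) C by (simp add: cf_def)
      have lt: "length ts = ?k" using lc[of t] C by simp
      have ac: "act M (tq (\<tau> t j)) (trs (\<tau> t j)) = (q', as)" if "j \<le> 2 * T" for j
        using a by (simp add: IH[OF that] tile_at_def C)
      have V: "tq (\<tau> (Suc t) j) = q'" "i < ?k \<Longrightarrow> if tgs (\<tau> t j) ! i = 0
           then tss (\<tau> (Suc t) j) ! i = fst (as ! i) \<and> tgs (\<tau> (Suc t) j) ! i = snd (as ! i)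
           else tss (\<tau> (Suc t) j) ! i = tss (\<tau> t j) ! i \<and> tgs (\<tau> (Suc t) j) ! i \<noteq> - (tgs (\<tau> t j) ! i)"
        if "j \<le> 2 * T" for j i
        using vr[of t j] tT that unfolding vrel_def ac[OF that] fst_conv snd_conv by auto
      show "\<tau> (Suc t) j = tile_at T (cf (Suc t)) j"
      proof (rule row_eq_tile_at[OF wf, where R = "\<tau> (Suc t)" and j = j])
        fix i assume i: "i < ?k"
        show "\<bar>snd (snd (cf (Suc t)) ! i)\<bar> \<le> int T" using hb[OF i, of "Suc t"] tT by simp
        obtain c h where ch: "ts ! i = (c, h)" by force
        obtain s d where sd: "as ! i = (s, d)" by force
        have d: "d \<in> {-1, 0, 1}" using aw(2)[OF i] sd by simp
        have h: "\<bar>h\<bar> \<le> int t" using hb[OF i, of t] C ch by simp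
        define z where "z = nat (h + int T)"
        have z: "int z = h + int T" "z \<le> 2 * T" "0 < z" "z < 2 * T" using h tT by (auto simp: z_def)
        have g: "tgs (\<tau> t j) ! i = sgn (h - (int j - int T))" if "j \<le> 2 * T" for j
          using i lt ch by (simp add: IH[OF that] C nth_tile_at)
        have gz: "tgs (\<tau> (Suc t) z) ! i = d" using V(2)[OF z(2) i] g[OF z(2)] z(1) sd by simp
        have hr': "(tgs (\<tau> (Suc t) j) ! i, tgs (\<tau> (Suc t) (Suc j)) ! i) \<in> {(1, 1), (1, 0), (0, - 1), (- 1, - 1)}"
          if "j < 2 * T" for j using hr[OF tT that] i unfolding hrel_def by blast
        have tgt: "nat (snd (snd (cf (Suc t)) ! i) + int T) = nat (int z + d)"
          using i ch sd z(1) by (simp add: C' upd_tape_def algebra_simps)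
        \<comment> \<open>In the new row column \<open>z\<close> shows \<open>d\<close>. If
          \<open>d = 1\<close>, column \<open>z + 1\<close> showed -1 before and so cannot show 1
          now, whereas \<open>hrel\<close> after a 1 permits only 1 or 0. The case
          \<open>d = -1\<close> is symmetric; both neighbours exist since the head is at distance at
          most \<open>t < T\<close> from the centre.\<close>
        have "tgs (\<tau> (Suc t) (nat (int z + d))) ! i = 0"
        proof -
          from d consider "d = 0" | "d = 1" | "d = -1" by blast
          then show ?thesis
          proof cases
            case 1
            then show ?thesis using gz by simp
          next
            case 2
            have "tgs (\<tau> t (Suc z)) ! i = -1" using g[of "Suc z"] z by simp
            then have "tgs (\<tau> (Suc t) (Suc z)) ! i \<noteq> 1" using V(2)[of "Suc z" i] i z by simp
            moreover have "tgs (\<tau> (Suc t) (Suc z)) ! i \<in> {0, 1}" using hr'[OF z(4)] gz 2 by auto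
            moreover have "nat (int z + d) = Suc z" using 2 by simp
            ultimately show ?thesis by simp
          next
            case 3
            have sz: "Suc (z - 1) = z" "z - 1 < 2 * T" "int (z - 1) = int z - 1" using z by auto
            have "tgs (\<tau> t (z - 1)) ! i = 1" using g[of "z - 1"] z sz by simp
            then have "tgs (\<tau> (Suc t) (z - 1)) ! i \<noteq> -1" using V(2)[of "z - 1" i] i sz by simp
            moreover have "tgs (\<tau> (Suc t) (z - 1)) ! i \<in> {0, -1}" using hr'[OF sz(2)] gz 3 sz(1) by auto
            moreover have "nat (int z + d) = z - 1" using 3 sz by simp
            ultimately show ?thesis by simp
          qed
        qed
        then show "tgs (\<tau> (Suc t) (nat (snd (snd (cf (Suc t)) ! i) + int T))) ! i = 0"
          unfolding tgt .
      next
        fix j assume j: "j \<le> 2 * T"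
        show "tq (\<tau> (Suc t) j) = fst (cf (Suc t))" using V(1)[OF j] by (simp add: C')
        fix i assume i: "i < ?k"
        obtain c h where ch: "ts ! i = (c, h)" by force
        obtain s d where sd: "as ! i = (s, d)" by force
        have g: "tgs (\<tau> t j) ! i = sgn (h - (int j - int T))" "tss (\<tau> t j) ! i = c (int j - int T)"
          using i lt ch by (simp_all add: IH[OF j] C nth_tile_at)
        show "tss (\<tau> (Suc t) j) ! i = fst (snd (cf (Suc t)) ! i) (int j - int T)"
          using V(2)[OF j i] i g ch sd by (auto simp: C' upd_tape_def sgn_0_0 split: if_splits)
      qed (use ti hr tT j in auto)
    qed
  qed
  then show ?thesis using that[OF ly] unfolding cf_def by blast
qed

section \<open>The model of a verifier\<close>

text \<open>Repeated features for one edge add up; large weights are obtained in this way.\<close>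

definition edge_weight :: "(feature \<times> int) list \<Rightarrow> nat set \<Rightarrow> int" where
  "edge_weight fs e = (\<Sum>(f, w)\<leftarrow>fs. case f of Edge u v \<Rightarrow> if {u, v} = e then w else 0 | _ \<Rightarrow> 0)"

definition triangle_weight :: "(feature \<times> int) list \<Rightarrow> int" where
  "triangle_weight fs = (\<Sum>(f, w)\<leftarrow>fs. case f of Triangles \<Rightarrow> w | _ \<Rightarrow> 0)"

text \<open>Edge indicators are additive over the edges of \<open>H\<close>, so the exponent takes
  the form treated in \<open>partition_sum_independent_sets\<close>.\<close>

lemma density_eq:
  assumes "finite H" "\<And>s w. (Other s, w) \<notin> set fs"
  shows "density ext \<lparr>num_vertices = n, weighted_features = fs\<rparr> H =
    2 powi ((\<Sum>e\<in>H. edge_weight fs e) + triangle_weight fs * int (triangle_count H))"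
  using assms(2)
proof (induction fs)
  case Nil
  then show ?case by (simp add: density_def edge_weight_def triangle_weight_def)
next
  case (Cons a fs)
  obtain f w where a: "a = (f, w)" by force
  have IH: "density ext \<lparr>num_vertices = n, weighted_features = fs\<rparr> H =
    2 powi ((\<Sum>e\<in>H. edge_weight fs e) + triangle_weight fs * int (triangle_count H))"
    using Cons.prems by (intro Cons.IH) auto
  have d: "density ext \<lparr>num_vertices = n, weighted_features = a # fs\<rparr> H =
    2 powi (int (feature_value ext n f H) * w) * density ext \<lparr>num_vertices = n, weighted_features = fs\<rparr> H"
    by (simp add: density_def a)
  show ?case
  proof (cases f)
    case (Edge u v)
    have "(\<Sum>e\<in>H. edge_weight (a # fs) e) = (\<Sum>e\<in>H. if {u, v} = e then w else 0) + (\<Sum>e\<in>H. edge_weight fs e)"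
      by (simp add: edge_weight_def a Edge sum.distrib)
    also have "(\<Sum>e\<in>H. if {u, v} = e then w else 0) = int (feature_value ext n f H) * w"
      using assms(1) by (simp add: Edge sum.delta)
    finally show ?thesis unfolding d IH
      by (simp add: triangle_weight_def a Edge power_int_add add.assoc)
  next
    case Triangles
    then show ?thesis unfolding d IH
      by (simp add: triangle_weight_def edge_weight_def a power_int_add ring_distribs mult.commute add_ac)
  next
    case (Other s)
    then show ?thesis using Cons.prems a by auto
  qed
qed

lemma edge_weight_append: "edge_weight (fs @ gs) e = edge_weight fs e + edge_weight gs e"
  and triangle_weight_append: "triangle_weight (fs @ gs) = triangle_weight fs + triangle_weight gs"
  by (simp_all add: edge_weight_def triangle_weight_def)

lemma edge_weight_concat: "edge_weight (concat (map F xs)) e = (\<Sum>x\<leftarrow>xs. edge_weight (F x) e)"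
  and triangle_weight_concat: "triangle_weight (concat (map F xs)) = (\<Sum>x\<leftarrow>xs. triangle_weight (F x))"
  by (induction xs) (simp_all add: edge_weight_append triangle_weight_append edge_weight_def[of "[]"]
      triangle_weight_def[of "[]"])

lemma edge_weight_replicate:
  "edge_weight (replicate c (Edge u v, w)) e = (if {u, v} = e then int c * w else 0)"
  "edge_weight (replicate c (Triangles, w)) e = 0"
  by (simp_all add: edge_weight_def sum_list_replicate)

lemma triangle_weight_replicate:
  "triangle_weight (replicate c (Edge u v, w)) = 0"
  "triangle_weight (replicate c (Triangles, w)) = int c * w"
  by (simp_all add: triangle_weight_def sum_list_replicate)

section \<open>Vertices, weights and conflicts of the instance\<close>

definition ncell :: "nat \<Rightarrow> nat" where "ncell T = Suc T * Suc (2 * T)"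
definition nv :: "nat \<Rightarrow> nat \<Rightarrow> nat" where "nv K T = 2 + ncell T * K"
text \<open>\<open>wA\<close>, \<open>wM\<close> and \<open>wB\<close> are the least values that
  satisfy the hypotheses on \<open>A\<close>, \<open>M\<close> and \<open>B\<close> in
  \<open>partition_sum_independent_sets\<close>.\<close>

definition wA :: "nat \<Rightarrow> nat \<Rightarrow> nat" where "wA K T = nv K T + 1"
definition wM :: "nat \<Rightarrow> nat \<Rightarrow> nat" where "wM K T = 2 * wA K T * nv K T + nv K T ^ 2 + 1"
definition wB :: "nat \<Rightarrow> nat \<Rightarrow> nat" where
  "wB K T = wM K T * nv K T ^ 3 + 2 * wA K T * nv K T + nv K T ^ 2 + 1"
text \<open>Mixed-radix numbering of time, column and tile; the offset 3 reserves 1 for the hub and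
  2 for the marker.\<close>

definition vid :: "nat \<Rightarrow> nat \<Rightarrow> nat \<Rightarrow> nat \<Rightarrow> nat \<Rightarrow> nat" where
  "vid K T t j s = 3 + ((t * Suc (2 * T) + j) * K + s)"

text \<open>Besides violated neighbour relations, two tiles in one cell conflict as well, so that an
  independent set has at most one vertex per cell.\<close>

definition cell_conf :: "tm \<Rightarrow> tile list \<Rightarrow> nat \<Rightarrow> nat \<Rightarrow> nat \<Rightarrow> nat \<times> nat \<Rightarrow> (nat \<times> nat) list" where
  "cell_conf M tls T t j = (\<lambda>(s, s').
     (if s < s' then [(vid (length tls) T t j s, vid (length tls) T t j s')] else []) @
     (if j < 2 * T \<and> \<not> hrel M (tls ! s) (tls ! s')
      then [(vid (length tls) T t j s, vid (length tls) T t (Suc j) s')] else []) @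
     (if t < T \<and> \<not> vrel M (tls ! s) (tls ! s')
      then [(vid (length tls) T t j s, vid (length tls) T (Suc t) j s')] else []))"

definition conf :: "tm \<Rightarrow> tile list \<Rightarrow> nat \<Rightarrow> (nat \<times> nat) list" where
  "conf M tls T = map (\<lambda>i. (2, i + 3)) [0..<ncell T * length tls] @
     concat (map (\<lambda>t. concat (map (\<lambda>j. concat (map (cell_conf M tls T t j)
       (List.product [0..<length tls] [0..<length tls]))) [0..<Suc (2 * T)])) [0..<Suc T])"

text \<open>Every pair starts from weight \<open>- wB\<close>; the summand \<open>wB\<close> cancels
  it and leaves \<open>wA\<close>, or \<open>wA * (ncell T + 1)\<close> for the marker.\<close>

definition stars :: "tm \<Rightarrow> tile list \<Rightarrow> nat \<Rightarrow> bool list \<Rightarrow> nat \<Rightarrow> (nat \<times> nat) list" where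
  "stars M tls T D l = (2, wB (length tls) T + wA (length tls) T * (ncell T + 1)) #
     concat (map (\<lambda>t. concat (map (\<lambda>j. concat (map (\<lambda>s. if uok M T D l t j (tls ! s)
       then [(vid (length tls) T t j s, wB (length tls) T + wA (length tls) T)] else [])
       [0..<length tls])) [0..<Suc (2 * T)])) [0..<Suc T])"

text \<open>Unit weights with multiplicity. The double loop gives each pair \<open>- wB\<close>
  exactly once; conflict edges then receive \<open>2 * wB\<close>, for a net weight of at least
  \<open>wB\<close>.\<close>

definition feats :: "tm \<Rightarrow> tile list \<Rightarrow> nat \<Rightarrow> bool list \<Rightarrow> nat \<Rightarrow> (feature \<times> int) list" where
  "feats M tls T D l = replicate (wM (length tls) T) (Triangles, -1) @
     concat (map (\<lambda>u. concat (map (\<lambda>v. replicate (wB (length tls) T) (Edge (v + 1) (u + 1), -1)) [0..<u]))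
       [0..<nv (length tls) T]) @
     concat (map (\<lambda>(v, c). replicate c (Edge 1 v, 1)) (stars M tls T D l)) @
     concat (map (\<lambda>(u, v). replicate (2 * wB (length tls) T) (Edge u v, 1)) (conf M tls T))"

lemma mult_add_inj:
  assumes "a * k + s = b * k + s'" "s < k" "s' < (k :: nat)" shows "a = b \<and> s = s'"
proof -
  have "(a * k + s) div k = a" using assms(2) by simp
  moreover have "(b * k + s') div k = b" using assms(3) by simp
  ultimately show ?thesis using assms by simp
qed

lemma vid_inj:
  assumes "vid K T t j s = vid K T t' j' s'" "j \<le> 2 * T" "j' \<le> 2 * T" "s < K" "s' < K"
  shows "t = t' \<and> j = j' \<and> s = s'"
proof -
  have "t * Suc (2 * T) + j = t' * Suc (2 * T) + j' \<and> s = s'"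
    using assms by (intro mult_add_inj[of _ K]) (auto simp: vid_def)
  then show ?thesis using mult_add_inj[of t "Suc (2 * T)" j t' j'] assms by auto
qed

lemma mult_add_less: "a < n \<Longrightarrow> s < k \<Longrightarrow> a * k + s < n * (k :: nat)"
proof -
  assume "a < n" "s < k"
  then have "a * k + s < Suc a * k" by simp
  also have "\<dots> \<le> n * k" using \<open>a < n\<close> by (intro mult_le_mono1) simp
  finally show ?thesis .
qed

lemma vid_range:
  assumes "t \<le> T" "j \<le> 2 * T" "s < K" shows "vid K T t j s \<in> {3..nv K T}"
proof -
  have "t * Suc (2 * T) + j < ncell T" unfolding ncell_def using assms by (intro mult_add_less) auto
  then have "(t * Suc (2 * T) + j) * K + s < ncell T * K" using assms(3) by (rule mult_add_less)
  then show ?thesis by (simp add: vid_def nv_def)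
qed

lemma sum_if_inj:
  assumes "finite Z" "inj_on g Z"
  shows "(\<Sum>z\<in>Z. if g z = v \<and> P z then c else 0) = (if \<exists>z\<in>Z. g z = v \<and> P z then c else (0 :: int))"
proof (cases "\<exists>z\<in>Z. g z = v \<and> P z")
  case True
  then obtain z0 where z0: "z0 \<in> Z" "g z0 = v" "P z0" by blast
  have "(\<Sum>z\<in>Z. if g z = v \<and> P z then c else 0) = (\<Sum>z\<in>Z. if z = z0 then c else 0)"
    using z0 assms(2) by (intro sum.cong refl) (auto dest: inj_onD)
  then show ?thesis using True z0 assms(1) by simp
next
  case False
  then have "(\<Sum>z\<in>Z. if g z = v \<and> P z then c else 0) = 0" by (intro sum.neutral) auto
  then show ?thesis unfolding if_not_P[OF False] .
qed

lemma base_weight: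
  "edge_weight (concat (map (\<lambda>u. concat (map (\<lambda>v. replicate B (Edge (v + 1) (u + 1), -1)) [0..<u])) [0..<n])) e =
    (if e \<in> pairs n then - int B else 0)"
proof -
  let ?Z = "Sigma {..<n} (\<lambda>u. {..<u})"
  have "edge_weight (concat (map (\<lambda>u. concat (map (\<lambda>v. replicate B (Edge (v + 1) (u + 1), -1)) [0..<u])) [0..<n])) e =
    (\<Sum>u\<in>{..<n}. \<Sum>v\<in>{..<u}. if {v + 1, u + 1} = e then - int B else 0)"
    by (simp add: edge_weight_concat edge_weight_replicate interv_sum_list_conv_sum_set_nat atLeast0LessThan
        cong: if_cong)
  also have "\<dots> = (\<Sum>z\<in>?Z. if (\<lambda>(u, v). {v + 1, u + 1}) z = e \<and> True then - int B else 0)"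
    by (subst sum.Sigma) (auto simp: split_beta)
  also have "\<dots> = (if \<exists>z\<in>?Z. (\<lambda>(u, v). {v + 1, u + 1}) z = e \<and> True then - int B else 0)"
    by (rule sum_if_inj) (auto simp: inj_on_def doubleton_eq_iff)
  also have "(\<exists>z\<in>?Z. (\<lambda>(u, v). {v + 1, u + 1}) z = e \<and> True) \<longleftrightarrow> e \<in> pairs n"
  proof
    assume "e \<in> pairs n"
    then obtain u v where "e = {u, v}" "u < v" "1 \<le> u" "v \<le> n" by (rule pairs_cases)
    then show "\<exists>z\<in>?Z. (\<lambda>(u, v). {v + 1, u + 1}) z = e \<and> True"
      by (intro bexI[of _ "(v - 1, u - 1)"]) auto
  qed (auto simp: pairs_iff)
  finally show ?thesis .
qed

lemma in_set_concat_map: "x \<in> set xs \<Longrightarrow> y \<in> set (F x) \<Longrightarrow> y \<in> set (concat (map F xs))"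
  by auto

lemma in_set_concat_map_iff: "y \<in> set (concat (map F xs)) \<longleftrightarrow> (\<exists>x\<in>set xs. y \<in> set (F x))"
  by auto

section \<open>The conflict graph of a tableau and its edge weights\<close>

locale tableau =
  fixes M :: tm and tls :: "tile list" and T :: nat and D :: "bool list" and l :: nat
  assumes M: "turing_machine M" and T: "length D + l \<le> T"
    and tls: "distinct tls" "set tls = tiles M"
begin

abbreviation "K \<equiv> length tls"
abbreviation "n \<equiv> nv K T"
abbreviation "vi \<equiv> vid K T"

definition X :: "nat set" where
  "X = {vi t j s | t j s. t \<le> T \<and> j \<le> 2 * T \<and> s < K \<and> uok M T D l t j (tls ! s)}"

lemma X_I: "t \<le> T \<Longrightarrow> j \<le> 2 * T \<Longrightarrow> s < K \<Longrightarrow> uok M T D l t j (tls ! s) \<Longrightarrow> vi t j s \<in> X"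
  unfolding X_def by blast

definition G :: "nat set set" where
  "G = {{u, v} | u v. (u, v) \<in> set (conf M tls T)}"

lemma K_pos: "0 < K"
proof -
  let ?z = "replicate (ntapes M) 0"
  have "Tile 0 ?z ?z (replicate (ntapes M) 0) \<in> tiles M"
    using M by (auto simp: tiles_def turing_machine_def)
  then show ?thesis using tls(2) by (metis length_greater_0_conv list.set(1) empty_iff)
qed

lemma conf_cases:
  assumes "(u, v) \<in> set (conf M tls T)"
  obtains (marker) "u = 2" "v \<in> {3..n}"
  | (same) t j s s' where "t \<le> T" "j \<le> 2 * T" "s < s'" "s' < K" "u = vi t j s" "v = vi t j s'"
  | (hor) t j s s' where "t \<le> T" "j < 2 * T" "s < K" "s' < K" "\<not> hrel M (tls ! s) (tls ! s')"
      "u = vi t j s" "v = vi t (Suc j) s'"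
  | (ver) t j s s' where "t < T" "j \<le> 2 * T" "s < K" "s' < K" "\<not> vrel M (tls ! s) (tls ! s')"
      "u = vi t j s" "v = vi (Suc t) j s'"
proof -
  have "(u = 2 \<and> v \<in> {3..n}) \<or> (\<exists>t\<le>T. \<exists>j\<le>2 * T. \<exists>s<K. \<exists>s'<K. (u, v) \<in> set (cell_conf M tls T t j (s, s')))"
    using assms by (auto simp: conf_def nv_def less_Suc_eq_le)
  then consider "u = 2" "v \<in> {3..n}" | t j s s' where "t \<le> T" "j \<le> 2 * T" "s < K" "s' < K"
    "(u, v) \<in> set (cell_conf M tls T t j (s, s'))" by blast
  then show ?thesis
  proof cases
    case 2
    from 2(5) show ?thesis unfolding cell_conf_def prod.case set_append
      using same[OF 2(1,2)] hor[OF 2(1) _ 2(3,4)] ver[OF _ 2(2-4)] 2(3,4)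
      by (auto split: if_splits)
  qed (rule marker)
qed

lemma cell_conf_in_G:
  assumes "t \<le> T" "j \<le> 2 * T" "s < K" "s' < K" "(u, v) \<in> set (cell_conf M tls T t j (s, s'))"
  shows "{u, v} \<in> G"
proof -
  have "(u, v) \<in> set (concat (map (cell_conf M tls T t j) (List.product [0..<K] [0..<K])))"
    by (rule in_set_concat_map[of "(s, s')"]) (use assms in simp_all)
  then have "(u, v) \<in> set (concat (map (\<lambda>j. concat (map (cell_conf M tls T t j)
      (List.product [0..<K] [0..<K]))) [0..<Suc (2 * T)]))"
    by - (rule in_set_concat_map[of j], use assms(2) in \<open>auto simp only: set_upt atLeastLessThan_iff less_Suc_eq_le\<close>)
  then have "(u, v) \<in> set (conf M tls T)"
    unfolding conf_def set_append by - (rule UnI2, rule in_set_concat_map[of t], use assms(1) in \<open>auto simp only: set_upt atLeastLessThan_iff less_Suc_eq_le\<close>)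
  then show ?thesis unfolding G_def by blast
qed

lemma G_marker: "v \<in> {3..n} \<Longrightarrow> {2, v} \<in> G"
  unfolding G_def conf_def
  by (rule CollectI, rule exI[of _ 2], rule exI[of _ v])
    (auto simp: nv_def image_iff intro!: bexI[of _ "v - 3"])

lemma G_same: "t \<le> T \<Longrightarrow> j \<le> 2 * T \<Longrightarrow> s < K \<Longrightarrow> s' < K \<Longrightarrow> s \<noteq> s' \<Longrightarrow> {vi t j s, vi t j s'} \<in> G"
proof (cases "s < s'")
  case True
  then show "t \<le> T \<Longrightarrow> j \<le> 2 * T \<Longrightarrow> s < K \<Longrightarrow> s' < K \<Longrightarrow> ?thesis"
    by (intro cell_conf_in_G[of t j s s']) (auto simp: cell_conf_def)
next
  case False
  then show "t \<le> T \<Longrightarrow> j \<le> 2 * T \<Longrightarrow> s < K \<Longrightarrow> s' < K \<Longrightarrow> s \<noteq> s' \<Longrightarrow> ?thesis"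
    unfolding insert_commute[of "vi t j s"]
    by (intro cell_conf_in_G[of t j s' s]) (auto simp: cell_conf_def)
qed

lemma G_hor:
  "t \<le> T \<Longrightarrow> j < 2 * T \<Longrightarrow> s < K \<Longrightarrow> s' < K \<Longrightarrow> \<not> hrel M (tls ! s) (tls ! s') \<Longrightarrow>
   {vi t j s, vi t (Suc j) s'} \<in> G"
  by (intro cell_conf_in_G[of t j s s']) (auto simp: cell_conf_def)

lemma G_ver:
  "t < T \<Longrightarrow> j \<le> 2 * T \<Longrightarrow> s < K \<Longrightarrow> s' < K \<Longrightarrow> \<not> vrel M (tls ! s) (tls ! s') \<Longrightarrow>
   {vi t j s, vi (Suc t) j s'} \<in> G"
  by (intro cell_conf_in_G[of t j s s']) (auto simp: cell_conf_def)

lemma conf_range: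
  assumes "(u, v) \<in> set (conf M tls T)" shows "u \<noteq> v \<and> u \<in> {2..n} \<and> v \<in> {2..n}"
  using assms
proof (cases rule: conf_cases)
  case marker
  then show ?thesis by auto
next
  case (same t j s s')
  then show ?thesis using vid_range[of t T j s K] vid_range[of t T j s' K] vid_inj[of K T t j s t j s'] by force
next
  case (hor t j s s')
  then show ?thesis
    using vid_range[of t T j s K] vid_range[of t T "Suc j" s' K] vid_inj[of K T t j s t "Suc j" s'] by force
next
  case (ver t j s s')
  then show ?thesis
    using vid_range[of t T j s K] vid_range[of "Suc t" T j s' K] vid_inj[of K T t j s "Suc t" j s'] by force
qed

lemma G_pairs: "G \<subseteq> pairs n" "e \<in> G \<Longrightarrow> 1 \<notin> e"
  using conf_range by (fastforce simp: G_def pairs_iff)+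

abbreviation "W \<equiv> edge_weight (feats M tls T D l)"

text \<open>On \<open>G\<close> a lower bound is enough, so repetitions in the list
  \<open>conf\<close> are harmless.\<close>

lemma conf_weight:
  "(e \<in> G \<longrightarrow> 2 * int (wB K T) \<le> edge_weight (concat (map (\<lambda>(u, v). replicate (2 * wB K T) (Edge u v, 1)) (conf M tls T))) e) \<and>
   (e \<notin> G \<longrightarrow> edge_weight (concat (map (\<lambda>(u, v). replicate (2 * wB K T) (Edge u v, 1)) (conf M tls T))) e = 0)"
proof -
  have eq: "edge_weight (concat (map (\<lambda>(u, v). replicate (2 * wB K T) (Edge u v, 1)) xs)) e =
    (\<Sum>(u, v)\<leftarrow>xs. if {u, v} = e then 2 * int (wB K T) else 0)" for xs
    by (simp add: edge_weight_concat case_prod_unfold edge_weight_replicate cong: if_cong)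
  have "((\<exists>(u, v)\<in>set xs. {u, v} = e) \<longrightarrow> 2 * int (wB K T) \<le> (\<Sum>(u, v)\<leftarrow>xs. if {u, v} = e then 2 * int (wB K T) else 0)) \<and>
    ((\<forall>(u, v)\<in>set xs. {u, v} \<noteq> e) \<longrightarrow> (\<Sum>(u, v)\<leftarrow>xs. if {u, v} = e then 2 * int (wB K T) else 0) = 0) \<and>
    0 \<le> (\<Sum>(u, v)\<leftarrow>xs. if {u, v} = e then 2 * int (wB K T) else 0)" for xs
    by (induction xs) (auto simp: split_beta)
  from this[of "conf M tls T"] show ?thesis unfolding eq G_def by blast
qed

text \<open>Here the exact value matters, since it becomes the base of the digits; injectivity of
  \<open>vid\<close> ensures that no vertex is listed twice.\<close>

lemma star_weight:
  assumes "v \<noteq> 1"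
  shows "edge_weight (concat (map (\<lambda>(v, c). replicate c (Edge 1 v, 1)) (stars M tls T D l))) {1, v} =
    (if v = 2 then int (wB K T + wA K T * (ncell T + 1)) else if v \<in> X then int (wB K T + wA K T) else 0)"
proof -
  let ?c = "int (wB K T + wA K T)"
  let ?Z = "{..<Suc T} \<times> {..<Suc (2 * T)} \<times> {..<K}"
  have e1: "{1, u} = {1, v} \<longleftrightarrow> u = v" for u using assms by (auto simp: doubleton_eq_iff)
  have "edge_weight (concat (map (\<lambda>(v, c). replicate c (Edge 1 v, 1)) (concat (map (\<lambda>t. concat (map (\<lambda>j.
      concat (map (\<lambda>s. if uok M T D l t j (tls ! s) then [(vi t j s, wB K T + wA K T)] else []) [0..<K]))
      [0..<Suc (2 * T)])) [0..<Suc T])))) {1, v} =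
    (\<Sum>t\<in>{..<Suc T}. \<Sum>j\<in>{..<Suc (2 * T)}. \<Sum>s\<in>{..<K}. if vi t j s = v \<and> uok M T D l t j (tls ! s) then ?c else 0)"
  proof -
    have a: "concat (map (\<lambda>(v, c). replicate c (Edge 1 v, 1 :: int)) (concat (map F xs))) =
      concat (map (\<lambda>x. concat (map (\<lambda>(v, c). replicate c (Edge 1 v, 1)) (F x))) xs)" for F and xs :: "nat list"
      by (induction xs) auto
    have b: "(\<Sum>x\<leftarrow>(if P then [(u, c)] else []). edge_weight (case x of (v, c) \<Rightarrow> replicate c (Edge 1 v, 1)) {1, v}) =
      (if u = v \<and> P then int c else 0)" for P u c
    proof (cases P)
      case True
      have "edge_weight (replicate c (Edge 1 u, 1)) {1, v} = (if u = v then int c else 0)"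
        using edge_weight_replicate(1)[of c 1 u 1 "{1, v}"] unfolding e1 by simp
      with True show ?thesis by (simp only: if_True list.map sum_list.Cons sum_list.Nil prod.case add_0_right simp_thms)
    qed simp
    show ?thesis unfolding a edge_weight_concat b interv_sum_list_conv_sum_set_nat set_upt atLeast0LessThan ..
  qed
  also have "\<dots> = (\<Sum>z\<in>?Z. if (\<lambda>(t, j, s). vi t j s) z = v \<and> (\<lambda>(t, j, s). uok M T D l t j (tls ! s)) z then ?c else 0)"
    by (simp add: sum.cartesian_product split_beta)
  also have "\<dots> = (if \<exists>z\<in>?Z. (\<lambda>(t, j, s). vi t j s) z = v \<and> (\<lambda>(t, j, s). uok M T D l t j (tls ! s)) z then ?c else 0)"
  proof (rule sum_if_inj)
    show "inj_on (\<lambda>(t, j, s). vi t j s) ?Z"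
      by (rule inj_onI) (auto simp: less_Suc_eq_le dest!: vid_inj)
  qed simp
  also have "(\<exists>z\<in>?Z. (\<lambda>(t, j, s). vi t j s) z = v \<and> (\<lambda>(t, j, s). uok M T D l t j (tls ! s)) z) \<longleftrightarrow> v \<in> X"
  proof
    assume "\<exists>z\<in>?Z. (\<lambda>(t, j, s). vi t j s) z = v \<and> (\<lambda>(t, j, s). uok M T D l t j (tls ! s)) z"
    then obtain t j s where "t \<le> T" "j \<le> 2 * T" "s < K" "vi t j s = v" "uok M T D l t j (tls ! s)"
      by (auto simp: less_Suc_eq_le)
    then show "v \<in> X" using X_I by blast
  next
    assume "v \<in> X"
    then obtain t j s where "t \<le> T" "j \<le> 2 * T" "s < K" "v = vi t j s" "uok M T D l t j (tls ! s)"
      unfolding X_def by blast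
    then show "\<exists>z\<in>?Z. (\<lambda>(t, j, s). vi t j s) z = v \<and> (\<lambda>(t, j, s). uok M T D l t j (tls ! s)) z"
      by (intro bexI[of _ "(t, j, s)"]) (simp_all add: less_Suc_eq_le)
  qed
  finally have main: "edge_weight (concat (map (\<lambda>(v, c). replicate c (Edge 1 v, 1)) (concat (map (\<lambda>t. concat (map (\<lambda>j.
      concat (map (\<lambda>s. if uok M T D l t j (tls ! s) then [(vi t j s, wB K T + wA K T)] else []) [0..<K]))
      [0..<Suc (2 * T)])) [0..<Suc T])))) {1, v} = (if v \<in> X then ?c else 0)" .
  have "2 \<notin> X" unfolding X_def using vid_range by (auto simp: vid_def)
  then show ?thesis
    unfolding stars_def list.map concat.simps prod.case edge_weight_append main edge_weight_replicate(1) e1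
    by auto
qed

lemma star_weight_0:
  assumes "1 \<notin> e"
  shows "edge_weight (concat (map (\<lambda>(v, c). replicate c (Edge 1 v, 1)) xs)) e = 0"
proof -
  have "{1, v} \<noteq> e" for v using assms by auto
  then show ?thesis by (simp add: edge_weight_concat split_beta edge_weight_replicate)
qed

lemma W_eq: "W e = (if e \<in> pairs n then - int (wB K T) else 0) +
    edge_weight (concat (map (\<lambda>(v, c). replicate c (Edge 1 v, 1)) (stars M tls T D l))) e +
    edge_weight (concat (map (\<lambda>(u, v). replicate (2 * wB K T) (Edge u v, 1)) (conf M tls T))) e"
  unfolding feats_def edge_weight_append base_weight edge_weight_replicate(2) by simp

lemma triangle_weight_feats: "triangle_weight (feats M tls T D l) = - int (wM K T)"
  unfolding feats_def triangle_weight_append triangle_weight_replicate(2) triangle_weight_concat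
  by (simp add: triangle_weight_replicate split_beta)

lemma feats_cases:
  assumes "(f, w) \<in> set (feats M tls T D l)"
  shows "valid_feature n f \<and> \<bar>w\<bar> = 1 \<and> (\<forall>s. f \<noteq> Other s)"
proof -
  have X: "v \<in> {2..n}" if vc: "(v, c) \<in> set (stars M tls T D l)" for v c
  proof -
    from vc consider "v = 2" | t j s where "t < Suc T" "j < Suc (2 * T)" "s < K"
      "(v, c) \<in> set (if uok M T D l t j (tls ! s) then [(vi t j s, wB K T + wA K T)] else [])"
      unfolding stars_def list.set insert_iff in_set_concat_map_iff set_upt prod.inject Bex_def atLeastLessThan_iff
      by blast
    then show ?thesis
    proof cases
      case 2
      then have "v = vi t j s" by (auto split: if_splits)
      then show ?thesis using vid_range[OF 2(1,2)[unfolded less_Suc_eq_le] 2(3)] by simp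
    qed (simp add: nv_def)
  qed
  have n2: "2 \<le> n" by (simp add: nv_def)
  from assms consider "f = Triangles" "w = -1"
    | u v where "f = Edge (v + 1) (u + 1)" "w = -1" "v < u" "u < n"
    | v c where "f = Edge 1 v" "w = 1" "(v, c) \<in> set (stars M tls T D l)"
    | u v where "f = Edge u v" "w = 1" "(u, v) \<in> set (conf M tls T)"
    unfolding feats_def by (auto split: prod.splits)
  then show ?thesis
  proof cases
    case 3
    then show ?thesis using X[OF 3(3)] by auto
  next
    case 4
    then show ?thesis using conf_range[OF 4(3)] by auto
  qed (use n2 in auto)
qed

section \<open>Independent sets with one vertex per cell are tilings\<close>

definition IS :: "nat set \<Rightarrow> bool" where
  "IS S \<longleftrightarrow> S \<subseteq> X \<and> (\<forall>u\<in>S. \<forall>v\<in>S. u \<noteq> v \<longrightarrow> {u, v} \<notin> G)"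

definition cells :: "(nat \<times> nat) set" where "cells = {..T} \<times> {..2 * T}"

definition cell_of :: "nat \<Rightarrow> nat \<times> nat" where
  "cell_of v = (THE c. c \<in> cells \<and> (\<exists>s<K. v = vi (fst c) (snd c) s))"

lemma cell_of_vid: "t \<le> T \<Longrightarrow> j \<le> 2 * T \<Longrightarrow> s < K \<Longrightarrow> cell_of (vi t j s) = (t, j)"
  unfolding cell_of_def by (rule the_equality) (auto simp: cells_def dest: vid_inj)

lemma finite_cells: "finite cells" and card_cells: "card cells = ncell T"
  by (simp_all add: cells_def ncell_def card_cartesian_product)

lemma IS_elem:
  assumes "IS S" "v \<in> S"
  obtains t j s where "t \<le> T" "j \<le> 2 * T" "s < K" "uok M T D l t j (tls ! s)" "v = vi t j s"
  using assms unfolding IS_def X_def by blast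

text \<open>Two different vertices of one cell are adjacent by \<open>G_same\<close>. This yields
  the maximal size \<open>ncell T\<close>.\<close>

lemma inj_cell_of:
  assumes "IS S" shows "inj_on cell_of S"
proof (rule inj_onI)
  fix u v assume u: "u \<in> S" and v: "v \<in> S" and eq: "cell_of u = cell_of v"
  obtain t j s where tj: "t \<le> T" "j \<le> 2 * T" "s < K" "u = vi t j s" using IS_elem[OF assms u] by metis
  obtain t' j' s' where tj': "t' \<le> T" "j' \<le> 2 * T" "s' < K" "v = vi t' j' s'" using IS_elem[OF assms v] by metis
  have c: "t = t'" "j = j'" using eq tj tj' cell_of_vid by auto
  show "u = v"
  proof (rule ccontr)
    assume ne: "u \<noteq> v"
    then have "s \<noteq> s'" using tj tj' c by auto
    then have "{u, v} \<in> G" using G_same[of t j s s'] tj tj' c by simp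
    then show False using assms u v ne unfolding IS_def by blast
  qed
qed

lemma cell_of_cells: "IS S \<Longrightarrow> cell_of ` S \<subseteq> cells"
  using cell_of_vid by (auto elim!: IS_elem simp: cells_def)

lemma card_IS: "IS S \<Longrightarrow> card S \<le> ncell T"
  using card_inj_on_le[OF inj_cell_of cell_of_cells finite_cells] by (simp add: card_cells)

definition run :: "bool list \<Rightarrow> nat \<Rightarrow> config" where
  "run y t = (step M ^^ t) (initial_config M (D @ y))"

definition accepted :: "bool list set" where
  "accepted = {y. length y = l \<and> fst (run y T) = 1 \<and> fst (snd (run y T) ! 0) = tape_of [True]}"

definition idx :: "tile \<Rightarrow> nat" where "idx a = (THE s. s < K \<and> tls ! s = a)"

lemma idx: "a \<in> tiles M \<Longrightarrow> idx a < K \<and> tls ! idx a = a"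
proof -
  assume "a \<in> tiles M"
  then obtain s where s: "s < K" "tls ! s = a" using tls(2) by (metis in_set_conv_nth)
  have "\<exists>!s. s < K \<and> tls ! s = a" using s tls(1) by (auto simp: nth_eq_iff_index_eq)
  from theI'[OF this] show ?thesis unfolding idx_def .
qed

lemma idx_nth: assumes s: "s < K" shows "idx (tls ! s) = s"
proof -
  have "tls ! s \<in> tiles M" using s tls(2) nth_mem by blast
  then show ?thesis using idx[of "tls ! s"] nth_eq_iff_index_eq[OF tls(1)] s by blast
qed

definition vset :: "(nat \<Rightarrow> nat \<Rightarrow> tile) \<Rightarrow> nat set" where
  "vset \<tau> = (\<lambda>(t, j). vi t j (idx (\<tau> t j))) ` cells"

lemma tiling_IS:
  assumes "tiling M T D l \<tau>" shows "IS (vset \<tau>) \<and> card (vset \<tau>) = ncell T"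
proof
  have ti: "\<tau> t j \<in> tiles M" "uok M T D l t j (\<tau> t j)" if "t \<le> T" "j \<le> 2 * T" for t j
    using assms that unfolding tiling_def by blast+
  have ix: "idx (\<tau> t j) < K" "tls ! idx (\<tau> t j) = \<tau> t j" if "t \<le> T" "j \<le> 2 * T" for t j
    using idx[OF ti(1)[OF that]] by auto
  have unq: "s = idx (\<tau> t j)" if "vi t j s \<in> vset \<tau>" "j \<le> 2 * T" "s < K" for t j s
    using that ix by (auto simp: vset_def cells_def dest!: vid_inj)
  have no: "{u, v} \<notin> G" if u: "u \<in> vset \<tau>" and v: "v \<in> vset \<tau>" for u v
  proof
    assume "{u, v} \<in> G"
    then obtain a b where ab: "(a, b) \<in> set (conf M tls T)" "a \<in> vset \<tau>" "b \<in> vset \<tau>"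
      using u v unfolding G_def by (auto simp: doubleton_eq_iff)
    from ab(1) show False
    proof (cases rule: conf_cases)
      case marker
      then show ?thesis using ab(2) by (auto simp: vset_def vid_def)
    next
      case (same t j s s')
      then show ?thesis using unq[of t j s] unq[of t j s'] ab by auto
    next
      case (hor t j s s')
      then have "s = idx (\<tau> t j)" "s' = idx (\<tau> t (Suc j))" using unq[of t j s] unq[of t "Suc j" s'] ab by auto
      then show ?thesis using hor ix assms by (simp add: tiling_def)
    next
      case (ver t j s s')
      then have "s = idx (\<tau> t j)" "s' = idx (\<tau> (Suc t) j)" using unq[of t j s] unq[of "Suc t" j s'] ab by auto
      then show ?thesis using ver ix assms by (simp add: tiling_def)
    qed
  qed
  have "vset \<tau> \<subseteq> X"
  proof
    fix v assume "v \<in> vset \<tau>"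
    then obtain t j where "t \<le> T" "j \<le> 2 * T" "v = vi t j (idx (\<tau> t j))" by (auto simp: vset_def cells_def)
    then show "v \<in> X" using X_I[of t j "idx (\<tau> t j)"] ix ti by simp
  qed
  then show "IS (vset \<tau>)" using no by (simp add: IS_def)
  have "inj_on (\<lambda>(t, j). vi t j (idx (\<tau> t j))) cells"
    by (rule inj_onI) (auto simp: cells_def ix dest!: vid_inj)
  then show "card (vset \<tau>) = ncell T" unfolding vset_def by (simp add: card_image card_cells)
qed

text \<open>With at most one vertex per cell and as many vertices as cells, every cell is hit;
  independence then says precisely that neighbouring tiles fit.\<close>

lemma IS_tiling:
  assumes S: "IS S" "card S = ncell T"
  obtains \<tau> where "tiling M T D l \<tau>" "S = vset \<tau>"
proof -
  have "cell_of ` S = cells"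
    using S card_image[OF inj_cell_of[OF S(1)]] card_subset_eq[OF finite_cells cell_of_cells[OF S(1)]]
    by (simp add: card_cells)
  then have ex: "\<exists>s<K. vi t j s \<in> S \<and> uok M T D l t j (tls ! s)" if "t \<le> T" "j \<le> 2 * T" for t j
  proof -
    have "(t, j) \<in> cell_of ` S" using that \<open>cell_of ` S = cells\<close> by (simp add: cells_def)
    then obtain v where v: "v \<in> S" "cell_of v = (t, j)" by auto
    obtain t' j' s where "t' \<le> T" "j' \<le> 2 * T" "s < K" "uok M T D l t' j' (tls ! s)" "v = vi t' j' s"
      by (rule IS_elem[OF S(1) v(1)])
    moreover from this have "t' = t" "j' = j" using v cell_of_vid by auto
    ultimately show ?thesis using v by blast
  qed
  define sg where "sg t j = (SOME s. s < K \<and> vi t j s \<in> S \<and> uok M T D l t j (tls ! s))" for t j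
  have sg: "sg t j < K" "vi t j (sg t j) \<in> S" "uok M T D l t j (tls ! sg t j)" if "t \<le> T" "j \<le> 2 * T" for t j
    using someI_ex[of "\<lambda>s. s < K \<and> vi t j s \<in> S \<and> uok M T D l t j (tls ! s)"] ex[OF that]
    unfolding sg_def by blast+
  define \<tau> where "\<tau> t j = tls ! sg t j" for t j
  have noG: "{u, v} \<notin> G" if "u \<in> S" "v \<in> S" for u v
  proof (cases "u = v")
    case True
    then show ?thesis using G_pairs(1) by (auto simp: pairs_def)
  next
    case False
    then show ?thesis using that S(1) unfolding IS_def by blast
  qed
  have til: "tiling M T D l \<tau>"
    unfolding tiling_def
  proof (intro allI impI conjI)
    fix t j assume tj: "t \<le> T" "j \<le> 2 * T"
    show "\<tau> t j \<in> tiles M" using sg[OF tj] unfolding \<tau>_def tls(2)[symmetric] by simp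
    show "uok M T D l t j (\<tau> t j)" using sg[OF tj] unfolding \<tau>_def by simp
    show "hrel M (\<tau> t j) (\<tau> t (Suc j))" if "j < 2 * T"
    proof (rule ccontr)
      assume "\<not> hrel M (\<tau> t j) (\<tau> t (Suc j))"
      then have "{vi t j (sg t j), vi t (Suc j) (sg t (Suc j))} \<in> G"
        using sg tj that unfolding \<tau>_def by (intro G_hor) auto
      then show False using noG sg tj that by (metis Suc_leI)
    qed
    show "vrel M (\<tau> t j) (\<tau> (Suc t) j)" if "t < T"
    proof (rule ccontr)
      assume "\<not> vrel M (\<tau> t j) (\<tau> (Suc t) j)"
      then have "{vi t j (sg t j), vi (Suc t) j (sg (Suc t) j)} \<in> G"
        using sg tj that unfolding \<tau>_def by (intro G_ver) auto
      then show False using noG sg tj that by (metis Suc_leI)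
    qed
  qed
  have sub: "vset \<tau> \<subseteq> S"
    using sg by (auto simp: vset_def cells_def \<tau>_def idx_nth)
  have "finite S" using S(2) card_ge_0_finite[of S] by (simp add: ncell_def)
  then have "vset \<tau> = S" using card_subset_eq[OF _ sub] tiling_IS[OF til] S(2) by simp
  then show ?thesis using that til by blast
qed

text \<open>The last row shows only the positions up to distance \<open>T\<close>; beyond them
  \<open>blank_outside\<close> supplies the equality with \<open>tape_of [True]\<close>.\<close>

lemma accepted_iff: "y \<in> accepted \<longleftrightarrow> length y = l \<and> tiling M T D l (\<lambda>t. tile_at T (run y t))"
proof (cases "length y = l")
  case True
  have k: "1 \<le> ntapes M" using M by (simp add: turing_machine_def)
  have lr: "length (snd (run y t)) = ntapes M" for t
    using wf_cfg_run[OF M, of t "D @ y"] by (simp add: run_def wf_cfg_def split_beta)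
  show ?thesis
  proof
    assume "y \<in> accepted"
    then show "length y = l \<and> tiling M T D l (\<lambda>t. tile_at T (run y t))"
      using tiling_complete[OF M, of D y T "run y"] T True by (simp add: accepted_def run_def)
  next
    assume "length y = l \<and> tiling M T D l (\<lambda>t. tile_at T (run y t))"
    then have u: "uok M T D l T j (tile_at T (run y T) j)" if "j \<le> 2 * T" for j
      using that unfolding tiling_def by blast
    have q: "fst (run y T) = 1" using u[of 0] by (simp add: uok_def tile_at_def)
    have "fst (snd (run y T) ! 0) p = tape_of [True] p" for p
    proof (cases "\<bar>p\<bar> \<le> int T")
      case True
      define j where "j = nat (p + int T)"
      have j: "j \<le> 2 * T" "int j - int T = p" using True by (auto simp: j_def)
      have "tss (tile_at T (run y T) j) ! 0 = (if j = T then 2 else 0)" using u[OF j(1)] by (simp add: uok_def)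
      moreover have "tss (tile_at T (run y T) j) ! 0 = fst (snd (run y T) ! 0) p"
        using lr[of T] k j(2) by (simp add: nth_tile_at)
      moreover have "j = T \<longleftrightarrow> p = 0" using j by auto
      ultimately show ?thesis by (auto simp: tape_of_def)
    next
      case False
      then show ?thesis
        using blank_outside[OF M, of 0 "D @ y" T T p] k T \<open>length y = l\<close> by (auto simp: run_def tape_of_def)
    qed
    then show "y \<in> accepted" using q True by (auto simp: accepted_def)
  qed
qed (simp add: accepted_def)

text \<open>Injective because the first row displays the certificate, surjective by
  \<open>IS_tiling\<close> and \<open>tiling_sound\<close>.\<close>

lemma card_IS_eq: "card {S. IS S \<and> card S = ncell T} = card accepted"
proof -
  let ?f = "\<lambda>y. vset (\<lambda>t. tile_at T (run y t))"
  have "bij_betw ?f accepted {S. IS S \<and> card S = ncell T}"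
  proof (rule bij_betw_imageI)
    show "inj_on ?f accepted"
    proof (rule inj_onI)
      fix y y' assume y: "y \<in> accepted" and y': "y' \<in> accepted" and eq: "?f y = ?f y'"
      have k: "1 \<le> ntapes M" using M by (simp add: turing_machine_def)
      have l: "length y = l" "length y' = l" using y y' by (auto simp: accepted_def)
      have tls: "tile_at T (run z t) j \<in> tiles M" if "z \<in> accepted" "t \<le> T" "j \<le> 2 * T" for z t j
        using that accepted_iff[of z] unfolding tiling_def by blast
      have same: "tile_at T (run y t) j = tile_at T (run y' t) j" if tj: "t \<le> T" "j \<le> 2 * T" for t j
      proof -
        let ?a = "idx (tile_at T (run y t) j)"
        have "vi t j ?a \<in> ?f y'" using tj unfolding eq[symmetric] by (auto simp: vset_def cells_def)
        then have "?a = idx (tile_at T (run y' t) j)"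
          using idx[OF tls[OF y tj]] idx[OF tls[OF y']] tj by (auto simp: vset_def cells_def dest!: vid_inj)
        then show ?thesis using idx[OF tls[OF y tj]] idx[OF tls[OF y' tj]] by metis
      qed
      have c0: "tss (tile_at T (run z 0) j) ! 0 = tape_of (D @ z) (int j - int T)" for z j
      proof -
        have "length (snd (run z 0)) = ntapes M"
          using wf_cfg_initial[OF M] by (simp add: run_def wf_cfg_def split_beta)
        then show ?thesis using k initial_tape[of 0 M "D @ z"] by (simp add: nth_tile_at run_def)
      qed
      show "y = y'"
      proof (rule nth_equalityI)
        fix i assume i: "i < length y"
        let ?j = "T + length D + i"
        have "?j \<le> 2 * T" using T i l by simp
        then have "tape_of (D @ y) (int ?j - int T) = tape_of (D @ y') (int ?j - int T)"
          unfolding c0[symmetric] using same[of 0 ?j] by simp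
        then have "bitsym (y ! i) = bitsym (y' ! i)"
          using tape_of_append_eq[of T ?j D y] tape_of_append_eq[of T ?j D y'] i l by simp
        then show "y ! i = y' ! i" by (simp add: bitsym_def split: if_splits)
      qed (simp add: l)
    qed
    show "?f ` accepted = {S. IS S \<and> card S = ncell T}"
    proof
      show "?f ` accepted \<subseteq> {S. IS S \<and> card S = ncell T}"
        using accepted_iff tiling_IS by auto
      show "{S. IS S \<and> card S = ncell T} \<subseteq> ?f ` accepted"
      proof
        fix S assume "S \<in> {S. IS S \<and> card S = ncell T}"
        then obtain \<tau> where \<tau>: "tiling M T D l \<tau>" "S = vset \<tau>" using IS_tiling by blast
        obtain y where y: "length y = l"
          "\<And>t j. t \<le> T \<Longrightarrow> j \<le> 2 * T \<Longrightarrow> \<tau> t j = tile_at T (run y t) j"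
          using tiling_sound[OF M T \<tau>(1)] unfolding run_def by metis
        have "tiling M T D l (\<lambda>t. tile_at T (run y t))"
          using \<tau>(1) y(2) unfolding tiling_def by auto
        moreover have "S = ?f y" unfolding \<tau>(2) vset_def using y(2) by (intro image_cong) (auto simp: cells_def)
        ultimately show "S \<in> ?f ` accepted" using accepted_iff y(1) by blast
      qed
    qed
  qed
  then show ?thesis by (simp add: bij_betw_same_card)
qed

text \<open>\<open>m\<close> is instantiated by the number of cells, which needs to be only an upper
  bound on the size of independent sets: if nothing is accepted, the digit is 0.\<close>

theorem partition_function_eq:
  "\<exists>(C :: nat) r. 0 \<le> r \<and> r < 2 ^ (wA K T * ncell T) \<and>
    partition_function ext \<lparr>num_vertices = n, weighted_features = feats M tls T D l\<rparr> =
    2 ^ C * (2 ^ (wA K T * (ncell T + 1)) + of_nat (card accepted) * 2 ^ (wA K T * ncell T) + r)"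
proof -
  have Kn: "ncell T * 1 \<le> ncell T * K" using K_pos by (intro mult_le_mono2) linarith
  have nc: "1 \<le> ncell T" by (simp add: ncell_def)
  have n3: "3 \<le> n" "ncell T + 1 \<le> n" using Kn nc unfolding nv_def by linarith+
  have "partition_function ext \<lparr>num_vertices = n, weighted_features = feats M tls T D l\<rparr> =
    (\<Sum>H\<in>Pow (pairs n). 2 powi ((\<Sum>e\<in>H. W e) - int (wM K T) * int (triangle_count H)))"
    unfolding partition_function_def
  proof (intro sum.cong)
    fix H assume "H \<in> Pow (pairs n)"
    then have "finite H" using finite_subset finite_pairs by auto
    moreover have "(Other s, w) \<notin> set (feats M tls T D l)" for s w using feats_cases by blast
    ultimately show "density ext \<lparr>num_vertices = n, weighted_features = feats M tls T D l\<rparr> H =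
      2 powi ((\<Sum>e\<in>H. W e) - int (wM K T) * int (triangle_count H))"
      by (subst density_eq) (auto simp: triangle_weight_feats)
  qed (auto simp: simple_graphs_def pairs_def)
  moreover have "\<exists>(C :: nat) (r :: rat). 0 \<le> r \<and> r < 2 ^ (wA K T * ncell T) \<and>
    (\<Sum>H\<in>Pow (pairs n). 2 powi ((\<Sum>e\<in>H. W e) - int (wM K T) * int (triangle_count H))) =
    2 ^ C * (2 ^ (wA K T * (ncell T + 1)) + of_nat (card {S. IS S \<and> card S = ncell T}) * 2 ^ (wA K T * ncell T) + r)"
  proof (rule partition_sum_independent_sets[where G = G and X = X and IS = IS and n = n and B = "wB K T"])
    show "G \<subseteq> pairs n" by (rule G_pairs)
    show "1 \<notin> e" if "e \<in> G" for e using G_pairs(2)[OF that] .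
    show "int (wB K T) \<le> W e" if "e \<in> G" for e
      using conf_weight[of e] star_weight_0[of e "stars M tls T D l"] G_pairs that by (auto simp: W_eq)
    show "W e \<le> - int (wB K T)" if "e \<in> pairs n" "1 \<notin> e" "e \<notin> G" for e
      using conf_weight[of e] star_weight_0[of e "stars M tls T D l"] that by (simp add: W_eq)
    have st: "W {1, v} = (if v = 2 then int (wA K T * (ncell T + 1)) else if v \<in> X then int (wA K T) else - int (wB K T))"
      if "v \<in> {2..n}" for v
    proof -
      have "{1, v} \<notin> G" using G_pairs(2) by blast
      moreover have "{1, v} \<in> pairs n" using that by (simp add: pairs_iff)
      moreover have "v \<noteq> 1" using that by auto
      ultimately show ?thesis using conf_weight[of "{1, v}"] star_weight[of v] by (simp add: W_eq)
    qed
    show X3: "X \<subseteq> {3..n}" using vid_range unfolding X_def by blast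
    show "W {1, v} = int (wA K T)" if "v \<in> X" for v using st[of v] X3 that by force
    show "W {1, 2} = int (wA K T * (ncell T + 1))" using st[of 2] n3 by simp
    show "W {1, v} \<le> - int (wB K T)" if "v \<in> {3..n}" "v \<notin> X" for v using st[of v] that by simp
    show "{2, v} \<in> G" if "v \<in> {3..n}" for v using G_marker[OF that] .
    show "IS S \<longleftrightarrow> S \<subseteq> X \<and> (\<forall>u\<in>S. \<forall>v\<in>S. u \<noteq> v \<longrightarrow> {u, v} \<notin> G)" for S by (rule IS_def)
    show "card S \<le> ncell T" if "IS S" for S using card_IS[OF that] .
  qed (use n3 nc in \<open>auto simp: wA_def wM_def wB_def\<close>)
  ultimately show ?thesis unfolding card_IS_eq by simp
qed

end

section \<open>Reading off the count\<close>

lemma nat_bits_div: "nat_bits (n div 2 ^ k) = drop k (nat_bits n)"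
proof (induction k arbitrary: n)
  case (Suc k)
  have "nat_bits (n div 2 ^ Suc k) = drop k (nat_bits (n div 2))"
    using Suc[of "n div 2"] by (simp add: div_mult2_eq)
  also have "\<dots> = drop (Suc k) (nat_bits n)"
    by (subst (2) nat_bits.simps) (simp add: nat_bits.simps[of 0])
  finally show ?case .
qed simp

primrec padbits :: "nat \<Rightarrow> nat \<Rightarrow> bool list" where
  "padbits 0 N = []"
| "padbits (Suc A) N = odd N # padbits A (N div 2)"

lemma length_padbits: "length (padbits A N) = A"
  by (induction A arbitrary: N) auto

lemma nat_bits_top: "N < 2 ^ A \<Longrightarrow> nat_bits (2 ^ A + N) = padbits A N @ [True]"
proof (induction A arbitrary: N)
  case 0
  then show ?case by (simp add: nat_bits.simps)
next
  case (Suc A)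
  have "nat_bits (2 ^ Suc A + N) = odd N # nat_bits ((2 ^ Suc A + N) div 2)"
    by (subst nat_bits.simps) simp
  also have "(2 ^ Suc A + N) div 2 = 2 ^ A + N div 2" by simp
  finally show ?case using Suc.IH[of "N div 2"] Suc.prems by simp
qed

definition strip_step :: "bool list \<Rightarrow> bool list \<Rightarrow> bool list" where
  "strip_step ys acc = (case ys of [] \<Rightarrow> [] | b # _ \<Rightarrow>
     if b then True # acc else (case acc of [] \<Rightarrow> [] | b # _ \<Rightarrow> if b then False # acc else False # acc))"

lemma strip_padbits: "N < 2 ^ A \<Longrightarrow> prec strip_step [] (padbits A N) = nat_bits N"
proof (induction A arbitrary: N)
  case 0
  then show ?case by (simp add: nat_bits.simps)
next
  case (Suc A)
  have "prec strip_step [] (padbits A (N div 2)) = nat_bits (N div 2)" using Suc by simp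
  moreover have "nat_bits (N div 2) = [] \<longleftrightarrow> N div 2 = 0" by (subst nat_bits.simps) simp
  ultimately show ?case
    by (subst nat_bits.simps) (auto simp: strip_step_def split: list.splits)
qed

lemma length_strip: "length (prec strip_step [] xs) \<le> length xs"
  by (induction xs) (auto simp: strip_step_def split: list.splits)

lemma PB_even: "PU \<Gamma> n \<Longrightarrow> PB \<Gamma> (\<lambda>e. even (n e))"
proof -
  assume n: "PU \<Gamma> n"
  let ?G = "\<lambda>(e :: bool list) (ys :: bool list) acc. case acc of [] \<Rightarrow> [True] | b # _ \<Rightarrow> if b then [] else []"
  have eq: "prec (?G e) [True] x = (if even (length x) then [True] else [])" for e x
    by (induction x) auto
  have "PF [\<lambda>x. x] (\<lambda>z. prec (?G z) [True] z)"
  proof (rule PF_prec)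
    show "pbd (clen [\<lambda>x. x]) (\<lambda>e. 1)" by (rule pbd_const)
  qed ((rule PF_case PF_const | (rule PF_var, simp add: lift_def))+, simp add: eq)
  then have "PF [\<lambda>x. x] (\<lambda>x. if even (length x) then [True] else [])" by (simp add: eq)
  from PF_app1[OF this n] show ?thesis by (simp add: PB_def)
qed

text \<open>\<open>k\<close> is the total length, so the parity test tells marker positions from
  data positions as counted from the left. Working from the right, whatever was collected from
  beyond the code is discarded when its terminating \<open>False\<close> is reached; data bits
  before it are then kept.\<close>

definition undelimit_step :: "nat \<Rightarrow> bool list \<Rightarrow> bool list \<Rightarrow> bool list" where
  "undelimit_step k ys acc = (if even (k + length ys)
     then (case ys of [] \<Rightarrow> [] | b # _ \<Rightarrow> if b then acc else [])
     else (case ys of [] \<Rightarrow> [] | b # _ \<Rightarrow> if b then True # acc else False # acc))"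

lemma undelimit:
  "even (k + length (delimit xs @ zs)) \<Longrightarrow> prec (undelimit_step k) [] (delimit xs @ zs) = xs"
  by (induction xs) (auto simp: delimit_simps undelimit_step_def)

lemma length_undelimit: "length (prec (undelimit_step k) [] xs) \<le> length xs"
  by (induction xs) (auto simp: undelimit_step_def split: list.splits)

lemma PF_undelimit:
  "PF \<Gamma> a \<Longrightarrow> PF \<Gamma> (\<lambda>e. prec (undelimit_step (length (a e))) [] (a e))"
proof (rule PF_app1[where F = "\<lambda>x. prec (undelimit_step (length x)) [] x"])
  show "PF [\<lambda>x. x] (\<lambda>x. prec (undelimit_step (length x)) [] x)"
  proof (rule PF_prec)
    show "pbd (clen [\<lambda>x. x]) (clen [\<lambda>x. x])" by (rule pbd_self)
    show "length (prec (undelimit_step (length e)) [] (drop n e)) \<le> clen [\<lambda>x. x] e" for e n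
      using length_undelimit[of "length e" "drop n e"] by (simp add: clen_def)
    show "PF (lift [\<lambda>x. x] @ [\<lambda>z. fst (snd z), \<lambda>z. snd (snd z)])
      (\<lambda>z. undelimit_step (length (fst z)) (snd (snd z)) (fst (snd z)))"
      unfolding undelimit_step_def
      by (rule PF_if PB_even PU_add PU_length PF_case PF_Cons PF_Nil | (rule PF_var, simp add: lift_def))+
  qed (rule PF_Nil | (rule PF_var, simp))+
qed

lemma PF_strip: "PF \<Gamma> a \<Longrightarrow> PF \<Gamma> (\<lambda>e. prec strip_step [] (a e))"
proof (rule PF_app1[where F = "prec strip_step []"])
  show "PF [\<lambda>x. x] (\<lambda>x. prec ((\<lambda>_. strip_step) x) [] x)"
  proof (rule PF_prec)
    show "pbd (clen [\<lambda>x. x]) (clen [\<lambda>x. x])" by (rule pbd_self)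
    show "length (prec strip_step [] (drop n e)) \<le> clen [\<lambda>x. x] e" for e n
      using length_strip[of "drop n e"] by (simp add: clen_def)
    show "PF (lift [\<lambda>x. x] @ [\<lambda>z. fst (snd z), \<lambda>z. snd (snd z)])
      (\<lambda>z. strip_step (snd (snd z)) (fst (snd z)))"
      unfolding strip_step_def
      by (rule PF_case PF_Cons PF_Nil | (rule PF_var, simp add: lift_def))+
  qed (rule PF_Nil | (rule PF_var, simp))+
qed

text \<open>The leading bit of the numerator is the contribution of the marker vertex; the following
  \<open>A\<close> bits are the count.\<close>

definition decode :: "nat \<Rightarrow> bool list \<Rightarrow> bool list" where
  "decode A out = (let w = tl out; L = prec (undelimit_step (length w)) [] w
     in prec strip_step [] (drop (length L - Suc A) (rev (tl (rev L)))))"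

lemma PF_decode: "PU \<Gamma> A \<Longrightarrow> PF \<Gamma> out \<Longrightarrow> PF \<Gamma> (\<lambda>e. decode (A e) (out e))"
  unfolding decode_def Let_def
  by (intro PF_strip PF_drop PU_diff PU_Suc PU_length PF_rev PF_tl PF_undelimit)

text \<open>\<open>decode\<close> does not know \<open>k\<close>; it finds the \<open>Suc A\<close>
  leading bits from the length of the numerator, which is why the leading 1 is
  indispensable.\<close>

lemma decode_eq:
  assumes a: "a div 2 ^ k = 2 ^ A + N" and N: "N < 2 ^ A"
  shows "decode A (encode_int (int a) @ zs) = nat_bits N"
proof -
  let ?w = "delimit (nat_bits a) @ zs" and ?L = "nat_bits a"
  have "even (length ?w + length ?w)" by simp
  from undelimit[OF this] have u: "prec (undelimit_step (length ?w)) [] ?w = ?L" .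
  have d: "drop k ?L = padbits A N @ [True]"
    using nat_bits_div[of a k] nat_bits_top[OF N] a by simp
  have "length ?L - k = Suc A" using arg_cong[OF d, of length] by (simp add: length_padbits)
  then have l: "length ?L - Suc A = k" by linarith
  have "drop (length ?L - Suc A) (rev (tl (rev ?L))) = butlast (drop k ?L)"
    unfolding l drop_butlast[symmetric] using butlast_rev[of "rev ?L"] by simp
  then show ?thesis
    using strip_padbits[OF N] u
    by (simp add: decode_def encode_int_def encode_nat_def Let_def d)
qed

lemma tape_of_inj:
  assumes "tape_of xs = tape_of ys" shows "xs = ys"
proof -
  have iff: "i < length zs \<longleftrightarrow> tape_of zs (int i) \<noteq> 0" for zs i by (auto simp: tape_of_def)
  have "i < length xs \<longleftrightarrow> i < length ys" for i using iff[of i xs] iff[of i ys] assms by simp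
  then have l: "length xs = length ys" by (metis linorder_neqE_nat order_less_irrefl)
  show ?thesis
  proof (rule nth_equalityI[OF l])
    fix i assume "i < length xs"
    then show "xs ! i = ys ! i"
      using fun_cong[OF assms, of "int i"] l by (simp add: tape_of_def split: if_splits)
  qed
qed

section \<open>The reduction is polynomial\<close>

definition encode_features :: "(feature \<times> int) list \<Rightarrow> bool list" where
  "encode_features fs = concat (map (\<lambda>(f, w). [True] @ encode_feature f @ encode_int w) fs)"

lemma encode_features_append: "encode_features (fs @ gs) = encode_features fs @ encode_features gs"
  by (simp add: encode_features_def)

lemma encode_features_concat:
  "encode_features (concat (map F xs)) = concat (map (\<lambda>x. encode_features (F x)) xs)"
  by (induction xs) (simp_all add: encode_features_def)

lemma length_encode_features: "length fs \<le> length (encode_features fs)"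
  by (induction fs) (auto simp: encode_features_def)

definition PE :: "('e \<Rightarrow> bool list) list \<Rightarrow> ('e \<Rightarrow> (feature \<times> int) list) \<Rightarrow> bool" where
  "PE \<Gamma> fs \<longleftrightarrow> PF \<Gamma> (\<lambda>e. encode_features (fs e))"

lemma PF_lift:
  assumes "PF \<Gamma> f" shows "PF (lift \<Gamma> @ \<Delta>) (\<lambda>z. f (fst z))"
  using PF_reindex[OF assms, of fst] by (rule PF_weaken) (simp add: lift_def)

lemma PE_append: "PE \<Gamma> a \<Longrightarrow> PE \<Gamma> b \<Longrightarrow> PE \<Gamma> (\<lambda>e. a e @ b e)"
  unfolding PE_def encode_features_append by (rule PF_append)

lemma PE_loop:
  "PU \<Gamma> n \<Longrightarrow> PE (lift \<Gamma> @ [\<lambda>z. replicate (snd z) True]) (\<lambda>z. F (fst z) (snd z)) \<Longrightarrow>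
   PE \<Gamma> (\<lambda>e. concat (map (F e) [0..<n e]))"
  unfolding PE_def encode_features_concat by (rule PF_loop)

lemma PE_concat_const:
  "(\<And>s. s \<in> set l \<Longrightarrow> PE \<Gamma> (f s)) \<Longrightarrow> PE \<Gamma> (\<lambda>e. concat (map (\<lambda>s. f s e) l))"
  unfolding PE_def encode_features_concat by (rule PF_concat_const)

lemma PE_if: "PB \<Gamma> P \<Longrightarrow> PE \<Gamma> a \<Longrightarrow> PE \<Gamma> (\<lambda>e. if P e then a e else [])"
  unfolding PE_def using PF_if[of \<Gamma> P "\<lambda>e. encode_features (a e)" "\<lambda>e. encode_features []"]
  by (simp add: PF_const if_distrib cong: if_cong)

lemma PE_replicate:
  assumes c: "PU \<Gamma> c" and f: "PF \<Gamma> (\<lambda>e. encode_feature (f e))"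
  shows "PE \<Gamma> (\<lambda>e. replicate (c e) (f e, w))"
proof -
  have eq: "concat (map (\<lambda>_. encode_features [a]) [0..<k]) = encode_features (replicate k a)" for a k
    by (induction k) (simp_all add: encode_features_def flip: replicate_append_same)
  have "PF \<Gamma> (\<lambda>e. encode_features [(f e, w)])"
    unfolding encode_features_def using f by (auto intro!: PF_Cons PF_append PF_const)
  from PF_loop[OF c PF_lift[OF this]] show ?thesis unfolding PE_def eq .
qed

lemma PE_edges: "PU \<Gamma> c \<Longrightarrow> PU \<Gamma> u \<Longrightarrow> PU \<Gamma> v \<Longrightarrow> PE \<Gamma> (\<lambda>e. replicate (c e) (Edge (u e) (v e), w))"
  by (rule PE_replicate) (auto simp: encode_nat_def intro!: PF_Cons PF_append PF_delimit PF_nat_bits)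

lemma PE_triangles: "PU \<Gamma> c \<Longrightarrow> PE \<Gamma> (\<lambda>e. replicate (c e) (Triangles, w))"
  by (rule PE_replicate) (simp_all add: PF_const)

lemma PU_power: "PU \<Gamma> n \<Longrightarrow> PU \<Gamma> (\<lambda>e. n e ^ k)"
proof (induction k)
  case 0
  then show ?case using PU_const[of \<Gamma> 1] by simp
qed (auto intro: PU_mult)

lemma PU_sizes:
  assumes "PU \<Gamma> T"
  shows "PU \<Gamma> (\<lambda>e. ncell (T e))" "PU \<Gamma> (\<lambda>e. nv K (T e))" "PU \<Gamma> (\<lambda>e. wA K (T e))"
    "PU \<Gamma> (\<lambda>e. wM K (T e))" "PU \<Gamma> (\<lambda>e. wB K (T e))"
  unfolding wB_def wM_def wA_def nv_def ncell_def
  by (intro PU_add PU_mult PU_power PU_Suc PU_const assms)+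

lemma PU_vid: "PU \<Gamma> T \<Longrightarrow> PU \<Gamma> t \<Longrightarrow> PU \<Gamma> j \<Longrightarrow> PU \<Gamma> (\<lambda>e. vid K (T e) (t e) (j e) s)"
  unfolding vid_def by (intro PU_add PU_mult PU_Suc PU_const)

text \<open>The tile is fixed, so all conditions on its components are constants; what remains to
  compute are comparisons of unary numbers and one lookup in \<open>D\<close>.\<close>

lemma PB_uok:
  assumes T: "PU \<Gamma> T" and D: "PF \<Gamma> D" and l: "PU \<Gamma> l" and t: "PU \<Gamma> t" and j: "PU \<Gamma> j"
  shows "PB \<Gamma> (\<lambda>e. uok M (T e) (D e) (l e) (t e) (j e) a)"
proof -
  let ?s = "tss a ! 0"
  let ?g = "\<lambda>z. \<forall>i<ntapes M. tgs a ! i = z"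
  let ?d = "\<lambda>e. drop (j e - T e) (D e)"
  have eq: "uok M (T e) (D e) (l e) (t e) (j e) a \<longleftrightarrow>
     (t e = 0 \<longrightarrow> (tq a = 0 \<and> (\<forall>i<ntapes M. i \<noteq> 0 \<longrightarrow> tss a ! i = 0)) \<and>
        (if j e < T e then ?g 1 else if T e < j e then ?g (-1) else ?g 0) \<and>
        (if j e < T e then ?s = 0
         else if j e - T e < length (D e) then (if ?d e \<noteq> [] \<and> hd (?d e) then ?s = 2 else ?s = 1)
         else if j e - T e < length (D e) + l e then ?s \<in> {1, 2}
         else ?s = 0)) \<and>
     (t e = T e \<longrightarrow> tq a = 1 \<and> (if j e = T e then ?s = 2 else ?s = 0))" for e
  proof -
    have 1: "(\<forall>i<ntapes M. tgs a ! i = sgn (int (T e) - int (j e))) \<longleftrightarrow>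
      (if j e < T e then ?g 1 else if T e < j e then ?g (-1) else ?g 0)" by simp
    have 2: "j e - T e < length (D e) \<Longrightarrow>
      (?s = bitsym (D e ! (j e - T e))) \<longleftrightarrow> (if ?d e \<noteq> [] \<and> hd (?d e) then ?s = 2 else ?s = 1)"
      by (simp add: hd_drop_conv_nth bitsym_def)
    show ?thesis unfolding uok_def 1 using 2 by (auto split: if_splits)
  qed
  show ?thesis unfolding eq
    by (intro PB_conj PB_imp PB_if PB_const PB_less PB_eq PB_hd PF_drop PU_diff PU_add PU_length
        T D l t j PF_const)
qed

lemma concat_map_concat: "concat (map h (concat (map F xs))) = concat (map (\<lambda>x. concat (map h (F x))) xs)"
  by (induction xs) auto

lemma concat_map_if: "concat (map h (if P then [a] else [])) = (if P then h a else [])"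
  by simp

text \<open>The tiles are fixed, so loops over them are unrolled. Loops over vertices, times and
  columns are run; \<open>\<Gamma>1\<close> and \<open>\<Gamma>2\<close> are the contexts with one
  and two such counters.\<close>

lemma PE_feats:
  fixes tls :: "tile list"
  assumes T: "PU \<Gamma> T" and D: "PF \<Gamma> D" and l: "PU \<Gamma> l"
  shows "PE \<Gamma> (\<lambda>e. feats M tls (T e) (D e) (l e))"
proof -
  let ?K = "length tls"
  let ?U = "\<lambda>z. replicate (snd z) True"
  define \<Gamma>1 where "\<Gamma>1 = lift \<Gamma> @ [\<lambda>z :: 'a \<times> nat. ?U z]"
  define \<Gamma>2 where "\<Gamma>2 = lift \<Gamma>1 @ [\<lambda>z :: ('a \<times> nat) \<times> nat. ?U z]"
  have T1: "PU \<Gamma>1 (\<lambda>z. T (fst z))" unfolding \<Gamma>1_def by (rule PF_lift[OF T])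
  have T2: "PU \<Gamma>2 (\<lambda>z. T (fst (fst z)))" unfolding \<Gamma>2_def by (rule PF_lift[OF T1])
  have D2: "PF \<Gamma>2 (\<lambda>z. D (fst (fst z)))"
    unfolding \<Gamma>2_def by (rule PF_lift[where f = "\<lambda>z. D (fst z)"]) (simp add: \<Gamma>1_def PF_lift[OF D])
  have l2: "PU \<Gamma>2 (\<lambda>z. l (fst (fst z)))"
    unfolding \<Gamma>2_def
    by (rule PF_lift[where f = "\<lambda>z. replicate (l (fst z)) True"]) (simp add: \<Gamma>1_def PF_lift[OF l])
  have i1: "PU \<Gamma>1 snd" unfolding \<Gamma>1_def by (rule PF_var) simp
  have t2: "PU \<Gamma>2 (\<lambda>z. snd (fst z))" unfolding \<Gamma>2_def by (rule PF_lift[OF i1])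
  have j2: "PU \<Gamma>2 snd" unfolding \<Gamma>2_def by (rule PF_var) simp
  note v2 = PU_vid[OF T2] and B2 = PU_sizes[OF T2]
  have base: "PE \<Gamma> (\<lambda>e. concat (map (\<lambda>u. concat (map (\<lambda>v. replicate (wB ?K (T e)) (Edge (v + 1) (u + 1), -1)) [0..<u]))
       [0..<nv ?K (T e)]))"
  proof (rule PE_loop[OF PU_sizes(2)[OF T], folded \<Gamma>1_def], rule PE_loop[OF i1, folded \<Gamma>2_def])
    show "PE \<Gamma>2 (\<lambda>z. replicate (wB ?K (T (fst (fst z)))) (Edge (snd z + 1) (snd (fst z) + 1), -1))"
      by (intro PE_edges PU_add PU_const B2 t2 j2)
  qed
  have star: "PE \<Gamma> (\<lambda>e. concat (map (\<lambda>(v, c). replicate c (Edge 1 v, 1)) (stars M tls (T e) (D e) (l e))))"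
    unfolding stars_def list.map concat.simps prod.case concat_map_concat concat_map_if
  proof (rule PE_append)
    show "PE \<Gamma> (\<lambda>e. replicate (wB ?K (T e) + wA ?K (T e) * (ncell (T e) + 1)) (Edge 1 2, 1))"
      by (intro PE_edges PU_add PU_mult PU_const PU_sizes T)
    show "PE \<Gamma> (\<lambda>e. concat (map (\<lambda>t. concat (map (\<lambda>j. concat (map (\<lambda>s. if uok M (T e) (D e) (l e) t j (tls ! s)
      then replicate (wB ?K (T e) + wA ?K (T e)) (Edge 1 (vid ?K (T e) t j s), 1) else []) [0..<?K]))
      [0..<Suc (2 * T e)])) [0..<Suc (T e)]))"
    proof (rule PE_loop[OF PU_Suc[OF T], folded \<Gamma>1_def],
        rule PE_loop[OF PU_Suc[OF PU_mult[OF PU_const T1]], folded \<Gamma>2_def], rule PE_concat_const)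
      fix s
      show "PE \<Gamma>2 (\<lambda>z. if uok M (T (fst (fst z))) (D (fst (fst z))) (l (fst (fst z))) (snd (fst z)) (snd z) (tls ! s)
        then replicate (wB ?K (T (fst (fst z))) + wA ?K (T (fst (fst z))))
          (Edge 1 (vid ?K (T (fst (fst z))) (snd (fst z)) (snd z) s), 1) else [])"
        by (intro PE_if PB_uok PE_edges PU_add PU_const v2 B2 T2 D2 l2 t2 j2)
    qed
  qed
  have conf: "PE \<Gamma> (\<lambda>e. concat (map (\<lambda>(u, v). replicate (2 * wB ?K (T e)) (Edge u v, 1)) (conf M tls (T e))))"
    unfolding conf_def map_append concat_append concat_map_concat map_map o_def prod.case
  proof (rule PE_append)
    show "PE \<Gamma> (\<lambda>e. concat (map (\<lambda>i. replicate (2 * wB ?K (T e)) (Edge 2 (i + 3), 1)) [0..<ncell (T e) * ?K]))"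
    proof (rule PE_loop[OF PU_mult[OF PU_sizes(1)[OF T] PU_const], folded \<Gamma>1_def])
      show "PE \<Gamma>1 (\<lambda>z. replicate (2 * wB ?K (T (fst z))) (Edge 2 (snd z + 3), 1))"
        by (intro PE_edges PU_add PU_mult PU_const PU_sizes T1 i1)
    qed
    show "PE \<Gamma> (\<lambda>e. concat (map (\<lambda>t. concat (map (\<lambda>j. concat (map (\<lambda>p. concat (map
      (\<lambda>(u, v). replicate (2 * wB ?K (T e)) (Edge u v, 1)) (cell_conf M tls (T e) t j p)))
      (List.product [0..<?K] [0..<?K]))) [0..<Suc (2 * T e)])) [0..<Suc (T e)]))"
    proof (rule PE_loop[OF PU_Suc[OF T], folded \<Gamma>1_def],
        rule PE_loop[OF PU_Suc[OF PU_mult[OF PU_const T1]], folded \<Gamma>2_def], rule PE_concat_const)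
      fix p :: "nat \<times> nat"
      obtain s s' where p: "p = (s, s')" by force
      show "PE \<Gamma>2 (\<lambda>z. concat (map (\<lambda>(u, v). replicate (2 * wB ?K (T (fst (fst z)))) (Edge u v, 1))
        (cell_conf M tls (T (fst (fst z))) (snd (fst z)) (snd z) p)))"
        unfolding p cell_conf_def prod.case map_append concat_append concat_map_if
        by (intro PE_append PE_if PB_conj PB_const PB_less PE_edges PU_mult PU_const PU_Suc v2 B2 T2 t2 j2)
    qed
  qed
  show ?thesis unfolding feats_def
    by (intro PE_append PE_triangles base star conf PU_sizes T)
qed

section \<open>Size of the partition function\<close>

text \<open>A denominator in lowest terms divides \<open>2 ^ E\<close> and is thus a power of two,
  so reducing the fraction merely shifts the binary digits.\<close>

lemma quotient_of_dyadic:
  assumes "Z * 2 ^ E = of_int z" "quotient_of Z = (a, b)"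
  obtains e where "e \<le> E" "b = 2 ^ e" "Z * 2 ^ e = of_int a"
proof -
  have b: "0 < b" and cop: "coprime a b" and Z: "Z = of_int a / of_int b"
    using assms(2) quotient_of_denom_pos quotient_of_coprime quotient_of_div by blast+
  have "(of_int (a * 2 ^ E) :: rat) = of_int (z * b)"
    using assms(1) b unfolding Z by (simp add: field_simps)
  then have "a * 2 ^ E = z * b" by (simp only: of_int_eq_iff)
  then have "b dvd a * 2 ^ E" by simp
  then have "b dvd 2 ^ E" using cop by (simp add: coprime_dvd_mult_right_iff coprime_commute)
  then have "int (nat b) dvd int (2 ^ E)" using b by simp
  then have "nat b dvd 2 ^ E" unfolding of_nat_dvd_iff .
  then obtain e where e: "e \<le> E" "nat b = 2 ^ e"
    using divides_primepow_nat[OF two_is_prime_nat] by blast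
  have be: "b = 2 ^ e" using e(2) b by (metis less_imp_le nat_0_le of_nat_numeral of_nat_power)
  have "Z * 2 ^ e = of_int a" unfolding Z be by simp
  then show ?thesis using that e(1) be by blast
qed

lemma powi_dyadic: "\<bar>x\<bar> \<le> int E \<Longrightarrow> (2 :: rat) powi x * 2 ^ E = of_int (2 ^ nat (x + int E))"
proof -
  assume "\<bar>x\<bar> \<le> int E"
  then have "(2 :: rat) powi (x + int E) = 2 ^ nat (x + int E)" by (intro power_int_nonneg_exp) simp
  then show ?thesis by (simp add: power_int_add)
qed

text \<open>\<open>n ^ 3\<close> bounds the triangle count and, because of \<open>1 \<le> n\<close>,
  also an edge indicator; each unit-weight feature shifts the exponent by at most this much.\<close>

lemma density_exponent:
  assumes H: "H \<in> simple_graphs n" and n: "1 \<le> n"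
    and fs: "\<And>f w. (f, w) \<in> set fs \<Longrightarrow> \<bar>w\<bar> = 1 \<and> (\<forall>s. f \<noteq> Other s)"
  shows "\<exists>x. \<bar>x\<bar> \<le> int (length fs * n ^ 3) \<and>
    density ext \<lparr>num_vertices = n, weighted_features = fs\<rparr> H = 2 powi x"
  using fs
proof (induction fs)
  case Nil
  then show ?case by (intro exI[of _ 0]) (simp add: density_def)
next
  case (Cons a fs)
  obtain f w where a: "a = (f, w)" by force
  obtain x where x: "\<bar>x\<bar> \<le> int (length fs * n ^ 3)"
    "density ext \<lparr>num_vertices = n, weighted_features = fs\<rparr> H = 2 powi x"
    using Cons by (metis list.set_intros(2))
  have fw: "\<bar>w\<bar> = 1" "\<And>s. f \<noteq> Other s" using Cons.prems[of f w] a by auto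
  have "feature_value ext n f H \<le> n ^ 3"
  proof (cases f)
    case (Edge u v)
    then show ?thesis using n by simp
  next
    case Triangles
    then show ?thesis using triangle_count_le[of H n] H by (simp add: simple_graphs_def pairs_def)
  qed (use fw in auto)
  then have "\<bar>int (feature_value ext n f H) * w\<bar> \<le> int (n ^ 3)"
    using fw(1) by (simp add: abs_mult flip: of_nat_power)
  then have "\<bar>int (feature_value ext n f H) * w + x\<bar> \<le> int (length (a # fs) * n ^ 3)"
    using x(1) by simp
  moreover have "density ext \<lparr>num_vertices = n, weighted_features = a # fs\<rparr> H =
    2 powi (int (feature_value ext n f H) * w + x)"
    using x(2) by (simp add: density_def a power_int_add)
  ultimately show ?case by blast
qed

lemma partition_function_bounds:
  fixes ext :: feature_meaning
  assumes n: "1 \<le> n" and fs: "\<And>f w. (f, w) \<in> set fs \<Longrightarrow> \<bar>w\<bar> = 1 \<and> (\<forall>s. f \<noteq> Other s)"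
  defines "Z \<equiv> partition_function ext \<lparr>num_vertices = n, weighted_features = fs\<rparr>"
    and "E \<equiv> length fs * n ^ 3"
  shows "\<exists>z. Z * 2 ^ E = of_int z" "0 < Z" "Z \<le> 2 ^ (n ^ 2 + E)"
proof -
  have sg: "simple_graphs n = Pow (pairs n)" by (simp add: simple_graphs_def pairs_def)
  have "\<forall>H\<in>simple_graphs n. \<exists>x. \<bar>x\<bar> \<le> int E \<and>
      density ext \<lparr>num_vertices = n, weighted_features = fs\<rparr> H = 2 powi x"
    unfolding E_def by (intro ballI density_exponent n) (assumption | erule fs)+
  from bchoice[OF this] obtain x where x: "\<And>H. H \<in> simple_graphs n \<Longrightarrow> \<bar>x H\<bar> \<le> int E"
    "\<And>H. H \<in> simple_graphs n \<Longrightarrow> density ext \<lparr>num_vertices = n, weighted_features = fs\<rparr> H = 2 powi x H"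
    by blast
  have Z: "Z = (\<Sum>H\<in>simple_graphs n. 2 powi x H)" unfolding Z_def partition_function_def using x(2) by simp
  have "Z * 2 ^ E = (\<Sum>H\<in>simple_graphs n. of_int (2 ^ nat (x H + int E)))"
    unfolding Z sum_distrib_right using x(1) by (intro sum.cong refl powi_dyadic)
  then show "\<exists>z. Z * 2 ^ E = of_int z" by (metis of_int_sum)
  have fin: "finite (simple_graphs n)" unfolding sg by (simp add: finite_pairs)
  show "0 < Z" unfolding Z using fin by (intro sum_pos) (auto simp: sg)
  have "Z \<le> (\<Sum>H\<in>simple_graphs n. 2 ^ E)"
    unfolding Z
  proof (intro sum_mono)
    fix H assume "H \<in> simple_graphs n"
    then have "(2::rat) powi x H \<le> 2 powi int E" using x(1)[of H] by (intro powi_mono) simp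
    then show "(2::rat) powi x H \<le> 2 ^ E" by simp
  qed
  also have "\<dots> = 2 ^ card (pairs n) * 2 ^ E" unfolding sg by (simp add: card_Pow finite_pairs)
  also have "\<dots> \<le> 2 ^ (n ^ 2) * 2 ^ E" by (intro mult_right_mono power_increasing card_pairs) auto
  finally show "Z \<le> 2 ^ (n ^ 2 + E)" by (simp add: power_add)
qed

lemma length_encode_int: "\<bar>k\<bar> < 2 ^ L \<Longrightarrow> length (encode_int k) \<le> 2 * L + 2"
proof -
  assume "\<bar>k\<bar> < 2 ^ L"
  then have "nat \<bar>k\<bar> < 2 ^ L" by (simp add: nat_less_iff)
  then show ?thesis using length_nat_bits[of "nat \<bar>k\<bar>" L] by (simp add: encode_int_def encode_nat_def length_delimit)
qed

lemma length_encode_partition_function: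
  assumes n: "1 \<le> n" and fs: "\<And>f w. (f, w) \<in> set fs \<Longrightarrow> \<bar>w\<bar> = 1 \<and> (\<forall>s. f \<noteq> Other s)"
  shows "length (encode_rat (partition_function ext \<lparr>num_vertices = n, weighted_features = fs\<rparr>))
    \<le> 8 * (n ^ 2 + 2 * (length fs * n ^ 3) + 1)"
proof -
  let ?Z = "partition_function ext \<lparr>num_vertices = n, weighted_features = fs\<rparr>"
  let ?E = "length fs * n ^ 3"
  \<comment> \<open>\<open>n ^ 2 + ?E\<close> for the size of the partition function, another
    \<open>?E\<close> for clearing the denominator, and 1 to make the bound strict.\<close>
  let ?L = "n ^ 2 + 2 * ?E + 1"
  note Z = partition_function_bounds[OF n fs, where ext = ext]
  obtain z where z: "?Z * 2 ^ ?E = of_int z" using Z(1) by blast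
  obtain a b where q: "quotient_of ?Z = (a, b)" by force
  obtain e where e: "e \<le> ?E" "b = 2 ^ e" "?Z * 2 ^ e = of_int a" by (rule quotient_of_dyadic[OF z q])
  have a0: "0 < a" using e(3) Z(2) by (metis of_int_0_less_iff zero_less_mult_iff zero_less_numeral zero_less_power)
  have "(of_int a :: rat) \<le> 2 ^ (n ^ 2 + ?E) * 2 ^ ?E"
    unfolding e(3)[symmetric] using Z(2,3) e(1) by (intro mult_mono power_increasing) auto
  also have "\<dots> < 2 ^ ?L" unfolding power_add[symmetric] by (rule power_strict_increasing) simp_all
  finally have "(of_int a :: rat) < of_int (2 ^ ?L)" by simp
  then have a: "\<bar>a\<bar> < 2 ^ ?L" using a0 by (simp only: of_int_less_iff abs_of_pos)
  have "(2::int) ^ e < 2 ^ ?L" using e(1) by (intro power_strict_increasing) auto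
  then have b: "\<bar>b\<bar> < 2 ^ ?L" by (simp add: e(2))
  show ?thesis
    using length_encode_int[OF a] length_encode_int[OF b] by (simp add: encode_rat_def q)
qed

lemma decode_partition_function:
  assumes n: "1 \<le> n" and fs: "\<And>f w. (f, w) \<in> set fs \<Longrightarrow> \<bar>w\<bar> = 1 \<and> (\<forall>s. f \<noteq> Other s)"
    and Z: "partition_function ext \<lparr>num_vertices = n, weighted_features = fs\<rparr> =
      2 ^ C * (2 ^ (A * (m + 1)) + of_nat N * 2 ^ (A * m) + r)"
    and r: "0 \<le> r" "r < 2 ^ (A * m)" and N: "N < 2 ^ A"
  shows "decode A (encode_rat (partition_function ext \<lparr>num_vertices = n, weighted_features = fs\<rparr>)) = nat_bits N"
proof -
  let ?Z = "partition_function ext \<lparr>num_vertices = n, weighted_features = fs\<rparr>"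
  note Zb = partition_function_bounds[OF n fs, where ext = ext]
  obtain z where z: "?Z * 2 ^ (length fs * n ^ 3) = of_int z" using Zb(1) by blast
  obtain a b where q: "quotient_of ?Z = (a, b)" by force
  obtain e where e: "b = 2 ^ e" "?Z * 2 ^ e = of_int a" by (rule quotient_of_dyadic[OF z q])
  have a0: "0 < a" using e(2) Zb(2) by (metis of_int_0_less_iff zero_less_mult_iff zero_less_numeral zero_less_power)
  \<comment> \<open>The unknown shift: \<open>e\<close> from the denominator, \<open>C\<close> from
    the common factor, and \<open>A * m\<close> for the part below the digit, which division by
    \<open>2 ^ k\<close> cuts off together with \<open>r\<close>.\<close>
  define k where "k = e + C + A * m"
  have ak: "(of_int a :: rat) = 2 ^ k * (2 ^ A + of_nat N) + 2 ^ (e + C) * r"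
    unfolding e(2)[symmetric] Z k_def by (simp add: power_add algebra_simps)
  have r2: "0 \<le> 2 ^ (e + C) * r" "2 ^ (e + C) * r < 2 ^ k"
    using r unfolding k_def power_add[of 2 "e + C"] by (simp_all add: mult_strict_left_mono)
  have nata: "(of_nat (nat a) :: rat) = of_int a" using a0 by simp
  have "(of_nat (2 ^ k * (2 ^ A + N)) :: rat) \<le> of_nat (nat a)"
    unfolding nata ak using r2 by simp
  then have 1: "2 ^ k * (2 ^ A + N) \<le> nat a" by (simp only: of_nat_le_iff)
  have "(of_nat (nat a) :: rat) < of_nat (2 ^ k * Suc (2 ^ A + N))"
    unfolding nata ak using r2 by (simp add: algebra_simps)
  then have 2: "nat a < 2 ^ k * Suc (2 ^ A + N)" by (simp only: of_nat_less_iff)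
  have "nat a div 2 ^ k = 2 ^ A + N" using 1 2 by (intro div_nat_eqI)
  from decode_eq[OF this N, of "encode_int b"] show ?thesis
    using a0 by (simp add: encode_rat_def q)
qed

section \<open>Hardness\<close>

text \<open>The verifier is fixed before the input, so its tiles are constants of the reduction and
  only the side lengths of the tableau grow with \<open>x\<close>.\<close>

lemma sharpP_polytime:
  assumes alg: "output_polytime_algorithm ergms encode_ergm (\<lambda>E. encode_rat (partition_function ext E))"
    and f: "f \<in> sharpP"
  shows "polytime_computable (\<lambda>x. nat_bits (f x))"
proof -
  obtain O' po where O': "turing_machine O'" "\<And>E. E \<in> ergms \<Longrightarrow> computes_within O' (encode_ergm E)
      (encode_rat (partition_function ext E))
      (poly po (length (encode_ergm E) + length (encode_rat (partition_function ext E))))"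
    using alg unfolding output_polytime_algorithm_def by blast
  obtain V p where V: "polytime_computable V"
    and fx: "\<And>x. f x = card {y. length y = poly p (length x) \<and> V (delimit x @ y) = [True]}"
    using f unfolding sharpP_def by blast
  obtain M q where M: "turing_machine M" and q: "\<And>w. computes_within M w (V w) (poly q (length w))"
    using V unfolding polytime_computable_def polytime_algorithm_def by auto
  obtain tls where tls: "set tls = tiles M" "distinct tls" using finite_distinct_list[OF finite_tiles] by blast
  let ?K = "length tls"
  define l where "l x = poly p (length x)" for x :: "bool list"
  define N where "N x = length (delimit x) + l x" for x
  \<comment> \<open>At least the length of the verifier's input, so that it fits into the columns,
    and at least its running time, so that it has halted in the last row.\<close>
  define T where "T x = N x + poly q (N x)" for x
  have tab: "tableau M tls (T x) (delimit x) (l x)" for x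
    using M tls by unfold_locales (auto simp: T_def N_def)
  define fs where "fs x = feats M tls (T x) (delimit x) (l x)" for x
  define E where "E x = \<lparr>num_vertices = nv ?K (T x), weighted_features = fs x\<rparr>" for x
  define ans where "ans x = encode_rat (partition_function ext (E x))" for x
  have fs: "valid_feature (nv ?K (T x)) g \<and> \<bar>w\<bar> = 1 \<and> (\<forall>s. g \<noteq> Other s)" if "(g, w) \<in> set (fs x)" for x g w
    using tableau.feats_cases[OF tab] that unfolding fs_def by blast
  have nv1: "1 \<le> nv ?K (T x)" for x by (simp add: nv_def)
  have E_ergms: "E x \<in> ergms" for x using fs by (auto simp: ergms_def E_def)
  have acc: "tableau.accepted M (T x) (delimit x) (l x) =
    {y. length y = l x \<and> V (delimit x @ y) = [True]}" for x
  proof -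
    have "fst (tableau.run M (delimit x) y (T x)) = 1 \<and>
      fst (snd (tableau.run M (delimit x) y (T x)) ! 0) = tape_of (V (delimit x @ y))"
      if "length y = l x" for y
    proof -
      have "computes_within M (delimit x @ y) (V (delimit x @ y)) (T x)"
        using that by (intro computes_within_mono[OF q]) (simp add: T_def N_def)
      then show ?thesis
        unfolding computes_within_def tableau.run_def[OF tab] by (simp add: split_beta Let_def)
    qed
    then show ?thesis
      unfolding tableau.accepted_def[OF tab] using tape_of_inj by fastforce
  qed
  have dec: "decode (wA ?K (T x)) (ans x) = nat_bits (f x)" for x
  proof -
    interpret tableau M tls "T x" "delimit x" "l x" by (rule tab)
    obtain C r where r: "0 \<le> r" "r < 2 ^ (wA ?K (T x) * ncell (T x))"
      and Z: "partition_function ext (E x) = 2 ^ C * (2 ^ (wA ?K (T x) * (ncell (T x) + 1)) +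
        of_nat (card accepted) * 2 ^ (wA ?K (T x) * ncell (T x)) + r)"
      using partition_function_eq[of ext] unfolding E_def fs_def by blast
    have fa: "f x = card accepted" using fx[of x] acc[of x] unfolding l_def by simp
    \<comment> \<open>There are \<open>2 ^ l x\<close> candidate certificates and
      \<open>l x \<le> T x\<close>, which is below \<open>wA\<close>; so the count fits into a
      single digit.\<close>
    have "f x < 2 ^ wA ?K (T x)"
    proof -
      have fin: "finite {y :: bool list. set y \<subseteq> UNIV \<and> length y = l x}" by (intro finite_lists_length_eq) simp
      have "f x \<le> card {y :: bool list. set y \<subseteq> UNIV \<and> length y = l x}"
        unfolding fx by (intro card_mono[OF fin]) (auto simp: l_def)
      also have "\<dots> = 2 ^ l x" by (subst card_lists_length_eq) (auto simp: card_UNIV_bool)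
      also have "\<dots> < 2 ^ wA ?K (T x)"
      proof (rule power_strict_increasing)
        have "T x * 1 \<le> ncell (T x) * ?K"
          using K_pos by (intro mult_le_mono) (simp add: ncell_def, linarith)
        moreover have "l x \<le> T x" by (simp add: T_def N_def)
        ultimately show "l x < wA ?K (T x)" by (simp add: wA_def nv_def)
      qed simp
      finally show ?thesis .
    qed
    then have lt: "card accepted < 2 ^ wA ?K (T x)" unfolding fa .
    show ?thesis
      unfolding ans_def E_def fa
      by (rule decode_partition_function[OF nv1 _ Z[unfolded E_def] r lt]) (use fs in blast)
  qed
  have var: "PF [\<lambda>x. x] (\<lambda>x. x)" by (rule PF_var) simp
  have PD: "PF [\<lambda>x. x] delimit" by (rule PF_delimit[OF var])
  have Pl: "PU [\<lambda>x. x] l" unfolding l_def by (intro PU_poly PU_length var)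
  have PN: "PU [\<lambda>x. x] N" unfolding N_def by (intro PU_add PU_length PD Pl)
  have PT: "PU [\<lambda>x. x] T" unfolding T_def by (intro PU_add PU_poly PN)
  have red: "PF [\<lambda>x. x] (\<lambda>x. encode_ergm (E x))"
  proof -
    have "PF [\<lambda>x. x] (\<lambda>x. encode_features (fs x))"
      using PE_feats[OF PT PD Pl] unfolding fs_def PE_def .
    then have "PF [\<lambda>x. x] (\<lambda>x. replicate (nv ?K (T x)) True @ [False] @ encode_features (fs x) @ [False])"
      by (intro PF_append PF_const PU_sizes PT)
    then show ?thesis by (simp add: encode_ergm_def E_def encode_features_def)
  qed
  have c1: "clen [\<lambda>x. x] = length" by (simp add: clen_def fun_eq_iff)
  have lans: "pbd length (\<lambda>x. length (ans x))"
  proof (rule pbd_le)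
    show "length (ans x) \<le> 8 * (nv ?K (T x) ^ 2 + 2 * (length (encode_ergm (E x)) * nv ?K (T x) ^ 3) + 1)" for x
    proof -
      have "length (fs x) \<le> length (encode_ergm (E x))"
        using length_encode_features[of "fs x"] by (simp add: encode_ergm_def E_def encode_features_def)
      moreover have "length (ans x) \<le> 8 * (nv ?K (T x) ^ 2 + 2 * (length (fs x) * nv ?K (T x) ^ 3) + 1)"
        unfolding ans_def E_def using fs by (intro length_encode_partition_function nv1) blast
      ultimately show ?thesis by (meson add_mono le_trans mult_le_mono order_refl)
    qed
    show "pbd length (\<lambda>x. 8 * (nv ?K (T x) ^ 2 + 2 * (length (encode_ergm (E x)) * nv ?K (T x) ^ 3) + 1))"
      using PF_len[OF red] PU_len[OF PU_sizes(2)[OF PT]] unfolding c1 by (intro pbd_intros)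
  qed
  have post: "PF [fst, snd] (\<lambda>z. decode (wA ?K (T (fst z))) (snd z))"
  proof (rule PF_decode)
    have "PU [fst] (\<lambda>z :: bool list \<times> bool list. wA ?K (T (fst z)))"
      using PF_reindex[OF PU_sizes(3)[OF PT], of fst] by simp
    then show "PU [fst, snd] (\<lambda>z :: bool list \<times> bool list. wA ?K (T (fst z)))"
      by (rule PF_weaken) simp
  qed (rule PF_var, simp)
  have "polytime_computable (\<lambda>x. decode (wA ?K (T x)) (ans x))"
    by (rule subroutine_composition[OF O'(1) _ red lans post]) (use O'(2)[OF E_ergms] in \<open>simp add: ans_def\<close>)
  then show ?thesis unfolding dec .
qed

lemma polytime_imp_output_polytime:
  "polytime_algorithm A inp out \<Longrightarrow> output_polytime_algorithm A inp out"
  unfolding polytime_algorithm_def output_polytime_algorithm_def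
  by (meson computes_within_mono le_add1 poly_mono_nat)

theorem theorem2:
  fixes ext :: feature_meaning
  assumes "\<not> P_eq_sharpP"
  shows "\<not> polytime_algorithm ergms encode_ergm (\<lambda>E. encode_rat (partition_function ext E)) \<and>
         \<not> output_polytime_algorithm ergms encode_ergm (\<lambda>E. encode_rat (partition_function ext E))"
  using assms sharpP_polytime polytime_imp_output_polytime unfolding P_eq_sharpP_def by blast

end
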